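(* Let $R$ be a regular ring essentially of finite type over an $F$-finite field of characteristic $p>0$. Let $(M,\kappa)$ be an $F$-regular Cartier module over $R$ (finitely generated as an $R$-module) and let $f\in R$ be a non zero-divisor on $M$. Then for all sufficiently large $e$ the roots of the Bernstein-Sato polynomial $b^e_{M,f}(s)\in\mathbb{Q}[s]$ are exactly the numbers $$\frac{\lceil \lambda p^e\rceil-1}{p^e},$$ where $\lambda$ varies over the $F$-jumping numbers in $(0,1]$ of the test module filtration $\tau(M,f^t)$.
   Context: Rings are commutative, Noetherian and of characteristic $p>0$. $F^e_*R$ (resp. $F^e_*M$) is $R$ (resp. $M$) as an abelian group with $R$-action $r\cdot m=r^{p^e}m$; $R$ is $F$-finite if $F_*R$ is a finite $R$-module. Cartier modules. A Cartier module is an $R$-module $M$ with an $R$-linear map $\kappa:F_*M\to M$ (i.e. additive with $\kappa(r^pm)=r\kappa(m)$); a Cartier submodule is an $R$-submodule $N$ with $\kappa(N)\subseteq N$. $M$ is $F$-pure if $\kappa$ is surjective. $M$ is $F$-regular if it is $F$-pure and every Cartier submodule $N\subseteq M$ which agrees with $M$ after localizing at every generic point of $\operatorname{Supp}M$ equals $M$. Test modules. For $M$ finitely generated and $F$-regular, $f$ a non zero-divisor on $M$ and $t\in\mathbb{R}_{\ge0}$, let $\mathcal{C}$ be the Cartier algebra generated (over $R$) by the $\kappa^nf^{\lceil tp^n\rceil}$, $n\ge1$; for a submodule $N\subseteq M$ put $\mathcal{C}_+N=\sum_{n\ge1}\kappa^n(f^{\lceil tp^n\rceil}N)$, and let $\underline{M}_{\mathcal{C}}=(\mathcal{C}_+)^hM$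 for $h\gg0$ (this stabilizes). The test module is $\tau(M,f^t)=\sum_{e\ge1}\kappa^e(f^{\lceil tp^e\rceil}f\,\underline{M}_{\mathcal{C}})$. These submodules decrease in $t$ and are right continuous. A number $t$ is an $F$-jumping number if $\tau(M,f^t)\ne\tau(M,f^{t-\varepsilon})$ for all $\varepsilon>0$. Differential operators. $\mathcal{D}^e_R=\operatorname{End}_R(F^e_*R)$. There is an inclusion $\mathcal{D}^e_R\to\mathcal{D}^e_{R[t]}$ extending $P$ by $P(bt^j)=P(b)t^j$ for $b\in R$, $j\ge0$. The operator $\theta_m=t^m\partial_t^{[m]}$ on $R[t]$ is the $R$-linear map $t^n\mapsto\binom nm t^n$. $\mathcal{D}^e_R[\theta_1,\theta_p,\dots,\theta_{p^{e-1}}]\subseteq\mathcal{D}^e_{R[t]}$ is the subring generated by $\mathcal{D}^e_R$ and these $\theta$'s. Bernstein-Sato polynomials. Let $\gamma:\operatorname{Spec}R\to\operatorname{Spec}R[t]$ be the graph embedding of $f$ ($t\mapsto f$), so $\gamma_*M$ is $M$ with $t$ acting as $f$. The module $\operatorname{Hom}_{R[t]}(F^e_*R[t],\gamma_*M)$ is a right $\mathcal{D}^e_{R[t]}$-module by precomposition. For a submodule $N\subseteq M$ let $\gamma_*C^e(N)$ be its subset consisting of the maps $g(t)\mapsto\kappa^e(g(f)n)$, $n\in N$. Put $A^e=(\gamma_*C^e(M))\,\mathcal{D}^e_R[\theta_1,\dots,\theta_{p^{e-1}}]$ (the right submodule generated) and $N^e=A^e/A^et$, where $A^et=(\gamma_*C^e(fM))\,\mathcal{D}^e_R[\theta_1,\dots,\theta_{p^{e-1}}]$.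 Then $N^e$ is a right $\mathcal{D}^e_R[\theta_1,\dots,\theta_{p^{e-1}}]$-module and decomposes as $\bigoplus_{i\in\mathbb{F}_p^e}N^e_i$, where $\theta_{p^{l-1}}$ acts on $N^e_i$ as multiplication by $i_l$ for $1\le l\le e$. Identify $\mathbb{F}_p$ with $\{0,\dots,p-1\}$ and let $\Gamma^e_f$ be the set of $i=(i_1,\dots,i_e)$ with $N^e_i\neq0$. Then $$b^e_{M,f}(s)=\prod_{i\in\Gamma^e_f}\Bigl(s-\Bigl(\frac{i_e}{p}+\cdots+\frac{i_1}{p^e}\Bigr)\Bigr)\in\mathbb{Q}[s].$$ *)

theory Defs
  imports "HOL-Algebra.Algebraic_Closure_Type" "HOL-Library.Extended_Nat"
begin

text \<open>
  The ring \<open>R\<close> is a type \<open>'r :: comm_ring_1\<close>, its modules are given by a scalar multiplication on an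
  abelian group type (locale \<open>Modules.module\<close>), and \<open>R[t]\<close> is the type \<open>'r poly\<close>.  Where a library
  notion exists only for ring records (ideals, localizations), \<open>R\<close> is viewed as the record
  \<^const>\<open>ring_of_type_algebra\<close>.
\<close>


section \<open>Localization, support, regular rings\<close>

abbreviation prime_ideal :: "'r::comm_ring_1 set \<Rightarrow> bool" where
  "prime_ideal P \<equiv> primeideal P (ring_of_type_algebra :: 'r ring)"

text \<open>The fraction \<open>m/s\<close> in \<open>S\<inverse>M\<close>, as an equivalence class of pairs.\<close>

definition frac_class ::
  "('r::comm_ring_1 \<Rightarrow> 'm::ab_group_add \<Rightarrow> 'm) \<Rightarrow> 'r set \<Rightarrow> 'm \<Rightarrow> 'r \<Rightarrow> ('m \<times> 'r) set" where
  "frac_class scale S m s =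
     {(m', s'). s' \<in> S \<and> (\<exists>u\<in>S. scale u (scale s' m) = scale u (scale s m'))}"

text \<open>For a submodule \<open>N \<subseteq> M\<close>, this is \<open>S\<inverse>N\<close> viewed as a submodule of \<open>S\<inverse>M\<close>.\<close>

definition localize ::
  "('r::comm_ring_1 \<Rightarrow> 'm::ab_group_add \<Rightarrow> 'm) \<Rightarrow> 'r set \<Rightarrow> 'm set \<Rightarrow> ('m \<times> 'r) set set" where
  "localize scale S N = {frac_class scale S n s | n s. n \<in> N \<and> s \<in> S}"

definition localization_ring :: "'r::comm_ring_1 set \<Rightarrow> ('r \<times> 'r) set ring" where
  "localization_ring S =
     \<lparr> carrier = localize (*) S UNIV,
       monoid.mult = (\<lambda>U V. \<Union>(a, s)\<in>U. \<Union>(b, t)\<in>V. frac_class (*) S (a * b) (s * t)),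
       one = frac_class (*) S 1 1,
       ring.zero = frac_class (*) S 0 1,
       add = (\<lambda>U V. \<Union>(a, s)\<in>U. \<Union>(b, t)\<in>V. frac_class (*) S (t * a + s * b) (s * t)) \<rparr>"

definition module_support ::
  "('r::comm_ring_1 \<Rightarrow> 'm::ab_group_add \<Rightarrow> 'm) \<Rightarrow> 'r set set" where
  "module_support scale =
     {P. prime_ideal P \<and> localize scale (- P) UNIV \<noteq> {frac_class scale (- P) 0 1}}"

definition generic_points :: "'r set set \<Rightarrow> 'r set set" where
  "generic_points Z = {P \<in> Z. \<forall>Q\<in>Z. Q \<subseteq> P \<longrightarrow> Q = P}"

definition krull_dim :: "('a, 'b) ring_scheme \<Rightarrow> enat" where
  "krull_dim A =
     (SUP n \<in> {n. \<exists>Q. (\<forall>i\<le>n. primeideal (Q i) A) \<and> (\<forall>i<n. Q i \<subset> Q (Suc i))}. enat n)"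

definition regular_local_ring :: "('a, 'b) ring_scheme \<Rightarrow> bool" where
  "regular_local_ring A \<longleftrightarrow>
     cring A \<and> noetherian_ring A \<and> (\<exists>!I. maximalideal I A) \<and>
     (\<exists>G \<subseteq> carrier A. finite G \<and> enat (card G) = krull_dim A \<and> maximalideal (genideal A G) A)"

definition regular_ring :: "'r::comm_ring_1 itself \<Rightarrow> bool" where
  "regular_ring T \<longleftrightarrow>
     noetherian_ring (ring_of_type_algebra :: 'r ring) \<and>
     (\<forall>P :: 'r set. prime_ideal P \<longrightarrow> regular_local_ring (localization_ring (- P)))"


section \<open>Finiteness conditions\<close>

definition fin_gen_module :: "('r::comm_ring_1 \<Rightarrow> 'm::ab_group_add \<Rightarrow> 'm) \<Rightarrow> bool" where
  "fin_gen_module scale \<longleftrightarrow> (\<exists>B. finite B \<and> module.span scale B = UNIV)"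

text \<open>The scalar multiplication below is that of \<open>F\<^sub>*R\<close>.\<close>

definition F_finite :: "nat \<Rightarrow> 'r::comm_ring_1 itself \<Rightarrow> bool" where
  "F_finite p T \<longleftrightarrow> fin_gen_module (\<lambda>r x :: 'r. r ^ p * x)"

text \<open>The \<open>k\<close>-subalgebra of \<open>R\<close> generated by \<open>G\<close>, where \<open>\<phi> : k \<rightarrow> R\<close> is the structure map.\<close>

inductive_set subalgebra_gen :: "('k::comm_ring_1 \<Rightarrow> 'r::comm_ring_1) \<Rightarrow> 'r set \<Rightarrow> 'r set"
  for \<phi> :: "'k \<Rightarrow> 'r" and G :: "'r set" where
  const: "\<phi> c \<in> subalgebra_gen \<phi> G"
| gen: "x \<in> G \<Longrightarrow> x \<in> subalgebra_gen \<phi> G"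
| add: "x \<in> subalgebra_gen \<phi> G \<Longrightarrow> y \<in> subalgebra_gen \<phi> G \<Longrightarrow> x + y \<in> subalgebra_gen \<phi> G"
| mult: "x \<in> subalgebra_gen \<phi> G \<Longrightarrow> y \<in> subalgebra_gen \<phi> G \<Longrightarrow> x * y \<in> subalgebra_gen \<phi> G"

text \<open>
  \<open>R\<close> is a localization of a finitely generated \<open>k\<close>-algebra.  Replacing that algebra by its image
  \<open>A\<close> in \<open>R\<close>, this says that every element of \<open>R\<close> has the form \<open>a/s\<close> with \<open>a, s \<in> A\<close> and \<open>s\<close> a
  unit of \<open>R\<close>.
\<close>

definition ess_finite_type :: "('k::comm_ring_1 \<Rightarrow> 'r::comm_ring_1) \<Rightarrow> bool" where
  "ess_finite_type \<phi> \<longleftrightarrow>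
     (\<exists>G. finite G \<and>
       (\<forall>r. \<exists>a \<in> subalgebra_gen \<phi> G. \<exists>s \<in> subalgebra_gen \<phi> G. s dvd 1 \<and> s * r = a))"


section \<open>Cartier modules\<close>

locale cartier_module = Modules.module scale
  for scale :: "'r::comm_ring_1 \<Rightarrow> 'm::ab_group_add \<Rightarrow> 'm" +
  fixes p :: nat and \<kappa> :: "'m \<Rightarrow> 'm"
  assumes kappa_add: "\<kappa> (x + y) = \<kappa> x + \<kappa> y"
    and kappa_scale: "\<kappa> (scale (r ^ p) x) = scale r (\<kappa> x)"

definition cartier_submodule ::
  "('r::comm_ring_1 \<Rightarrow> 'm::ab_group_add \<Rightarrow> 'm) \<Rightarrow> ('m \<Rightarrow> 'm) \<Rightarrow> 'm set \<Rightarrow> bool" where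
  "cartier_submodule scale \<kappa> N \<longleftrightarrow> module.subspace scale N \<and> \<kappa> ` N \<subseteq> N"

definition F_pure :: "('m \<Rightarrow> 'm) \<Rightarrow> bool" where
  "F_pure \<kappa> \<longleftrightarrow> surj \<kappa>"

definition F_regular ::
  "('r::comm_ring_1 \<Rightarrow> 'm::ab_group_add \<Rightarrow> 'm) \<Rightarrow> ('m \<Rightarrow> 'm) \<Rightarrow> bool" where
  "F_regular scale \<kappa> \<longleftrightarrow>
     F_pure \<kappa> \<and>
     (\<forall>N. cartier_submodule scale \<kappa> N \<and>
          (\<forall>P \<in> generic_points (module_support scale).
             localize scale (- P) N = localize scale (- P) UNIV)
        \<longrightarrow> N = UNIV)"


section \<open>Test modules\<close>

text \<open>The sum of submodules is the span of their union.\<close>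

definition cartier_plus ::
  "('r::comm_ring_1 \<Rightarrow> 'm::ab_group_add \<Rightarrow> 'm) \<Rightarrow> nat \<Rightarrow> ('m \<Rightarrow> 'm) \<Rightarrow> 'r \<Rightarrow> real \<Rightarrow> 'm set \<Rightarrow> 'm set"
where
  "cartier_plus scale p \<kappa> f t N =
     module.span scale
       (\<Union>n\<in>{1..}. (\<lambda>x. (\<kappa> ^^ n) (scale (f ^ nat \<lceil>t * real p ^ n\<rceil>) x)) ` N)"

text \<open>The stable value of \<open>(C\<^sub>+)\<^sup>h M\<close> for large \<open>h\<close>.\<close>

definition stable_image ::
  "('r::comm_ring_1 \<Rightarrow> 'm::ab_group_add \<Rightarrow> 'm) \<Rightarrow> nat \<Rightarrow> ('m \<Rightarrow> 'm) \<Rightarrow> 'r \<Rightarrow> real \<Rightarrow> 'm set" where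
  "stable_image scale p \<kappa> f t =
     (THE N. \<forall>\<^sub>F h in sequentially. (cartier_plus scale p \<kappa> f t ^^ h) UNIV = N)"

definition test_module ::
  "('r::comm_ring_1 \<Rightarrow> 'm::ab_group_add \<Rightarrow> 'm) \<Rightarrow> nat \<Rightarrow> ('m \<Rightarrow> 'm) \<Rightarrow> 'r \<Rightarrow> real \<Rightarrow> 'm set" where
  "test_module scale p \<kappa> f t =
     cartier_plus scale p \<kappa> f t (scale f ` stable_image scale p \<kappa> f t)"

text \<open>Only parameters \<open>t - \<epsilon> \<ge> 0\<close> are considered, since the filtration is indexed by \<open>t \<ge> 0\<close>.\<close>

definition F_jumping_number ::
  "('r::comm_ring_1 \<Rightarrow> 'm::ab_group_add \<Rightarrow> 'm) \<Rightarrow> nat \<Rightarrow> ('m \<Rightarrow> 'm) \<Rightarrow> 'r \<Rightarrow> real \<Rightarrow> bool" where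
  "F_jumping_number scale p \<kappa> f t \<longleftrightarrow>
     t \<ge> 0 \<and>
     (\<forall>\<epsilon>>0. \<epsilon> \<le> t \<longrightarrow> test_module scale p \<kappa> f t \<noteq> test_module scale p \<kappa> f (t - \<epsilon>))"


section \<open>Differential operators\<close>

definition diff_ops :: "nat \<Rightarrow> nat \<Rightarrow> ('a::comm_ring_1 \<Rightarrow> 'a) set" where
  "diff_ops p e =
     {P. (\<forall>a b. P (a + b) = P a + P b) \<and> (\<forall>r a. P (r ^ (p ^ e) * a) = r ^ (p ^ e) * P a)}"

definition theta :: "nat \<Rightarrow> 'r::comm_ring_1 poly \<Rightarrow> 'r poly" where
  "theta m g =
     (\<Sum>n\<le>Polynomial.degree g. Polynomial.monom (of_nat (n choose m) * Polynomial.coeff g n) n)"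

text \<open>
  The ring \<open>D\<^sup>e\<^sub>R[\<theta>\<^sub>1, \<theta>\<^sub>p, \<dots>]\<close>.  The operator \<open>P\<close> on \<open>R\<close> extends to \<open>R[t]\<close> as
  \<^term>\<open>map_poly P\<close>.
\<close>

inductive_set theta_ring :: "nat \<Rightarrow> nat \<Rightarrow> ('r::comm_ring_1 poly \<Rightarrow> 'r poly) set"
  for p e :: nat where
  one: "id \<in> theta_ring p e"
| diff: "P \<in> diff_ops p e \<Longrightarrow> map_poly P \<in> theta_ring p e"
| theta: "l < e \<Longrightarrow> theta (p ^ l) \<in> theta_ring p e"
| add: "A \<in> theta_ring p e \<Longrightarrow> B \<in> theta_ring p e \<Longrightarrow> (\<lambda>g. A g + B g) \<in> theta_ring p e"
| uminus: "A \<in> theta_ring p e \<Longrightarrow> (\<lambda>g. - A g) \<in> theta_ring p e"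
| comp: "A \<in> theta_ring p e \<Longrightarrow> B \<in> theta_ring p e \<Longrightarrow> A \<circ> B \<in> theta_ring p e"


section \<open>Bernstein-Sato polynomials\<close>

text \<open>
  The elements of \<open>Hom (F\<^sup>e\<^sub>* R[t], \<gamma>\<^sub>*M)\<close> are functions \<open>'r poly \<Rightarrow> 'm\<close>.  Operators act on them from the
  right by precomposition.
\<close>

definition graph_maps ::
  "('r::comm_ring_1 \<Rightarrow> 'm::ab_group_add \<Rightarrow> 'm) \<Rightarrow> ('m \<Rightarrow> 'm) \<Rightarrow> 'r \<Rightarrow> nat \<Rightarrow> 'm set
     \<Rightarrow> ('r poly \<Rightarrow> 'm) set" where
  "graph_maps scale \<kappa> f e N = {(\<lambda>g. (\<kappa> ^^ e) (scale (poly g f) n)) | n. n \<in> N}"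

inductive_set right_submodule_gen ::
  "('a \<Rightarrow> 'a) set \<Rightarrow> ('a \<Rightarrow> 'm::ab_group_add) set \<Rightarrow> ('a \<Rightarrow> 'm) set"
  for Ops :: "('a \<Rightarrow> 'a) set" and G :: "('a \<Rightarrow> 'm) set" where
  zero: "(\<lambda>_. 0) \<in> right_submodule_gen Ops G"
| gen: "\<psi> \<in> G \<Longrightarrow> \<psi> \<in> right_submodule_gen Ops G"
| add: "\<psi> \<in> right_submodule_gen Ops G \<Longrightarrow> \<chi> \<in> right_submodule_gen Ops G
    \<Longrightarrow> (\<lambda>g. \<psi> g + \<chi> g) \<in> right_submodule_gen Ops G"
| act: "\<psi> \<in> right_submodule_gen Ops G \<Longrightarrow> P \<in> Ops \<Longrightarrow> \<psi> \<circ> P \<in> right_submodule_gen Ops G"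

definition A_mod ::
  "('r::comm_ring_1 \<Rightarrow> 'm::ab_group_add \<Rightarrow> 'm) \<Rightarrow> nat \<Rightarrow> ('m \<Rightarrow> 'm) \<Rightarrow> 'r \<Rightarrow> nat
     \<Rightarrow> ('r poly \<Rightarrow> 'm) set" where
  "A_mod scale p \<kappa> f e = right_submodule_gen (theta_ring p e) (graph_maps scale \<kappa> f e UNIV)"

definition At_mod ::
  "('r::comm_ring_1 \<Rightarrow> 'm::ab_group_add \<Rightarrow> 'm) \<Rightarrow> nat \<Rightarrow> ('m \<Rightarrow> 'm) \<Rightarrow> 'r \<Rightarrow> nat
     \<Rightarrow> ('r poly \<Rightarrow> 'm) set" where
  "At_mod scale p \<kappa> f e =
     right_submodule_gen (theta_ring p e) (graph_maps scale \<kappa> f e (range (scale f)))"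

text \<open>The class of \<open>\<psi>\<close> in the quotient \<open>N\<^sup>e\<close>, as a coset.\<close>

definition N_class ::
  "('r::comm_ring_1 \<Rightarrow> 'm::ab_group_add \<Rightarrow> 'm) \<Rightarrow> nat \<Rightarrow> ('m \<Rightarrow> 'm) \<Rightarrow> 'r \<Rightarrow> nat
     \<Rightarrow> ('r poly \<Rightarrow> 'm) \<Rightarrow> ('r poly \<Rightarrow> 'm) set" where
  "N_class scale p \<kappa> f e \<psi> = {(\<lambda>g. \<psi> g + \<chi> g) | \<chi>. \<chi> \<in> At_mod scale p \<kappa> f e}"

text \<open>The summand \<open>N\<^sup>e\<^sub>i\<close>, i.e. the simultaneous eigenspace of the \<open>\<theta>\<close>'s in \<open>N\<^sup>e\<close>.\<close>

definition N_eigen ::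
  "('r::comm_ring_1 \<Rightarrow> 'm::ab_group_add \<Rightarrow> 'm) \<Rightarrow> nat \<Rightarrow> ('m \<Rightarrow> 'm) \<Rightarrow> 'r \<Rightarrow> nat
     \<Rightarrow> (nat \<Rightarrow> nat) \<Rightarrow> ('r poly \<Rightarrow> 'm) set set" where
  "N_eigen scale p \<kappa> f e i =
     {N_class scale p \<kappa> f e \<psi> | \<psi>. \<psi> \<in> A_mod scale p \<kappa> f e \<and>
        (\<forall>l\<in>{1..e}. N_class scale p \<kappa> f e (\<psi> \<circ> theta (p ^ (l - 1))) =
                     N_class scale p \<kappa> f e (\<lambda>g. scale (of_nat (i l)) (\<psi> g)))}"

text \<open>Tuples \<open>(i\<^sub>1, \<dots>, i\<^sub>e)\<close> are functions on \<open>{1..e}\<close>, extended by \<^const>\<open>undefined\<close>.\<close>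

definition BS_index_set ::
  "('r::comm_ring_1 \<Rightarrow> 'm::ab_group_add \<Rightarrow> 'm) \<Rightarrow> nat \<Rightarrow> ('m \<Rightarrow> 'm) \<Rightarrow> 'r \<Rightarrow> nat
     \<Rightarrow> (nat \<Rightarrow> nat) set" where
  "BS_index_set scale p \<kappa> f e =
     {i \<in> {1..e} \<rightarrow>\<^sub>E {0..<p}. N_eigen scale p \<kappa> f e i \<noteq> {N_class scale p \<kappa> f e (\<lambda>_. 0)}}"

definition BS_poly ::
  "('r::comm_ring_1 \<Rightarrow> 'm::ab_group_add \<Rightarrow> 'm) \<Rightarrow> nat \<Rightarrow> ('m \<Rightarrow> 'm) \<Rightarrow> 'r \<Rightarrow> nat \<Rightarrow> rat poly" where
  "BS_poly scale p \<kappa> f e =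
     (\<Prod>i \<in> BS_index_set scale p \<kappa> f e.
        [: - (\<Sum>l=1..e. of_nat (i l) / of_nat p ^ (e + 1 - l)), 1 :])"

end

theory Submission
  imports Defs "HOL-Number_Theory.Residues"
begin

text \<open>
  Put \<open>T(t) = \<Union>\<^sub>e \<kappa>\<^sup>e(f\<^bsup>\<lceil>tp\<^sup>e\<rceil>\<^esup>M)\<close>.  Since \<open>\<kappa>\<close> is surjective, the union is increasing and
  \<open>T(j/p\<^sup>e) = \<kappa>\<^sup>e(f\<^sup>jM)\<close> holds exactly; \<open>F\<close>-regularity gives \<open>\<kappa>\<^sup>h(f\<^sup>cM) = M\<close> for large \<open>h\<close>, whence
  \<open>\<tau>(M, f\<^sup>t) = T(t)\<close> and right continuity.  So a jump lies in \<open>(j/p\<^sup>e, (j+1)/p\<^sup>e]\<close> iff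
  \<open>\<kappa>\<^sup>e(f\<^sup>jM) \<noteq> \<kappa>\<^sup>e(f\<^sup>j\<^sup>+\<^sup>1M)\<close>.

  On the other side, the \<open>\<theta>\<close>'s generate the projections of \<open>R[t]\<close> onto the exponents congruent to
  \<open>j\<close> modulo \<open>p\<^sup>e\<close>, so the summand of \<open>N\<^sup>e\<close> belonging to the digits of \<open>j\<close> compares the
  \<open>\<D>\<^sup>e\<^sub>R\<close>-submodules of \<open>Hom(F\<^sup>e\<^sub>*R, M)\<close> generated by \<open>b \<mapsto> \<kappa>\<^sup>e(bf\<^sup>jn)\<close> and by
  \<open>b \<mapsto> \<kappa>\<^sup>e(bf\<^sup>j\<^sup>+\<^sup>1n)\<close>.  A dual basis of \<open>F\<^sup>e\<^sub>*R\<close> identifies these with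
  \<open>Hom(F\<^sup>e\<^sub>*R, \<kappa>\<^sup>e(f\<^sup>jM))\<close> and \<open>Hom(F\<^sup>e\<^sub>*R, \<kappa>\<^sup>e(f\<^sup>j\<^sup>+\<^sup>1M))\<close>.

  The dual basis exists because \<open>F\<^sub>*R\<close> is projective (Kunz): at a prime, the \<open>p\<close>-th powers of a
  regular system of parameters form a regular sequence, so a minimal set of generators of \<open>F\<^sub>*R\<close> is
  a basis.  That regular systems of parameters are regular sequences comes from Krull's principal
  ideal theorem.
\<close>

section \<open>Noetherian modules and prime ideals\<close>

text \<open>The dual basis makes \<open>At_mod\<close> computable. If r is the sum of the
  \<phi>(r)^q x with q = p^e, then an R-linear map \<psi> on F^e_*R has \<psi>(b) equal to the sum
  of the \<phi>(b) \<psi>(x). Writing \<psi>(x) = \<kappa>^e(f^(j+1) n_x) and moving \<phi>(b)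
  inside \<kappa>^e, each summand becomes b \<mapsto> \<kappa>^e(\<phi>(b)^q f^(j+1) n_x), and b
  \<mapsto> \<phi>(b)^q is itself an element of D^e_R. The obstacle is Kunz's theorem, whose proof
  lives over R_P. That ring is not a type, so the local algebra is carried out inside R: an ideal of
  R_P is represented by its contraction, a P-saturated ideal of R, and inverting units means
  multiplying by some s outside P. Local bases are glued through the ideal of those t for which
  every t^p r has an expansion; it lies in no prime. Beyond surjectivity of \<kappa>, F-regularity
  enters once, for the union of the \<kappa>^h(f^c M): this is a Cartier submodule containing f^c M,
  and f lies in no generic point of the support because it is a nonzerodivisor on M.\<close>

locale noetherian_module = Modules.module scale
  for scale :: "'r::comm_ring_1 \<Rightarrow> 'm::ab_group_add \<Rightarrow> 'm" (infixr \<open>*s\<close> 75) +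
  assumes subspace_fin_gen: "subspace N \<Longrightarrow> \<exists>A. finite A \<and> N = span A"
begin

text \<open>The union of a chain is finitely generated, and finitely many generators already lie in
  one member, so Zorn's lemma applies. The Noetherian hypothesis is mostly used in this
  form.\<close>

lemma ex_maximal_subspace:
  assumes "\<A> \<noteq> {}" and sub: "\<And>N. N \<in> \<A> \<Longrightarrow> subspace N"
  shows "\<exists>N\<in>\<A>. \<forall>L\<in>\<A>. N \<subseteq> L \<longrightarrow> L = N"
proof (rule subset_Zorn_nonempty[OF assms(1)])
  fix C assume C: "C \<noteq> {}" "subset.chain \<A> C"
  have CA: "C \<subseteq> \<A>" using C(2) by (simp add: subset.chain_def)
  have "subspace (\<Union>C)"
  proof (rule subspaceI)
    show "0 \<in> \<Union>C" using C(1) CA sub subspace_0 by (metis UnionI all_not_in_conv subsetD)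
    show "scale c x \<in> \<Union>C" if "x \<in> \<Union>C" for c x
      using that CA sub subspace_scale by (metis UnionE UnionI subsetD)
    fix x y assume "x \<in> \<Union>C" "y \<in> \<Union>C"
    then obtain U V where UV: "U \<in> C" "x \<in> U" "V \<in> C" "y \<in> V" by blast
    then have "U \<subseteq> V \<or> V \<subseteq> U" using C(2) by (auto simp: subset.chain_def)
    then obtain Z where "Z \<in> C" "x \<in> Z" "y \<in> Z" using UV by blast
    then show "x + y \<in> \<Union>C" using CA sub[of Z] subspace_add by blast
  qed
  then obtain A where A: "finite A" "\<Union>C = span A" using subspace_fin_gen by blast
  have "A \<subseteq> \<Union>C" using A(2) span_superset by simp
  then obtain U where U: "U \<in> C" "A \<subseteq> U"
    using finite_subset_Union_chain[OF A(1) _ C(1), of \<A>] C(2) by blast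
  then have "span A \<subseteq> U" using U CA sub span_minimal by (metis subsetD)
  then have "\<Union>C = U" using U A(2) by blast
  then show "\<Union>C \<in> \<A>" using U CA by blast
qed

lemma ascending_stabilizes:
  assumes inc: "\<And>n::nat. N n \<subseteq> N (Suc n)" and sub: "\<And>n. subspace (N n)"
  shows "\<exists>n. (\<Union>k. N k) = N n"
proof -
  have "\<exists>M\<in>range N. \<forall>L\<in>range N. M \<subseteq> L \<longrightarrow> L = M"
    by (rule ex_maximal_subspace) (use sub in auto)
  then obtain M where M: "M \<in> range N" "\<And>L. L \<in> range N \<Longrightarrow> M \<subseteq> L \<Longrightarrow> L = M"
    by auto
  then obtain n where n: "M = N n" by blast
  have "N k \<subseteq> N n" for k
  proof (cases "k \<le> n")
    case True then show ?thesis using lift_Suc_mono_le[of N, OF inc] by blast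
  next
    case False
    then have "N n \<subseteq> N k" using lift_Suc_mono_le[of N n k, OF inc] by simp
    then show ?thesis using M(2)[of "N k"] n by blast
  qed
  then show ?thesis by blast
qed

end

interpretation ring_mod: Modules.module "(*) :: 'r::comm_ring_1 \<Rightarrow> 'r \<Rightarrow> 'r"
  by unfold_locales (simp_all add: algebra_simps)

text \<open>As a rewrite rule this would loop with associativity of multiplication.\<close>

declare ring_mod.scale_scale [simp del]

text \<open>Induction on the number of generators: a submodule is assembled from its intersection
  with the span of the other generators and from lifts of generators of an ideal of leading
  coefficients.\<close>

lemma (in Modules.module) noetherian_module_fin_gen:
  assumes "noetherian_module ((*) :: 'a \<Rightarrow> 'a \<Rightarrow> 'a)" "fin_gen_module scale"
  shows "noetherian_module scale"
proof -
  interpret R: noetherian_module "(*) :: 'a \<Rightarrow> 'a \<Rightarrow> 'a" by fact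
  obtain B where B: "finite B" "span B = UNIV"
    using assms(2) by (auto simp: fin_gen_module_def)
  have *: "\<exists>A. finite A \<and> N = span A" if "finite B" "subspace N" "N \<subseteq> span B" for B N
    using that
  proof (induction B arbitrary: N rule: finite_induct)
    case empty
    then have "N = span {}" using subspace_0[of N] by auto
    then show ?case by blast
  next
    case (insert b B)
    \<comment> \<open>The ideal of coefficients of \<open>b\<close> that occur in \<open>N\<close>
      modulo \<open>span B\<close>; \<open>h\<close> below lifts its generators to
      \<open>N\<close>.\<close>
    define I where "I = {r. \<exists>n\<in>N. n - r *s b \<in> span B}"
    have "ring_mod.subspace I"
    proof (rule ring_mod.subspaceI)
      show "0 \<in> I" unfolding I_def using subspace_0[OF insert.prems(1)] span_zero
        by (auto intro!: bexI[of _ 0])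
      show "x + y \<in> I" if xy: "x \<in> I" "y \<in> I" for x y
      proof -
        obtain n n' where "n \<in> N" "n - x *s b \<in> span B" "n' \<in> N" "n' - y *s b \<in> span B"
          using xy by (auto simp: I_def)
        then have "n + n' \<in> N" "(n + n') - (x + y) *s b \<in> span B"
          using subspace_add[OF insert.prems(1)] span_add[of "n - x *s b" B "n' - y *s b"]
          by (auto simp: algebra_simps)
        then show ?thesis by (auto simp: I_def)
      qed
      show "c * x \<in> I" if x: "x \<in> I" for c x
      proof -
        obtain n where "n \<in> N" "n - x *s b \<in> span B"
          using x by (auto simp: I_def)
        then have "c *s n \<in> N" "c *s n - (c * x) *s b \<in> span B"
          using subspace_scale[OF insert.prems(1)] span_scale[of "n - x *s b" B c]
          by (auto simp: algebra_simps)
        then show ?thesis by (auto simp: I_def)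
      qed
    qed
    then obtain A where A: "finite A" "I = ring_mod.span A" using R.subspace_fin_gen by blast
    have "a \<in> I" if "a \<in> A" for a
      using A(2) ring_mod.span_base[OF that] by simp
    then have "\<forall>a\<in>A. \<exists>n\<in>N. n - a *s b \<in> span B"
      unfolding I_def by simp
    then obtain h where h: "\<And>a. a \<in> A \<Longrightarrow> h a \<in> N" "\<And>a. a \<in> A \<Longrightarrow> h a - a *s b \<in> span B"
      by metis
    have "subspace (N \<inter> span B)" using insert.prems(1) by (simp add: subspace_inter)
    then obtain A' where A': "finite A'" "N \<inter> span B = span A'"
      using insert.IH[of "N \<inter> span B"] by blast
    have "N \<subseteq> span (h ` A \<union> A')"
    proof
      fix n assume n: "n \<in> N"
      then obtain r where r: "n - r *s b \<in> span B"
        using insert.prems(2) span_breakdown_eq by blast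
      then have "r \<in> ring_mod.span A" using n A(2) by (auto simp: I_def)
      then obtain c where c: "r = (\<Sum>a\<in>A. c a * a)" using ring_mod.span_finite[OF A(1)] by auto
      define m where "m = (\<Sum>a\<in>A. c a *s h a)"
      have mN: "m \<in> N" unfolding m_def
        using h(1) insert.prems(1) by (intro subspace_sum subspace_scale) auto
      have "m - r *s b = (\<Sum>a\<in>A. c a *s (h a - a *s b))"
        by (simp add: m_def c scale_sum_left scale_right_diff_distrib sum_subtractf)
      also have "\<dots> \<in> span B" using h(2) by (intro span_sum span_scale)
      finally have "(n - r *s b) - (m - r *s b) \<in> span B" using r span_diff by blast
      then have "n - m \<in> N \<inter> span B" using n mN subspace_diff[OF insert.prems(1)] by simp
      then have "n - m \<in> span A'" using A'(2) by blast
      then have "n - m \<in> span (h ` A \<union> A')" by (rule subsetD[OF span_mono, rotated]) simp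
      moreover have "m \<in> span (h ` A \<union> A')" unfolding m_def
        by (intro span_sum span_scale span_base) auto
      ultimately show "n \<in> span (h ` A \<union> A')" by (metis diff_add_cancel span_add)
    qed
    moreover have "span (h ` A \<union> A') \<subseteq> N"
    proof (intro span_minimal Un_least)
      have "A' \<subseteq> span A'" by (rule span_superset)
      then show "A' \<subseteq> N" unfolding A'(2)[symmetric] by blast
    qed (use h(1) insert.prems(1) in auto)
    ultimately have "N = span (h ` A \<union> A')" by blast
    then show ?case using A(1) A'(1) by (intro exI[of _ "h ` A \<union> A'"]) simp
  qed
  show ?thesis
    by unfold_locales (use *[OF B(1)] B(2) in auto)
qed

section \<open>Ideals of the ring record as submodules of the type\<close>

lemma ideal_ring_of_type_algebra_iff:
  "ideal I (ring_of_type_algebra :: 'r::comm_ring_1 ring) \<longleftrightarrow> ring_mod.subspace I"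
proof
  assume "ideal I (ring_of_type_algebra :: 'r ring)"
  then interpret ideal I "ring_of_type_algebra :: 'r ring" .
  show "ring_mod.subspace I"
    unfolding ring_mod.subspace_def
    using additive_subgroup.zero_closed[OF is_additive_subgroup]
      additive_subgroup.a_closed[OF is_additive_subgroup] I_l_closed
    unfolding ring_of_type_algebra_def by auto
next
  assume I: "ring_mod.subspace I"
  have inv: "\<exists>y\<in>I. y + x = 0" if "x \<in> I" for x
    using ring_mod.subspace_neg[OF I that] by force
  show "ideal I (ring_of_type_algebra :: 'r ring)"
  proof (rule idealI)
    show "ring (ring_of_type_algebra :: 'r ring)" by (rule ring_from_type_algebra)
    show "subgroup I (add_monoid (ring_of_type_algebra :: 'r ring))"
    proof (rule group.subgroupI)
      show "Group.group (add_monoid (ring_of_type_algebra :: 'r ring))"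
        using abelian_group.a_group ring.is_abelian_group ring_from_type_algebra by blast
      show "inv\<^bsub>add_monoid ring_of_type_algebra\<^esub> a \<in> I" if a: "a \<in> I" for a
      proof -
        interpret Group.group "add_monoid (ring_of_type_algebra :: 'r ring)"
          using abelian_group.a_group ring.is_abelian_group ring_from_type_algebra by blast
        have "inv\<^bsub>add_monoid ring_of_type_algebra\<^esub> a = - a"
          by (rule inv_equality) (auto simp: ring_of_type_algebra_def)
        then show ?thesis using ring_mod.subspace_neg[OF I a] by simp
      qed
    qed (use I ring_mod.subspace_0[OF I] ring_mod.subspace_add[OF I] in \<open>auto simp: ring_of_type_algebra_def\<close>)
  qed (use ring_mod.subspace_scale[OF I] in \<open>auto simp: ring_of_type_algebra_def mult.commute\<close>)
qed

lemma noetherian_ring_imp_noetherian_module: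
  assumes "noetherian_ring (ring_of_type_algebra :: 'r::comm_ring_1 ring)"
  shows "noetherian_module ((*) :: 'r \<Rightarrow> 'r \<Rightarrow> 'r)"
proof unfold_locales
  interpret noetherian_ring "ring_of_type_algebra :: 'r ring" by fact
  fix I :: "'r set" assume I: "ring_mod.subspace I"
  then obtain A where A: "finite A" "I = genideal (ring_of_type_algebra :: 'r ring) A"
    using finetely_gen ideal_ring_of_type_algebra_iff by blast
  have "genideal (ring_of_type_algebra :: 'r ring) A = ring_mod.span A"
    by (simp add: genideal_def ring_mod.span_def hull_def ideal_ring_of_type_algebra_iff)
  then show "\<exists>A. finite A \<and> I = ring_mod.span A" using A by blast
qed

lemma prime_ideal_iff:
  "prime_ideal (P :: 'r::comm_ring_1 set) \<longleftrightarrow>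
     ring_mod.subspace P \<and> 1 \<notin> P \<and> (\<forall>a b. a * b \<in> P \<longrightarrow> a \<in> P \<or> b \<in> P)"
proof
  assume "prime_ideal P"
  then interpret primeideal P "ring_of_type_algebra :: 'r ring" .
  have sub: "ring_mod.subspace P" using ideal_ring_of_type_algebra_iff is_ideal by blast
  moreover have "1 \<notin> P" using I_notcarr ring_mod.subspace_scale[OF sub, of 1]
    by (auto simp: ring_of_type_algebra_def)
  ultimately show "ring_mod.subspace P \<and> 1 \<notin> P \<and> (\<forall>a b. a * b \<in> P \<longrightarrow> a \<in> P \<or> b \<in> P)"
    using I_prime by (auto simp: ring_of_type_algebra_def)
next
  assume "ring_mod.subspace P \<and> 1 \<notin> P \<and> (\<forall>a b. a * b \<in> P \<longrightarrow> a \<in> P \<or> b \<in> P)"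
  then show "prime_ideal P"
    using ideal_ring_of_type_algebra_iff[of P]
    by (intro primeidealI cring_from_type_algebra) (auto simp: ring_of_type_algebra_def)
qed

section \<open>Saturated ideals and Krull's principal ideal theorem\<close>

text \<open>For an ideal \<open>I\<close> this is the contraction of \<open>I R_P\<close> to
  \<open>R\<close>. The ideals with \<open>sat P I = I\<close> correspond to the ideals of
  \<open>R_P\<close>, so local algebra at \<open>P\<close> can be done without leaving
  \<open>R\<close>.\<close>

definition sat :: "'r::comm_ring_1 set \<Rightarrow> 'r set \<Rightarrow> 'r set" where
  "sat P I = {r. \<exists>s. s \<notin> P \<and> s * r \<in> I}"

lemma prime_ideal_subspace: "prime_ideal P \<Longrightarrow> ring_mod.subspace P"
  by (simp add: prime_ideal_iff)

lemma prime_ideal_mult: "prime_ideal P \<Longrightarrow> a * b \<in> P \<longleftrightarrow> a \<in> P \<or> b \<in> P"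
  unfolding prime_ideal_iff using ring_mod.subspace_scale by (metis mult.commute)

lemma prime_ideal_one: "prime_ideal P \<Longrightarrow> 1 \<notin> P"
  by (simp add: prime_ideal_iff)

lemma prime_ideal_power: "prime_ideal P \<Longrightarrow> a ^ n \<in> P \<Longrightarrow> a \<in> P"
  by (induction n) (auto simp: prime_ideal_one prime_ideal_mult)

lemma prime_ideal_power_notin: "prime_ideal P \<Longrightarrow> a \<notin> P \<Longrightarrow> a ^ n \<notin> P"
  using prime_ideal_power by blast

lemma satI: "s \<notin> P \<Longrightarrow> s * r \<in> I \<Longrightarrow> r \<in> sat P I"
  by (auto simp: sat_def)

lemma satE:
  assumes "r \<in> sat P I"
  obtains s where "s \<notin> P" "s * r \<in> I"
  using assms unfolding sat_def by blast

lemma sat_mono: "I \<subseteq> J \<Longrightarrow> sat P I \<subseteq> sat P J"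
  by (auto simp: sat_def)

lemma sat_subset: "prime_ideal P \<Longrightarrow> I \<subseteq> sat P I"
  using satI[of 1 P] prime_ideal_one by fastforce

lemma subspace_sat:
  assumes P: "prime_ideal P" and I: "ring_mod.subspace I"
  shows "ring_mod.subspace (sat P I)"
proof (rule ring_mod.subspaceI)
  show "0 \<in> sat P I" using sat_subset[OF P] ring_mod.subspace_0[OF I] by blast
  show "x + y \<in> sat P I" if xy: "x \<in> sat P I" "y \<in> sat P I" for x y
  proof -
    obtain s t where st: "s \<notin> P" "s * x \<in> I" "t \<notin> P" "t * y \<in> I"
      using xy by (auto elim!: satE)
    have "t * (s * x) + s * (t * y) \<in> I"
      using ring_mod.subspace_add[OF I] ring_mod.subspace_scale[OF I] st by blast
    then show ?thesis
      using st by (intro satI[of "s * t"]) (auto simp: prime_ideal_mult[OF P] algebra_simps)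
  qed
  show "c * x \<in> sat P I" if x: "x \<in> sat P I" for c x
  proof -
    obtain s where "s \<notin> P" "s * x \<in> I" using x by (auto elim!: satE)
    then show ?thesis
      using ring_mod.subspace_scale[OF I, of "s * x" c]
      by (intro satI[of s]) (auto simp: algebra_simps)
  qed
qed

lemma sat_sat:
  assumes P: "prime_ideal P"
  shows "sat P (sat P I) = sat P I"
proof
  show "sat P (sat P I) \<subseteq> sat P I"
  proof
    fix r assume "r \<in> sat P (sat P I)"
    then obtain s t where "s \<notin> P" "t \<notin> P" "t * (s * r) \<in> I" by (auto elim!: satE)
    then show "r \<in> sat P I"
      using prime_ideal_mult[OF P, of t s] satI[of "t * s" P r I] by (simp add: mult.assoc)
  qed
qed (rule sat_subset[OF P])

lemma sat_prime:
  assumes "prime_ideal Q" "Q \<subseteq> P" "prime_ideal P"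
  shows "sat P Q = Q"
proof
  show "sat P Q \<subseteq> Q"
  proof
    fix r assume "r \<in> sat P Q"
    then obtain s where "s \<notin> P" "s * r \<in> Q" by (rule satE)
    then show "r \<in> Q" using assms(2) prime_ideal_mult[OF assms(1)] by blast
  qed
qed (rule sat_subset[OF assms(3)])

lemma sat_minimal:
  assumes "I \<subseteq> J" "sat P J = J"
  shows "sat P I \<subseteq> J"
  using sat_mono[OF assms(1), of P] assms(2) by simp

lemma mem_span_insert_iff:
  assumes "ring_mod.subspace I"
  shows "r \<in> ring_mod.span (insert x I) \<longleftrightarrow> (\<exists>i\<in>I. \<exists>c. r = i + c * x)"
proof -
  have "ring_mod.span I = I" by (rule ring_mod.span_eq_iff[THEN iffD2, OF assms])
  then have "r \<in> ring_mod.span (insert x I) \<longleftrightarrow> (\<exists>c. r - c * x \<in> I)"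
    by (simp only: ring_mod.span_breakdown_eq)
  also have "\<dots> \<longleftrightarrow> (\<exists>i\<in>I. \<exists>c. r = i + c * x)"
    by (metis add_diff_cancel_right' diff_add_cancel)
  finally show ?thesis .
qed

lemma mem_sat_insertE:
  assumes "r \<in> sat P (ring_mod.span (insert x I))" "ring_mod.subspace I"
  obtains s i c where "s \<notin> P" "i \<in> I" "s * r = i + c * x"
  using assms by (auto elim!: satE simp: mem_span_insert_iff)

lemma mem_sat_insertI:
  assumes "s \<notin> P" "i \<in> I" "s * r = i + c * x" "ring_mod.subspace I"
  shows "r \<in> sat P (ring_mod.span (insert x I))"
  using assms by (intro satI[of s]) (auto simp: mem_span_insert_iff)

section \<open>Nakayama, descending chains and Krull's theorem at a prime\<close>

locale noetherian_comm_ring = noetherian_module "(*) :: 'r::comm_ring_1 \<Rightarrow> 'r \<Rightarrow> 'r"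
begin

declare scale_scale [simp del]

text \<open>Over \<open>R_P\<close> the hypothesis says that \<open>K\<close> lies in
  \<open>L + xK\<close>. Here \<open>K\<close> is an arbitrary set, because
  \<open>frobenius_basis_descent\<close> applies the lemma to a set of coefficients. The proof takes
  a saturated ideal \<open>N\<close> maximal among those that contain \<open>L\<close> but not
  \<open>K\<close>.\<close>

lemma nakayama:
  fixes P L K :: "'r set"
  assumes P: "prime_ideal P" and L: "ring_mod.subspace L" "sat P L = L" and x: "x \<in> P"
    and K: "\<And>k. k \<in> K \<Longrightarrow> \<exists>s l k'. s \<notin> P \<and> l \<in> L \<and> k' \<in> K \<and> s * k = l + x * k'"
  shows "K \<subseteq> L"
proof (rule ccontr)
  assume "\<not> K \<subseteq> L"
  define \<A> where "\<A> = {J. ring_mod.subspace J \<and> sat P J = J \<and> L \<subseteq> J \<and> \<not> K \<subseteq> J}"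
  have "\<exists>N\<in>\<A>. \<forall>J\<in>\<A>. N \<subseteq> J \<longrightarrow> J = N"
  proof (rule ex_maximal_subspace)
    have "L \<in> \<A>" using L \<open>\<not> K \<subseteq> L\<close> by (simp add: \<A>_def)
    then show "\<A> \<noteq> {}" by blast
  qed (simp add: \<A>_def)
  then obtain N where "N \<in> \<A>" and max: "\<And>J. J \<in> \<A> \<Longrightarrow> N \<subseteq> J \<Longrightarrow> J = N"
    by blast
  then have N: "ring_mod.subspace N" "sat P N = N" "L \<subseteq> N" "\<not> K \<subseteq> N"
    by (simp_all add: \<A>_def)
  obtain k where k: "k \<in> K" "x * k \<notin> N"
  proof (rule ccontr)
    assume "\<not> thesis"
    with that have xk: "x * k \<in> N" if "k \<in> K" for k using \<open>k \<in> K\<close> by blast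
    have "k \<in> N" if "k \<in> K" for k
    proof -
      obtain s l k' where "s \<notin> P" "l \<in> L" "k' \<in> K" "s * k = l + x * k'"
        using K[OF \<open>k \<in> K\<close>] by metis
      then have "s * k \<in> N" using xk N(1,3) ring_mod.subspace_add[of N l "x * k'"] by auto
      then show ?thesis using \<open>s \<notin> P\<close> N(2) satI by blast
    qed
    then show False using N(4) by blast
  qed
  define J where "J = sat P (ring_mod.span (insert (x * k) N))"
  have NJ: "N \<subseteq> J" and kJ: "x * k \<in> J" unfolding J_def
    using sat_subset[OF P] ring_mod.span_superset by blast+
  have "ring_mod.subspace J" "sat P J = J"
    unfolding J_def using P by (simp_all add: subspace_sat sat_sat)
  then have "K \<subseteq> J" using max[of J] NJ kJ k(2) N(3) by (auto simp: \<A>_def)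
  then obtain s i c where s: "s \<notin> P" "i \<in> N" "s * k = i + c * (x * k)"
    using k(1) mem_sat_insertE[OF _ N(1)] unfolding J_def by blast
  \<comment> \<open>Since \<open>x\<close> is in \<open>P\<close> and \<open>s\<close> is not,
    \<open>s - c * x\<close> is a unit at \<open>P\<close>, which pushes \<open>k\<close> into
    \<open>N\<close>.\<close>
  have "(s - c * x) * k = i" using s(3) by (simp add: algebra_simps)
  moreover have "s - c * x \<notin> P"
    using s(1) ring_mod.subspace_add[OF prime_ideal_subspace[OF P], of "s - c * x" "c * x"]
      ring_mod.subspace_scale[OF prime_ideal_subspace[OF P] x, of c] by (metis diff_add_cancel)
  ultimately have "k \<in> N" using N(2) s(2) satI by blast
  then show False using k(2) N(1) ring_mod.subspace_scale by blast
qed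

text \<open>This is the descending chain condition in \<open>R_P/I\<close>, a ring with at most one
  prime. If it fails, take \<open>N\<close> maximal among the saturated ideals above which it fails.
  The layer \<open>N1\<close> just above \<open>N\<close> is simple over \<open>R_P\<close>, and a
  chain is controlled by its intersections with \<open>N1\<close> and its sums with
  \<open>N1\<close>.\<close>

lemma descending_stabilizes:
  fixes P I :: "'r set" and D :: "nat \<Rightarrow> 'r set"
  assumes P: "prime_ideal P" and I: "ring_mod.subspace I" "sat P I = I"
    and only: "\<And>Q. prime_ideal Q \<Longrightarrow> I \<subseteq> Q \<Longrightarrow> Q \<subseteq> P \<Longrightarrow> Q = P"
    and D: "\<And>n. ring_mod.subspace (D n)" "\<And>n. sat P (D n) = D n" "\<And>n. I \<subseteq> D n"
      "\<And>n::nat. D (Suc n) \<subseteq> D n"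
  shows "\<exists>n. \<forall>k\<ge>n. D k = D n"
proof (rule ccontr)
  assume nst: "\<not> ?thesis"
  define good where "good J \<longleftrightarrow> ring_mod.subspace J \<and> sat P J = J \<and> I \<subseteq> J" for J
  define dcc where "dcc J \<longleftrightarrow> (\<forall>D. (\<forall>n. good (D n) \<and> J \<subseteq> D n \<and> D (Suc n) \<subseteq> D n)
      \<longrightarrow> (\<exists>n. \<forall>k\<ge>n. D k = D n))" for J
  have "I \<in> {J. good J \<and> \<not> dcc J}" using nst D I unfolding good_def dcc_def by blast
  then have "\<exists>N\<in>{J. good J \<and> \<not> dcc J}. \<forall>J\<in>{J. good J \<and> \<not> dcc J}. N \<subseteq> J \<longrightarrow> J = N"
    by (intro ex_maximal_subspace) (auto simp: good_def)
  then obtain N where N: "good N" "\<not> dcc N"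
    and max: "\<And>J. good J \<Longrightarrow> \<not> dcc J \<Longrightarrow> N \<subseteq> J \<Longrightarrow> J = N" by auto
  have N': "ring_mod.subspace N" "sat P N = N" "I \<subseteq> N" using N by (auto simp: good_def)
  have "1 \<notin> N"
  proof
    assume "1 \<in> N"
    then have "N = UNIV" using ring_mod.subspace_scale[OF N'(1), of 1] by auto
    then have "dcc N" unfolding dcc_def by (metis UNIV_I subset_antisym subset_UNIV)
    then show False using N(2) by blast
  qed
  \<comment> \<open>A maximal annihilator of an element modulo \<open>N\<close> is an associated
    prime; by \<open>only\<close> it must be \<open>P\<close>.\<close>
  define ann where "ann y = {r. r * y \<in> N}" for y
  have ann: "ring_mod.subspace (ann y)" for y unfolding ann_def
    using ring_mod.subspace_0[OF N'(1)] ring_mod.subspace_add[OF N'(1)] ring_mod.subspace_scale[OF N'(1)]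
    by (intro ring_mod.subspaceI) (simp_all add: distrib_right mult.assoc)
  have "\<exists>A\<in>{ann y | y. y \<notin> N}. \<forall>J\<in>{ann y | y. y \<notin> N}. A \<subseteq> J \<longrightarrow> J = A"
    by (rule ex_maximal_subspace) (use ann \<open>1 \<notin> N\<close> in auto)
  then obtain y where y: "y \<notin> N" and ymax: "\<And>z. z \<notin> N \<Longrightarrow> ann y \<subseteq> ann z \<Longrightarrow> ann z = ann y"
    by auto
  have "prime_ideal (ann y)"
    unfolding prime_ideal_iff
  proof (intro conjI allI impI ann)
    show "1 \<notin> ann y" using y by (simp add: ann_def)
    fix a b assume ab: "a * b \<in> ann y"
    show "a \<in> ann y \<or> b \<in> ann y"
    proof (rule ccontr)
      assume *: "\<not> (a \<in> ann y \<or> b \<in> ann y)"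
      have "t * (b * y) \<in> N" if "t * y \<in> N" for t
        using ring_mod.subspace_scale[OF N'(1) that, of b] by (simp only: mult.left_commute)
      then have "ann y \<subseteq> ann (b * y)" unfolding ann_def by blast
      then have "ann (b * y) = ann y" using * by (intro ymax) (auto simp: ann_def)
      moreover have "a \<in> ann (b * y)" using ab by (simp add: ann_def mult.assoc)
      ultimately show False using * by blast
    qed
  qed
  moreover have "I \<subseteq> ann y"
    using N' ring_mod.subspace_scale[OF N'(1)] by (auto simp: ann_def mult.commute)
  moreover have "ann y \<subseteq> P" using y N'(2) satI[of _ P y N] by (auto simp: ann_def)
  ultimately have annP: "ann y = P" using only by blast
  define N1 where "N1 = sat P (ring_mod.span (insert y N))"
  have N1: "good N1" "N \<subseteq> N1" "y \<in> N1" unfolding N1_def good_def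
    using P N'(3) sat_subset[OF P] ring_mod.span_superset by (auto simp: subspace_sat sat_sat) blast+
  have dcc1: "dcc N1" using max[of N1] N1 y by auto
  have "dcc N"
    unfolding dcc_def
  proof (intro allI impI)
    fix D assume D: "\<forall>n. good (D n) \<and> N \<subseteq> D n \<and> D (Suc n) \<subseteq> D n"
    have Dsub: "ring_mod.subspace (D n)" "sat P (D n) = D n" for n using D by (auto simp: good_def)
    have mono: "D k \<subseteq> D n" if "n \<le> k" for n k
      using lift_Suc_antimono_le[of D n k] D that by blast
    \<comment> \<open>\<open>N1\<close> modulo \<open>N\<close> is a line over the residue field at
      \<open>P\<close>, so a saturated ideal above \<open>N\<close> that meets \<open>N1\<close>
      outside \<open>N\<close> contains all of \<open>N1\<close>.\<close>
    have layer: "N1 \<subseteq> D n" if z: "z \<in> D n" "z \<in> N1" "z \<notin> N" for n z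
    proof -
      obtain s i c where s: "s \<notin> P" "i \<in> N" "s * z = i + c * y"
        using z(2) mem_sat_insertE[OF _ N'(1)] unfolding N1_def by blast
      have "c \<notin> P"
      proof
        assume "c \<in> P"
        then have "c * y \<in> N" using annP by (auto simp: ann_def)
        then have "s * z \<in> N" using s N'(1) ring_mod.subspace_add by auto
        then show False using s(1) z(3) N'(2) satI by blast
      qed
      moreover have "c * y \<in> D n"
      proof -
        have "c * y = s * z - i" using s(3) by simp
        then show ?thesis using z(1) s(2) D Dsub(1)
          by (metis ring_mod.subspace_diff ring_mod.subspace_scale subsetD)
      qed
      ultimately have "y \<in> D n" using Dsub(2) satI by blast
      then have "ring_mod.span (insert y N) \<subseteq> D n" using D Dsub(1)
        by (intro ring_mod.span_minimal) auto
      then show ?thesis unfolding N1_def using sat_minimal Dsub(2) by blast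
    qed
    define E where "E n = sat P (ring_mod.span (D n \<union> N1))" for n
    have "good (E n)" for n
      unfolding good_def E_def
    proof (intro conjI)
      have "I \<subseteq> N1" using N1(1) by (simp add: good_def)
      also have "\<dots> \<subseteq> ring_mod.span (D n \<union> N1)"
        using ring_mod.span_superset[of "D n \<union> N1"] by blast
      also have "\<dots> \<subseteq> sat P (ring_mod.span (D n \<union> N1))" by (rule sat_subset[OF P])
      finally show "I \<subseteq> sat P (ring_mod.span (D n \<union> N1))" .
    qed (use P in \<open>auto simp: subspace_sat sat_sat\<close>)
    moreover have "N1 \<subseteq> E n" for n
      unfolding E_def using sat_subset[OF P] ring_mod.span_superset[of "D n \<union> N1"] by blast
    moreover have "E (Suc n) \<subseteq> E n" for n
      unfolding E_def using D by (intro sat_mono ring_mod.span_mono) blast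
    ultimately obtain n where n: "\<And>k. k \<ge> n \<Longrightarrow> E k = E n"
      using dcc1 unfolding dcc_def by meson
    \<comment> \<open>From \<open>m\<close> on both the sums with \<open>N1\<close> (by the choice
      of \<open>n\<close>) and the intersections with \<open>N1\<close> are constant; the modular
      law then makes \<open>D\<close> constant.\<close>
    obtain m where m: "m \<ge> n" "\<And>k. k \<ge> m \<Longrightarrow> D m \<inter> N1 \<subseteq> D k"
    proof (cases "\<exists>m\<ge>n. D m \<inter> N1 \<subseteq> N")
      case True
      then show ?thesis using that D by (meson order_trans)
    next
      case False
      then have "N1 \<subseteq> D m" if "m \<ge> n" for m using layer that by blast
      then show ?thesis using that[of n] by blast
    qed
    have "D m \<subseteq> D k" if k: "k \<ge> m" for k
    proof
      fix z assume z: "z \<in> D m"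
      have "z \<in> E m" unfolding E_def
        using z sat_subset[OF P] ring_mod.span_superset[of "D m \<union> N1"] by blast
      then have "z \<in> E k" using n k m(1) by (metis order_trans)
      then obtain s where s: "s \<notin> P" "s * z \<in> ring_mod.span (D k \<union> N1)"
        unfolding E_def by (auto elim: satE)
      have "ring_mod.subspace N1" using N1(1) by (simp add: good_def)
      then have eq: "ring_mod.span (D k) = D k" "ring_mod.span N1 = N1" using Dsub(1) by simp_all
      obtain u v where uv: "u \<in> D k" "v \<in> N1" "s * z = u + v"
        using s(2) unfolding ring_mod.span_Un eq by blast
      have "v = s * z - u" using uv(3) by simp
      then have "v \<in> D m" using z uv(1) mono[OF k] Dsub(1)
        by (metis ring_mod.subspace_diff ring_mod.subspace_scale subsetD)
      then have "v \<in> D k" using m(2)[OF k] uv(2) by blast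
      then have "s * z \<in> D k" using uv Dsub(1) ring_mod.subspace_add by auto
      then show "z \<in> D k" using s(1) Dsub(2) satI by blast
    qed
    then have "\<forall>k\<ge>m. D k = D m" using mono by blast
    then show "\<exists>n. \<forall>k\<ge>n. D k = D n" by blast
  qed
  then show False using N(2) by blast
qed

text \<open>Krull's principal ideal theorem, in the domain \<open>R/Q\<^sub>0\<close>: a prime minimal over \<open>x\<close> cannot have
  height two.  The proof compares the ideals \<open>y\<^sup>n R\<^bsub>Q\<^sub>1\<^esub> \<inter> R\<close> for some \<open>y\<close> in \<open>Q\<^sub>1\<close> but not in \<open>Q\<^sub>0\<close>.\<close>

lemma principal_ideal_theorem:
  fixes Q0 Q1 P :: "'r set"
  assumes Q0: "prime_ideal Q0" and Q1: "prime_ideal Q1" and P: "prime_ideal P"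
    and sub: "Q0 \<subset> Q1" "Q1 \<subset> P" and x: "x \<in> P"
  shows "\<exists>Q. prime_ideal Q \<and> Q0 \<subseteq> Q \<and> x \<in> Q \<and> Q \<subset> P"
proof (rule ccontr)
  assume none: "\<not> ?thesis"
  then have x1: "x \<notin> Q1" using Q1 sub by blast
  note subs = prime_ideal_subspace[OF Q0] prime_ideal_subspace[OF Q1]
  obtain y where y: "y \<in> Q1" "y \<notin> Q0" using sub by blast
  define K where "K n = sat Q1 (ring_mod.span (insert (y ^ n) Q0))" for n
  have Ksub: "ring_mod.subspace (K n)" for n
    unfolding K_def by (simp add: subspace_sat Q1)
  have KQ1: "sat Q1 (K n) = K n" for n unfolding K_def by (simp add: sat_sat Q1)
  have KP: "sat P (K n) = K n" for n
  proof
    have "sat P (K n) \<subseteq> sat Q1 (K n)" using sub(2) unfolding sat_def by blast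
    then show "sat P (K n) \<subseteq> K n" using KQ1 by simp
  qed (rule sat_subset[OF P])
  have Q0K: "Q0 \<subseteq> K n" and yK: "y ^ n \<in> K n" for n unfolding K_def
    using sat_subset[OF Q1] ring_mod.span_superset by blast+
  have Kmono: "K (Suc n) \<subseteq> K n" for n
  proof -
    have "insert (y ^ Suc n) Q0 \<subseteq> K n"
      using Q0K yK ring_mod.subspace_scale[OF Ksub] by auto
    then show ?thesis unfolding K_def[of "Suc n"]
      by (intro sat_minimal ring_mod.span_minimal Ksub KQ1)
  qed
  \<comment> \<open>Adding \<open>x\<close> to \<open>K n\<close> makes the chain stabilize: under
    the negated claim, \<open>P\<close> is the only prime inside \<open>P\<close> that contains both
    \<open>Q0\<close> and \<open>x\<close>.\<close>
  define D where "D n = sat P (ring_mod.span (insert x (K n)))" for n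
  define I where "I = sat P (ring_mod.span (insert x Q0))"
  have "\<exists>n. \<forall>k\<ge>n. D k = D n"
  proof (rule descending_stabilizes[OF P, of I])
    show "Q = P" if Q: "prime_ideal Q" "I \<subseteq> Q" "Q \<subseteq> P" for Q
    proof -
      have "insert x Q0 \<subseteq> I" unfolding I_def
        using sat_subset[OF P] ring_mod.span_superset by blast
      then show ?thesis using Q none by blast
    qed
    show "I \<subseteq> D n" for n unfolding I_def D_def
      using Q0K by (intro sat_mono ring_mod.span_mono) blast
    show "D (Suc n) \<subseteq> D n" for n unfolding D_def
      using Kmono by (intro sat_mono ring_mod.span_mono) blast
  qed (simp_all add: I_def D_def subspace_sat sat_sat P)
  then obtain n where n: "D (Suc n) = D n" by (metis le_SucI order_refl)
  have "K n \<subseteq> K (Suc n)"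
  proof (rule nakayama[OF P Ksub KP x])
    fix k assume k: "k \<in> K n"
    then have "k \<in> D (Suc n)" unfolding n
      unfolding D_def using sat_subset[OF P] ring_mod.span_superset by blast
    then obtain s i c where s: "s \<notin> P" "i \<in> K (Suc n)" "s * k = i + c * x"
      unfolding D_def by (rule mem_sat_insertE[OF _ Ksub])
    \<comment> \<open>As \<open>x\<close> is outside \<open>Q1\<close> and \<open>K n\<close> is
      \<open>Q1\<close>-saturated, the coefficient \<open>c\<close> falls back into
      \<open>K n\<close>. So \<open>K n\<close> lies in \<open>K (Suc n) + x K n\<close> at
      \<open>P\<close>, and Nakayama removes the second term.\<close>
    have "x * c = s * k - i" using s(3) by (simp add: mult.commute)
    then have "x * c \<in> K n" using k s(2) Kmono Ksub
      by (metis ring_mod.subspace_diff ring_mod.subspace_scale subsetD)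
    then have "c \<in> K n" using satI[OF x1] KQ1 by blast
    then show "\<exists>s l k'. s \<notin> P \<and> l \<in> K (Suc n) \<and> k' \<in> K n \<and> s * k = l + x * k'"
      using s by (metis mult.commute)
  qed
  then have "y ^ n \<in> K (Suc n)" using yK by blast
  \<comment> \<open>Modulo the prime \<open>Q0\<close>, cancelling \<open>y^n\<close> leaves
    \<open>u = c y\<close>, which would place \<open>u\<close> inside \<open>Q1\<close>.\<close>
  then obtain u i c where u: "u \<notin> Q1" "i \<in> Q0" "u * y ^ n = i + c * y ^ Suc n"
    unfolding K_def by (rule mem_sat_insertE[OF _ subs(1)])
  then have "y ^ n * (u - c * y) \<in> Q0" by (simp add: algebra_simps)
  then have "u - c * y \<in> Q0" using y(2) Q0 prime_ideal_mult prime_ideal_power by blast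
  then have "u - c * y \<in> Q1" using sub by blast
  then have "(u - c * y) + c * y \<in> Q1"
    using y(1) subs(2) by (intro ring_mod.subspace_add ring_mod.subspace_scale)
  then show False using u(1) by simp
qed

end

section \<open>Regular systems of parameters\<close>

lemma span_ideal: "ring_mod.subspace I \<Longrightarrow> ring_mod.span I = I"
  by simp

text \<open>\<open>n\<close> counts strict inclusions, and the recursion peels off the top, since
  \<open>prime_chain_shift\<close> replaces primes from the top downwards.\<close>

primrec prime_chain :: "nat \<Rightarrow> 'r::comm_ring_1 set \<Rightarrow> 'r set \<Rightarrow> bool" where
  "prime_chain 0 A B \<longleftrightarrow> prime_ideal A \<and> A = B"
| "prime_chain (Suc n) A B \<longleftrightarrow> (\<exists>C. prime_chain n A C \<and> C \<subset> B \<and> prime_ideal B)"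

lemma prime_chain_prime: "prime_chain n A B \<Longrightarrow> prime_ideal A \<and> prime_ideal B \<and> A \<subseteq> B"
proof (induction n arbitrary: B)
  case (Suc n)
  then obtain C where "prime_chain n A C" "C \<subset> B" "prime_ideal B" by auto
  then show ?case using Suc.IH by blast
qed simp

lemma prime_chain_extend_below:
  "prime_chain n A B \<Longrightarrow> A' \<subset> A \<Longrightarrow> prime_ideal A' \<Longrightarrow> prime_chain (Suc n) A' B"
proof (induction n arbitrary: B)
  case 0
  then show ?case by auto
next
  case (Suc n)
  then obtain C where "prime_chain n A C" "C \<subset> B" "prime_ideal B" by auto
  then have "prime_chain (Suc n) A' C" using Suc by blast
  then show ?case using \<open>C \<subset> B\<close> \<open>prime_ideal B\<close> by auto
qed

lemma prime_chain_of_sequence: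
  assumes "\<And>i. i \<le> n \<Longrightarrow> prime_ideal (Q i)" "\<And>i. i < n \<Longrightarrow> Q i \<subset> Q (Suc i)"
  shows "prime_chain n (Q 0) (Q n)"
  using assms
proof (induction n)
  case (Suc n)
  then have "prime_chain n (Q 0) (Q n)" "Q n \<subset> Q (Suc n)" "prime_ideal (Q (Suc n))" by auto
  then show ?case by auto
qed simp

text \<open>The principal ideal theorem exchanges each intermediate prime, from the top down, for
  one that contains \<open>x\<close>; only the lowest prime is lost. Passing to the quotient by
  \<open>x\<close> thus lowers the dimension by at most one.\<close>

lemma (in noetherian_comm_ring) prime_chain_shift:
  fixes A B :: "'r set"
  assumes "prime_chain (Suc n) A B" "x \<in> B"
  shows "\<exists>A'. A \<subset> A' \<and> x \<in> A' \<and> prime_chain n A' B"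
  using assms
proof (induction n arbitrary: B)
  case 0
  then show ?case by (intro exI[of _ B]) auto
next
  case (Suc n)
  then obtain C where C: "prime_chain (Suc n) A C" "C \<subset> B" "prime_ideal B" by auto
  obtain C' where C': "prime_chain (Suc n) A C'" "C' \<subset> B" "x \<in> C'"
  proof (cases "x \<in> C")
    case True
    then show ?thesis using that C by blast
  next
    case False
    obtain D where D: "prime_chain n A D" "D \<subset> C" "prime_ideal C" using C(1) by auto
    then have "prime_ideal D" using prime_chain_prime by blast
    then obtain Q where Q: "prime_ideal Q" "D \<subseteq> Q" "x \<in> Q" "Q \<subset> B"
      using principal_ideal_theorem[of D C B x] D C Suc.prems(2) by blast
    moreover have "D \<noteq> Q" using Q(3) False D(2) by blast
    ultimately have "prime_chain (Suc n) A Q" using D(1) by auto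
    then show ?thesis using that Q by blast
  qed
  then obtain A' where "A \<subset> A'" "x \<in> A'" "prime_chain n A' C'" using Suc.IH by blast
  then show ?case using C' C(3) by auto
qed

text \<open>The quotient of \<open>R\<^bsub>P\<^esub>\<close> by \<open>I\<close> is regular, with \<open>G\<close> as a regular system of parameters.\<close>

definition regular_params :: "'r::comm_ring_1 set \<Rightarrow> 'r set \<Rightarrow> 'r set \<Rightarrow> bool" where
  "regular_params P I G \<longleftrightarrow> prime_ideal P \<and> ring_mod.subspace I \<and> sat P I = I \<and> finite G \<and>
     sat P (ring_mod.span (I \<union> G)) = P \<and> (\<exists>A. I \<subseteq> A \<and> prime_chain (card G) A P)"

lemma sat_span_insert:
  assumes P: "prime_ideal P" and "sat P (ring_mod.span (I \<union> insert x G)) = P"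
  shows "sat P (ring_mod.span (sat P (ring_mod.span (insert x I)) \<union> G)) = P"
proof
  let ?I = "sat P (ring_mod.span (insert x I))"
  have PP: "sat P P = P" by (simp add: sat_prime P)
  have sub: "I \<union> insert x G \<subseteq> P"
    using assms(2) sat_subset[OF P, of "ring_mod.span (I \<union> insert x G)"]
      ring_mod.span_superset[of "I \<union> insert x G"] by blast
  have "?I \<subseteq> P" using sub prime_ideal_subspace[OF P]
    by (intro sat_minimal[OF _ PP] ring_mod.span_minimal) auto
  then show "sat P (ring_mod.span (?I \<union> G)) \<subseteq> P" using sub prime_ideal_subspace[OF P]
    by (intro sat_minimal[OF _ PP] ring_mod.span_minimal) auto
  have "insert x I \<subseteq> ?I"
    using sat_subset[OF P, of "ring_mod.span (insert x I)"] ring_mod.span_superset[of "insert x I"]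
    by blast
  then have "sat P (ring_mod.span (I \<union> insert x G)) \<subseteq> sat P (ring_mod.span (?I \<union> G))"
    by (intro sat_mono ring_mod.span_mono) auto
  then show "P \<subseteq> sat P (ring_mod.span (?I \<union> G))" using assms(2) by simp
qed

context noetherian_comm_ring
begin

text \<open>Krull's height theorem for \<open>R_P/I\<close>: each generator of the maximal ideal
  shortens a chain by at most one, by \<open>prime_chain_shift\<close>.\<close>

lemma prime_chain_bound:
  fixes P I :: "'r set"
  assumes "finite G" "prime_ideal P" "ring_mod.subspace I" "sat P I = I"
    "sat P (ring_mod.span (I \<union> G)) = P" "I \<subseteq> A" "prime_chain n A P"
  shows "n \<le> card G"
  using assms
proof (induction G arbitrary: I n A rule: finite_induct)
  case empty
  then have "I = P" by (simp add: span_ideal)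
  moreover have "A \<subset> P" if "n = Suc m" for m
    using empty.prems(6) that prime_chain_prime[of m A] by auto
  ultimately show ?case using empty.prems(5) by (cases n) auto
next
  case (insert x G)
  show ?case
  proof (cases n)
    case (Suc m)
    define I' where "I' = sat P (ring_mod.span (insert x I))"
    have xP: "x \<in> P"
      using insert.prems(4) sat_subset[OF insert.prems(1), of "ring_mod.span (I \<union> insert x G)"]
        ring_mod.span_superset[of "I \<union> insert x G"] by blast
    then obtain A' where A': "A \<subset> A'" "x \<in> A'" "prime_chain m A' P"
      using prime_chain_shift[of m A P x] insert.prems(6) Suc by blast
    have p: "prime_ideal A'" "A' \<subseteq> P" using prime_chain_prime[OF A'(3)] by auto
    then have sub: "I' \<subseteq> A'"
      unfolding I'_def using A' insert.prems(1,5) prime_ideal_subspace[OF p(1)]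
      by (intro sat_minimal ring_mod.span_minimal sat_prime) auto
    have "m \<le> card G"
    proof (rule insert.IH[OF insert.prems(1) _ _ _ sub A'(3)])
      show "sat P (ring_mod.span (I' \<union> G)) = P"
        unfolding I'_def by (rule sat_span_insert) fact+
    qed (use insert.prems(1) in \<open>simp_all add: I'_def subspace_sat sat_sat\<close>)
    then show ?thesis using Suc insert.hyps by simp
  qed simp
qed

text \<open>A shifted chain has length \<open>card G\<close>, so the quotient by the parameter
  \<open>x\<close> is again regular. If \<open>x\<close> lay in the bottom prime \<open>A\<close>,
  the unshifted chain would start above \<open>I'\<close> and exceed
  \<open>prime_chain_bound\<close>; hence \<open>x\<close> is not in \<open>I\<close>
  either.\<close>

lemma regular_params_insert:
  fixes P I G :: "'r set"
  assumes r: "regular_params P I (insert x G)" and x: "x \<notin> G"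
  defines "I' \<equiv> sat P (ring_mod.span (insert x I))"
  shows "regular_params P I' G" "x \<notin> I"
proof -
  have P: "prime_ideal P" and I: "ring_mod.subspace I" "sat P I = I" "finite G"
    and gen: "sat P (ring_mod.span (I \<union> insert x G)) = P"
    using r by (auto simp: regular_params_def)
  have I': "ring_mod.subspace I'" "sat P I' = I'" unfolding I'_def
    using P by (auto simp: subspace_sat sat_sat)
  have II': "insert x I \<subseteq> I'" unfolding I'_def
    using sat_subset[OF P] ring_mod.span_superset by blast
  have gen': "sat P (ring_mod.span (I' \<union> G)) = P"
    unfolding I'_def by (rule sat_span_insert[OF P gen])
  have xP: "x \<in> P"
    using gen sat_subset[OF P, of "ring_mod.span (I \<union> insert x G)"]
      ring_mod.span_superset[of "I \<union> insert x G"] by blast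
  have min: "I' \<subseteq> B" if "x \<in> B" "I \<subseteq> B" "prime_ideal B" "B \<subseteq> P" for B
    unfolding I'_def using that P prime_ideal_subspace
    by (intro sat_minimal ring_mod.span_minimal sat_prime) auto
  have bound: "n \<le> card G" if "I' \<subseteq> A" "prime_chain n A P" for n A
    using prime_chain_bound[OF I(3) P I' gen' that] .
  have main: "regular_params P I' G \<and> x \<notin> A \<and> (\<exists>A'. A \<subset> A' \<and> I' \<subseteq> A' \<and> prime_chain (card G) A' P)"
    if A: "I \<subseteq> A" "prime_chain (card (insert x G)) A P" for A
  proof -
    have A1: "prime_chain (Suc (card G)) A P" using A(2) x I(3) by simp
    then obtain A' where A': "A \<subset> A'" "x \<in> A'" "prime_chain (card G) A' P"
      using prime_chain_shift[OF A1 xP] by blast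
    have "I' \<subseteq> A'" using A' A(1) prime_chain_prime[OF A'(3)] by (intro min) auto
    moreover have "x \<notin> A"
      using bound[of A "Suc (card G)"] A1 A(1) min[of A] prime_chain_prime[OF A1] by auto
    ultimately show ?thesis using A' P I' I(3) gen' by (auto simp: regular_params_def)
  qed
  obtain A where "I \<subseteq> A" "prime_chain (card (insert x G)) A P"
    using r unfolding regular_params_def by blast
  then show "regular_params P I' G" and "x \<notin> I" using main by blast+
qed

text \<open>Induction on the parameters: the quotient by \<open>x\<close> is a domain, the bottom
  prime \<open>A\<close> of a longest chain then lies in \<open>I + xA\<close>, and Nakayama gives
  \<open>A = I\<close>. This is the theorem that regular local rings are domains.\<close>

lemma regular_params_prime:
  fixes P I G :: "'r set"
  assumes "regular_params P I G"
  shows "prime_ideal I"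
proof -
  have "finite G" using assms by (simp add: regular_params_def)
  then show ?thesis using assms
  proof (induction G arbitrary: I rule: finite_induct)
    case empty
    then show ?case by (auto simp: regular_params_def span_ideal)
  next
    case (insert x G)
    define I' where "I' = sat P (ring_mod.span (insert x I))"
    have P: "prime_ideal P" and I: "ring_mod.subspace I" "sat P I = I" "finite G"
      and gen: "sat P (ring_mod.span (I \<union> insert x G)) = P"
      using insert.prems by (auto simp: regular_params_def)
    have r': "regular_params P I' G"
      unfolding I'_def using regular_params_insert(1)[OF insert.prems insert.hyps(2)] .
    then have pI': "prime_ideal I'" using insert.IH by blast
    have I': "ring_mod.subspace I'" "sat P I' = I'" "sat P (ring_mod.span (I' \<union> G)) = P"
      using r' by (auto simp: regular_params_def)
    have xP: "x \<in> P"
      using gen sat_subset[OF P, of "ring_mod.span (I \<union> insert x G)"]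
        ring_mod.span_superset[of "I \<union> insert x G"] by blast
    obtain A where A: "I \<subseteq> A" "prime_chain (card (insert x G)) A P"
      using insert.prems by (auto simp: regular_params_def)
    then have A1: "prime_chain (Suc (card G)) A P" using insert.hyps by simp
    then obtain A' where A': "A \<subset> A'" "x \<in> A'" "prime_chain (card G) A' P"
      using prime_chain_shift[OF A1 xP] by blast
    have pA: "prime_ideal A" "A \<subseteq> P" using prime_chain_prime[OF A1] by auto
    have pA': "prime_ideal A'" "A' \<subseteq> P" using prime_chain_prime[OF A'(3)] by auto
    have min: "I' \<subseteq> B" if "x \<in> B" "I \<subseteq> B" "prime_ideal B" "B \<subseteq> P" for B
      unfolding I'_def using that P prime_ideal_subspace
      by (intro sat_minimal ring_mod.span_minimal sat_prime) auto
    \<comment> \<open>Both are prime; a strict inclusion would extend the chain over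
      \<open>A'\<close> to one longer than \<open>prime_chain_bound\<close> allows.\<close>
    have "I' = A'"
    proof (rule ccontr)
      assume "I' \<noteq> A'"
      then have "I' \<subset> A'" using min[of A'] A' A(1) pA' by blast
      then have "prime_chain (Suc (card G)) I' P"
        using prime_chain_extend_below A'(3) pI' by blast
      then show False using prime_chain_bound[OF I(3) P I' order_refl] by fastforce
    qed
    have "x \<notin> A"
      using prime_chain_bound[OF I(3) P I' _ A1] min[of A] A(1) pA by auto
    have "A \<subseteq> I"
    proof (rule nakayama[OF P I(1,2) xP])
      fix k assume k: "k \<in> A"
      then have "k \<in> I'" using \<open>I' = A'\<close> A'(1) by blast
      then obtain s i c where s: "s \<notin> P" "i \<in> I" "s * k = i + c * x"
        unfolding I'_def by (rule mem_sat_insertE[OF _ I(1)])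
      have "c * x = s * k - i" using s(3) by simp
      then have "c * x \<in> A" using k s(2) A(1) prime_ideal_subspace[OF pA(1)]
        by (metis ring_mod.subspace_diff ring_mod.subspace_scale subsetD)
      \<comment> \<open>\<open>A\<close> is prime and misses \<open>x\<close>, so in
        \<open>s * k = i + c * x\<close> the coefficient is again in \<open>A\<close>; this is the
        shape that Nakayama asks for.\<close>
      then have "c \<in> A" using \<open>x \<notin> A\<close> prime_ideal_mult[OF pA(1)] by blast
      then show "\<exists>s l k'. s \<notin> P \<and> l \<in> I \<and> k' \<in> A \<and> s * k = l + x * k'"
        using s by (metis mult.commute)
    qed
    then show ?case using A(1) pA(1) by simp
  qed
qed

lemma regular_params_Un:
  fixes P I G S :: "'r set"
  assumes "finite S" "regular_params P I (S \<union> G)" "S \<inter> G = {}"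
  shows "regular_params P (sat P (ring_mod.span (S \<union> I))) G"
  using assms
proof (induction S arbitrary: I rule: finite_induct)
  case empty
  then have "sat P (ring_mod.span ({} \<union> I)) = I" by (simp add: regular_params_def span_ideal)
  then show ?case using empty by simp
next
  case (insert x S)
  define I' where "I' = sat P (ring_mod.span (insert x I))"
  have P: "prime_ideal P" using insert.prems by (simp add: regular_params_def)
  have sat_eq: "sat P (ring_mod.span (S \<union> I')) = sat P (ring_mod.span (insert x S \<union> I))" (is "?L = ?R")
  proof
    have R: "ring_mod.subspace ?R" "sat P ?R = ?R"
      using P by (simp_all add: subspace_sat sat_sat)
    have "insert x S \<union> I \<subseteq> ?R"
      using ring_mod.span_superset sat_subset[OF P] by (rule order_trans)
    moreover from this have "I' \<subseteq> ?R" unfolding I'_def using R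
      by (intro sat_minimal ring_mod.span_minimal) auto
    ultimately show "?L \<subseteq> ?R" using R by (intro sat_minimal ring_mod.span_minimal) auto
    have "insert x I \<subseteq> I'"
      unfolding I'_def using ring_mod.span_superset sat_subset[OF P] by (rule order_trans)
    then show "?R \<subseteq> ?L" by (intro sat_mono ring_mod.span_mono) auto
  qed
  have "regular_params P I' (S \<union> G)"
    unfolding I'_def using insert by (intro regular_params_insert(1)) auto
  then have "regular_params P (sat P (ring_mod.span (S \<union> I'))) G"
    using insert by (intro insert.IH) auto
  then show ?case using sat_eq by simp
qed

text \<open>Dividing out \<open>S\<close> leaves the parameters \<open>G - S\<close> on a regular
  quotient. Applied to all \<open>S\<close>, this makes \<open>G\<close> a regular sequence at
  \<open>P\<close> in every order, which is the base of the exponent induction below.\<close>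

lemma regular_params_subset:
  fixes P G S :: "'r set"
  assumes "regular_params P (sat P {0}) G" "S \<subseteq> G"
  shows "prime_ideal (sat P (ring_mod.span S))" "x \<in> G \<Longrightarrow> x \<notin> S \<Longrightarrow> x \<notin> sat P (ring_mod.span S)"
proof -
  have P: "prime_ideal P" and "finite G" using assms(1) by (auto simp: regular_params_def)
  have eq: "sat P (ring_mod.span (S \<union> sat P {0})) = sat P (ring_mod.span S)"
  proof
    have "sat P {0} \<subseteq> sat P (ring_mod.span S)"
      by (intro sat_mono) (simp add: ring_mod.span_zero)
    moreover have "S \<subseteq> sat P (ring_mod.span S)"
      using ring_mod.span_superset sat_subset[OF P] by (rule order_trans)
    ultimately show "sat P (ring_mod.span (S \<union> sat P {0})) \<subseteq> sat P (ring_mod.span S)"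
      using P by (intro sat_minimal ring_mod.span_minimal) (auto simp: subspace_sat sat_sat)
  qed (intro sat_mono ring_mod.span_mono, blast)
  have "S \<union> (G - S) = G" using assms(2) by blast
  then have r: "regular_params P (sat P (ring_mod.span S)) (G - S)"
    using regular_params_Un[of S P "sat P {0}" "G - S"] assms \<open>finite G\<close> finite_subset eq by auto
  then show "prime_ideal (sat P (ring_mod.span S))" by (rule regular_params_prime)
  show "x \<notin> sat P (ring_mod.span S)" if "x \<in> G" "x \<notin> S"
  proof -
    have "G - S = insert x (G - S - {x})" using that by blast
    then show ?thesis using r regular_params_insert(2)[of P "sat P (ring_mod.span S)" x "G - S - {x}"] by simp
  qed
qed

end

section \<open>Powers of regular sequences\<close>

lemma span_image_insert:
  "ring_mod.span (h ` insert z T) = ring_mod.span (insert (h z) (ring_mod.span (h ` T)))"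
proof
  have "insert (h z) (h ` T) \<subseteq> ring_mod.span (insert (h z) (ring_mod.span (h ` T)))"
    using ring_mod.span_superset[of "h ` T"]
      ring_mod.span_superset[of "insert (h z) (ring_mod.span (h ` T))"] by blast
  then show "ring_mod.span (h ` insert z T) \<subseteq> ring_mod.span (insert (h z) (ring_mod.span (h ` T)))"
    by (intro ring_mod.span_minimal) simp_all
  have "ring_mod.span (h ` T) \<subseteq> ring_mod.span (h ` insert z T)"
    by (intro ring_mod.span_mono) blast
  moreover have "h z \<in> ring_mod.span (h ` insert z T)" by (simp add: ring_mod.span_base)
  ultimately show "ring_mod.span (insert (h z) (ring_mod.span (h ` T))) \<subseteq> ring_mod.span (h ` insert z T)"
    by (intro ring_mod.span_minimal) auto
qed

lemma power_cancel:
  fixes x :: "'a::comm_monoid_mult"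
  assumes "\<And>y. x * y \<in> I \<Longrightarrow> y \<in> I" "x ^ n * y \<in> I"
  shows "y \<in> I"
  using assms(2)
proof (induction n arbitrary: y)
  case (Suc n)
  then have "x ^ n * (x * y) \<in> I" by (simp add: mult_ac)
  then show ?case using Suc.IH assms(1) by blast
qed simp

text \<open>Induction on the sum of the exponents. With all exponents 1 the ideal is prime and
  misses \<open>x\<close>. Otherwise lower one exponent from \<open>m + 1\<close> to
  \<open>m\<close>, and use that \<open>z\<close> is regular modulo the remaining powers to divide a
  relation by \<open>z^m\<close>.\<close>

lemma (in noetherian_comm_ring) regular_params_power:
  fixes P G S :: "'r set" and a :: "'r \<Rightarrow> nat"
  assumes r: "regular_params P (sat P {0}) G"
    and "S \<subseteq> G" "x \<in> G" "x \<notin> S" "\<And>z. z \<in> S \<Longrightarrow> 0 < a z"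
    and "x * y \<in> sat P (ring_mod.span ((\<lambda>z. z ^ a z) ` S))"
  shows "y \<in> sat P (ring_mod.span ((\<lambda>z. z ^ a z) ` S))"
  using assms(2-)
proof (induction "sum a S" arbitrary: S a x y rule: less_induct)
  case less
  have P: "prime_ideal P" and fin: "finite S"
    using r less.prems(1) by (auto simp: regular_params_def intro: finite_subset)
  have sub: "ring_mod.subspace (sat P (ring_mod.span A))" for A
    by (simp add: subspace_sat P)
  show ?case
  proof (cases "\<exists>z\<in>S. a z \<noteq> 1")
    case False
    then have "(\<lambda>z. z ^ a z) ` S = S" by (simp add: image_def)
    moreover have "y \<in> sat P (ring_mod.span S)" if "x * y \<in> sat P (ring_mod.span S)"
      using that regular_params_subset[OF r less.prems(1)] less.prems(2,3) prime_ideal_mult by blast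
    ultimately show ?thesis using less.prems(5) by simp
  next
    case True
    then obtain z m where z: "z \<in> S" "a z = Suc m" "0 < m"
      using less.prems(4) by (metis One_nat_def Suc_pred' neq0_conv)
    define T where "T = S - {z}"
    have S: "S = insert z T" "z \<notin> T" "finite T" using z fin by (auto simp: T_def)
    define L where "L = ring_mod.span ((\<lambda>z. z ^ a z) ` T)"
    have Lsub: "ring_mod.subspace L" by (simp add: L_def)
    have sat_eq: "sat P (ring_mod.span ((\<lambda>v. v ^ (a(z := n)) v) ` S))
        = sat P (ring_mod.span (insert (z ^ n) L))" for n
    proof -
      have "(\<lambda>v. v ^ (a(z := n)) v) ` T = (\<lambda>v. v ^ a v) ` T"
        using S(2) by (intro image_cong) auto
      then show ?thesis
        using span_image_insert[of "\<lambda>v. v ^ (a(z := n)) v" z T] S(1) by (simp add: L_def)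
    qed
    have sat_eq': "sat P (ring_mod.span ((\<lambda>v. v ^ a v) ` S)) = sat P (ring_mod.span (insert (z ^ Suc m) L))"
      using sat_eq[of "Suc m"] z(2) by (simp add: fun_upd_idem)
    have suma: "sum (a(z := n)) S = n + sum a T" for n
    proof -
      have "sum (a(z := n)) T = sum a T" using S(2) by (intro sum.cong) auto
      then show ?thesis using S by simp
    qed
    have sumaS: "sum a S = Suc m + sum a T" using S z(2) by simp
    \<comment> \<open>The induction hypothesis is used for \<open>x\<close> with the exponent of
      \<open>z\<close> lowered to some \<open>n \<le> m\<close>, and, in \<open>zreg\<close>, for
      \<open>z\<close> in place of \<open>x\<close> with \<open>z\<close> dropped from
      \<open>S\<close>.\<close>
    have xreg: "v \<in> sat P (ring_mod.span (insert (z ^ n) L))"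
      if "x * v \<in> sat P (ring_mod.span (insert (z ^ n) L))" "0 < n" "n \<le> m" for v n
      using less.hyps[of "a(z := n)" S x v] that less.prems sat_eq[of n] suma[of n] sumaS by auto
    have zreg: "v \<in> sat P L" if "z * v \<in> sat P L" for v
      using less.hyps[of a T z v] that less.prems sumaS S by (auto simp: L_def)
    have "insert (z ^ Suc m) L \<subseteq> ring_mod.span (insert (z ^ m) L)"
      using ring_mod.span_superset[of "insert (z ^ m) L"]
        ring_mod.span_scale[OF ring_mod.span_base[of "z ^ m" "insert (z ^ m) L"], of z] by auto
    then have "sat P (ring_mod.span (insert (z ^ Suc m) L)) \<subseteq> sat P (ring_mod.span (insert (z ^ m) L))"
      by (intro sat_mono ring_mod.span_minimal) simp_all
    then have "x * y \<in> sat P (ring_mod.span (insert (z ^ m) L))"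
      using less.prems(5) unfolding sat_eq' by (rule subsetD)
    then have "y \<in> sat P (ring_mod.span (insert (z ^ m) L))" using z(3) xreg by blast
    then obtain s k c where s: "s \<notin> P" "k \<in> L" "s * y = k + c * z ^ m"
      by (rule mem_sat_insertE[OF _ Lsub])
    from less.prems(5) obtain t l d where t: "t \<notin> P" "l \<in> L" "t * (x * y) = l + d * z ^ Suc m"
      unfolding sat_eq' by (rule mem_sat_insertE[OF _ Lsub])
    \<comment> \<open>Eliminating \<open>y\<close> between the expansions of \<open>s * y\<close>
      and \<open>t * (x * y)\<close> leaves a multiple of \<open>z^m\<close> in \<open>L\<close>;
      cancelling \<open>z^m\<close> turns it into a relation for \<open>x * c\<close> modulo
      \<open>z\<close>.\<close>
    have "z ^ m * (t * x * c - s * d * z) = t * x * (c * z ^ m) - s * (d * z ^ Suc m)"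
      by (simp add: algebra_simps)
    also have "\<dots> = t * x * (s * y - k) - s * (t * (x * y) - l)"
      using s(3) t(3) by simp
    also have "\<dots> = s * l - t * x * k" by (simp add: algebra_simps)
    also have "\<dots> \<in> L" using s t Lsub by (intro ring_mod.subspace_diff ring_mod.subspace_scale)
    finally have "z ^ m * (t * x * c - s * d * z) \<in> sat P L" using sat_subset[OF P] by blast
    then have "t * x * c - s * d * z \<in> sat P L" using power_cancel zreg by metis
    then obtain u where u: "u \<notin> P" "u * (t * x * c - s * d * z) \<in> L" by (rule satE)
    have "(u * t) * (x * c) = u * (t * x * c - s * d * z) + (u * s * d) * z ^ 1"
      by (simp add: algebra_simps)
    moreover have "u * t \<notin> P" using u t prime_ideal_mult[OF P] by blast
    ultimately have "x * c \<in> sat P (ring_mod.span (insert (z ^ 1) L))"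
      using u(2) mem_sat_insertI Lsub by blast
    then have "c \<in> sat P (ring_mod.span (insert (z ^ 1) L))"
      using xreg[of c 1] z(3) by linarith
    then obtain v k' e where v: "v \<notin> P" "k' \<in> L" "v * c = k' + e * z ^ 1"
      by (rule mem_sat_insertE[OF _ Lsub])
    have "(v * s) * y = v * (k + c * z ^ m)" using s(3) by (simp add: mult.assoc)
    also have "\<dots> = v * k + z ^ m * (v * c)" by (simp add: algebra_simps)
    also have "\<dots> = (v * k + z ^ m * k') + e * z ^ Suc m" unfolding v(3) by (simp add: algebra_simps)
    finally have "(v * s) * y = (v * k + z ^ m * k') + e * z ^ Suc m" .
    moreover have "v * k + z ^ m * k' \<in> L"
      using v s Lsub by (intro ring_mod.subspace_add ring_mod.subspace_scale)
    moreover have "v * s \<notin> P" using v s prime_ideal_mult[OF P] by blast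
    ultimately show ?thesis unfolding sat_eq' using mem_sat_insertI Lsub by blast
  qed
qed

lemma sat_common_denominator:
  assumes P: "prime_ideal P" and I: "ring_mod.subspace I" and "finite B" "\<And>b. b \<in> B \<Longrightarrow> \<alpha> b \<in> sat P I"
  shows "\<exists>s. s \<notin> P \<and> (\<forall>b\<in>B. s * \<alpha> b \<in> I)"
  using assms(3,4)
proof (induction B rule: finite_induct)
  case empty
  then show ?case using prime_ideal_one[OF P] by auto
next
  case (insert b B)
  then obtain s where s: "s \<notin> P" "\<And>b. b \<in> B \<Longrightarrow> s * \<alpha> b \<in> I" by auto
  obtain t where t: "t \<notin> P" "t * \<alpha> b \<in> I" using insert.prems[of b] by (auto elim: satE)
  have "t * (s * \<alpha> c) \<in> I" if "c \<in> B" for c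
    using ring_mod.subspace_scale[OF I s(2)[OF that]] .
  moreover have "s * (t * \<alpha> b) \<in> I" using ring_mod.subspace_scale[OF I t(2)] .
  ultimately have "\<forall>c\<in>insert b B. (t * s) * \<alpha> c \<in> I" by (simp add: mult_ac)
  then show ?case using s t prime_ideal_mult[OF P] by blast
qed

lemma freshmans_dream_diff:
  fixes x y :: "'a::comm_ring_1"
  assumes "prime CHAR('a)" "n = CHAR('a)"
  shows "(x - y) ^ n = x ^ n - y ^ n"
proof -
  have "(x - y + y) ^ n = (x - y) ^ n + y ^ n" by (rule freshmans_dream[OF assms])
  then have "x ^ n = (x - y) ^ n + y ^ n" unfolding diff_add_cancel .
  then show ?thesis unfolding eq_diff_eq by (rule sym)
qed

lemma span_frobenius:
  fixes S :: "'r::comm_ring_1 set"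
  assumes p: "prime p" "CHAR('r) = p" and "u \<in> ring_mod.span S"
  shows "u ^ p \<in> ring_mod.span ((\<lambda>x. x ^ p) ` S)"
  using assms(3)
proof (induction rule: ring_mod.span_induct_alt)
  case base
  then show ?case using p prime_gt_0_nat by (simp add: power_0_left ring_mod.span_zero)
next
  case (step c x y)
  have "(c * x + y) ^ p = c ^ p * x ^ p + y ^ p"
    using p by (simp add: freshmans_dream power_mult_distrib)
  then show ?case using step by (simp add: ring_mod.span_add ring_mod.span_scale ring_mod.span_base)
qed

context noetherian_comm_ring
begin

text \<open>Independence modulo all \<open>x^p\<close>, which minimality of a generating set
  provides, is carried to independence modulo fewer of them. When \<open>x^p\<close> is dropped, the
  coefficients of a relation are multiples of \<open>x\<close> up to the remaining parameters; since
  \<open>x^p\<close> is regular, the cofactors again form a relation, and Nakayama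
  concludes.\<close>

lemma frobenius_basis_descent:
  fixes P G U B :: "'r set"
  assumes p: "prime p" "CHAR('r) = p"
    and r: "regular_params P (sat P {0}) G" and B: "finite B"
    and indep: "\<And>\<alpha> b. (\<Sum>b\<in>B. \<alpha> b ^ p * b) \<in> sat P (ring_mod.span ((\<lambda>x. x ^ p) ` G)) \<Longrightarrow>
      b \<in> B \<Longrightarrow> \<alpha> b \<in> sat P (ring_mod.span G)"
    and T: "T \<subseteq> G" and rel: "(\<Sum>b\<in>B. \<alpha> b ^ p * b) \<in> sat P (ring_mod.span ((\<lambda>x. x ^ p) ` (G - T)))"
    and b: "b \<in> B"
  shows "\<alpha> b \<in> sat P (ring_mod.span (G - T))"
proof -
  have P: "prime_ideal P" and "finite T" using r T by (auto simp: regular_params_def intro: finite_subset)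
  from \<open>finite T\<close> T rel b show ?thesis
  proof (induction T arbitrary: \<alpha> b rule: finite_induct)
    case empty
    then show ?case using indep by simp
  next
    case (insert x T)
    define U where "U = G - insert x T"
    have GT: "G - T = insert x U" "x \<notin> U" "U \<subseteq> G" "x \<in> G" using insert by (auto simp: U_def)
    define I where "I = sat P (ring_mod.span ((\<lambda>x. x ^ p) ` U))"
    have I: "ring_mod.subspace I" "sat P I = I" unfolding I_def by (simp_all add: subspace_sat sat_sat P)
    have xreg: "v \<in> I" if "x ^ p * v \<in> I" for v
    proof (rule power_cancel[OF _ that])
      show "w \<in> I" if "x * w \<in> I" for w
        using regular_params_power[OF r GT(3,4,2), of "\<lambda>_. p"] that p prime_gt_0_nat
        unfolding I_def by blast
    qed
    \<comment> \<open>The coefficients at the fixed \<open>b\<close> in all relations modulo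
      \<open>I\<close>; a mere set, which is why Nakayama is stated for sets.\<close>
    define A where "A = {\<alpha> b | \<alpha>. (\<Sum>b\<in>B. \<alpha> b ^ p * b) \<in> I}"
    have "A \<subseteq> sat P (ring_mod.span U)"
    proof (rule nakayama[OF P])
      show "x \<in> P"
      proof -
        have "G \<subseteq> P"
          using r sat_subset[OF P, of "ring_mod.span (sat P {0} \<union> G)"]
            ring_mod.span_superset[of "sat P {0} \<union> G"] by (auto simp: regular_params_def)
        then show ?thesis using GT by blast
      qed
      fix k assume "k \<in> A"
      then obtain \<alpha> where k: "k = \<alpha> b" and rel: "(\<Sum>b\<in>B. \<alpha> b ^ p * b) \<in> I" by (auto simp: A_def)
      have "I \<subseteq> sat P (ring_mod.span ((\<lambda>x. x ^ p) ` (G - T)))"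
        unfolding I_def GT by (intro sat_mono ring_mod.span_mono) auto
      then have \<alpha>: "\<alpha> c \<in> sat P (ring_mod.span (insert x U))" if "c \<in> B" for c
        using insert.IH[of \<alpha> c] insert.prems(1) rel that GT by auto
      have "\<exists>s. s \<notin> P \<and> (\<forall>c\<in>B. s * \<alpha> c \<in> ring_mod.span (insert x U))"
        by (rule sat_common_denominator[OF P _ B]) (simp_all add: \<alpha>)
      then obtain s where s: "s \<notin> P" "\<And>c. c \<in> B \<Longrightarrow> s * \<alpha> c \<in> ring_mod.span (insert x U)" by blast
      then have "\<forall>c\<in>B. \<exists>d. s * \<alpha> c - d * x \<in> ring_mod.span U"
        by (simp add: ring_mod.span_breakdown_eq)
      then obtain d where d: "\<And>c. c \<in> B \<Longrightarrow> s * \<alpha> c - d c * x \<in> ring_mod.span U" by metis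
      \<comment> \<open>Frobenius is additive, so subtracting the \<open>p\<close>-th powers of the
        parts in \<open>span U\<close> leaves \<open>x^p\<close> times the combination with
        coefficients \<open>d c\<close>.\<close>
      have "x ^ p * (\<Sum>c\<in>B. d c ^ p * c) = s ^ p * (\<Sum>c\<in>B. \<alpha> c ^ p * c) - (\<Sum>c\<in>B. c * (s * \<alpha> c - d c * x) ^ p)"
        using p by (simp add: freshmans_dream_diff power_mult_distrib sum_distrib_left
            sum_subtractf[symmetric] algebra_simps)
      moreover have "(\<Sum>c\<in>B. c * (s * \<alpha> c - d c * x) ^ p) \<in> I"
      proof (intro ring_mod.subspace_sum ring_mod.subspace_scale I(1))
        fix c assume "c \<in> B"
        then have "(s * \<alpha> c - d c * x) ^ p \<in> ring_mod.span ((\<lambda>x. x ^ p) ` U)"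
          using span_frobenius[OF p] d by blast
        then show "(s * \<alpha> c - d c * x) ^ p \<in> I" unfolding I_def using sat_subset[OF P] by blast
      qed
      ultimately have "x ^ p * (\<Sum>c\<in>B. d c ^ p * c) \<in> I"
        using rel I(1) by (simp add: ring_mod.subspace_diff ring_mod.subspace_scale)
      then have "(\<Sum>c\<in>B. d c ^ p * c) \<in> I" by (rule xreg)
      then have "d b \<in> A" by (auto simp: A_def)
      moreover have "s * k = (s * \<alpha> b - d b * x) + x * d b" by (simp add: k mult.commute)
      moreover have "s * \<alpha> b - d b * x \<in> sat P (ring_mod.span U)"
        using d insert.prems(3) sat_subset[OF P] by blast
      ultimately show "\<exists>s l k'. s \<notin> P \<and> l \<in> sat P (ring_mod.span U) \<and> k' \<in> A \<and> s * k = l + x * k'"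
        using s(1) by blast
    qed (simp_all add: subspace_sat sat_sat P)
    moreover have "\<alpha> b \<in> A" using insert.prems(2) by (auto simp: A_def I_def U_def)
    ultimately show ?case by (auto simp: U_def)
  qed
qed

end

section \<open>Projectivity of the Frobenius pushforward\<close>

text \<open>For \<open>q = p\<^sup>e\<close> this is a homomorphism from \<open>F\<^sup>e\<^sub>*R\<close> to \<open>R\<close>.\<close>

definition frob_dual :: "nat \<Rightarrow> ('r::comm_ring_1 \<Rightarrow> 'r) \<Rightarrow> bool" where
  "frob_dual q \<phi> \<longleftrightarrow> (\<forall>a b. \<phi> (a + b) = \<phi> a + \<phi> b) \<and> (\<forall>r a. \<phi> (r ^ q * a) = r * \<phi> a)"

text \<open>For \<open>q = p^e\<close>, the identity \<open>frob_expansion q L r = r\<close> for all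
  \<open>r\<close> says that \<open>L\<close> is a dual basis of \<open>F^e_*R\<close>, because a
  scalar acts there through its \<open>q\<close>-th power.\<close>

definition frob_expansion :: "nat \<Rightarrow> (('r::comm_ring_1 \<Rightarrow> 'r) \<times> 'r) list \<Rightarrow> 'r \<Rightarrow> 'r" where
  "frob_expansion q L r = (\<Sum>(\<phi>, x)\<leftarrow>L. \<phi> r ^ q * x)"

lemma frobenius_module:
  assumes "prime p" "CHAR('r::comm_ring_1) = p"
  shows "Modules.module (\<lambda>r x :: 'r. r ^ p * x)"
  using assms
  by unfold_locales (simp_all add: algebra_simps power_mult_distrib freshmans_dream)

context noetherian_comm_ring
begin

text \<open>A generating set of least size for \<open>F_*R\<close> at \<open>P\<close> is
  independent modulo \<open>P\<close>, and \<open>frobenius_basis_descent\<close> lifts this to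
  independence over \<open>R_P\<close>. A denominator \<open>s\<close> appears as
  \<open>s ^ p\<close>, its action on \<open>F_*R\<close>; a coefficient in \<open>sat P {0}\<close>
  is zero in \<open>R_P\<close>.\<close>

lemma frobenius_local_basis:
  fixes P G :: "'r set"
  assumes p: "prime p" "CHAR('r) = p" and fin: "F_finite p TYPE('r)"
    and r: "regular_params P (sat P {0}) G"
  shows "\<exists>B s. finite B \<and> s \<notin> P \<and> (\<forall>r. \<exists>\<alpha>. s ^ p * r = (\<Sum>b\<in>B. \<alpha> b ^ p * b)) \<and>
    (\<forall>\<alpha>. (\<Sum>b\<in>B. \<alpha> b ^ p * b) = 0 \<longrightarrow> (\<forall>b\<in>B. \<alpha> b \<in> sat P {0}))"
proof -
  interpret F: Modules.module "\<lambda>r x :: 'r. r ^ p * x" by (rule frobenius_module[OF p])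
  note F.scale_scale [simp del]
  have P: "prime_ideal P" and G: "finite G" using r by (auto simp: regular_params_def)
  have Psub: "ring_mod.subspace P" using prime_ideal_subspace[OF P] .
  define gen where "gen B \<longleftrightarrow> finite B \<and> (\<exists>s. s \<notin> P \<and> (\<forall>r. s ^ p * r \<in> F.span B))" for B
  have "\<exists>B. gen B"
  proof -
    obtain B where "finite B" "F.span B = UNIV" using fin by (auto simp: F_finite_def fin_gen_module_def)
    then have "gen B" using prime_ideal_one[OF P] unfolding gen_def by blast
    then show ?thesis by blast
  qed
  then obtain B where B: "gen B" and min: "\<And>C. gen C \<Longrightarrow> card B \<le> card C"
    using ex_has_least_nat[of gen _ card] by metis
  then obtain s where s: "finite B" "s \<notin> P" "\<And>r. s ^ p * r \<in> F.span B" by (auto simp: gen_def)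
  have expand: "\<exists>\<alpha>. s ^ p * r = (\<Sum>b\<in>B. \<alpha> b ^ p * b)" for r
    using s(3)[of r] F.span_finite[OF s(1)] by auto
  have indep: "\<alpha> b \<in> P" if rel: "(\<Sum>b\<in>B. \<alpha> b ^ p * b) \<in> sat P (ring_mod.span ((\<lambda>x. x ^ p) ` G))"
    and b: "b \<in> B" for \<alpha> b
  proof (rule ccontr)
    assume "\<alpha> b \<notin> P"
    obtain t where t: "t \<notin> P" "t * (\<Sum>b\<in>B. \<alpha> b ^ p * b) \<in> ring_mod.span ((\<lambda>x. x ^ p) ` G)"
      using rel by (rule satE)
    have GP: "G \<subseteq> P"
      using r sat_subset[OF P, of "ring_mod.span (sat P {0} \<union> G)"]
        ring_mod.span_superset[of "sat P {0} \<union> G"] by (auto simp: regular_params_def)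
    \<comment> \<open>Elements of the ideal generated by the \<open>p\<close>-th powers of
      \<open>G\<close> expand with coefficients in \<open>P\<close>, because a factor
      \<open>x^p\<close> multiplies each coefficient by \<open>x\<close>.\<close>
    have *: "\<exists>\<gamma>. s ^ p * y = (\<Sum>b\<in>B. \<gamma> b ^ p * b) \<and> (\<forall>b\<in>B. \<gamma> b \<in> P)"
      if "y \<in> ring_mod.span ((\<lambda>x. x ^ p) ` G)" for y
      using that
    proof (induction rule: ring_mod.span_induct_alt)
      case base
      then show ?case using p prime_gt_0_nat ring_mod.subspace_0[OF Psub]
        by (intro exI[of _ "\<lambda>_. 0"]) (simp add: power_0_left)
    next
      case (step c w y)
      then obtain x \<gamma> where x: "x \<in> G" "w = x ^ p"
        and \<gamma>: "s ^ p * y = (\<Sum>b\<in>B. \<gamma> b ^ p * b)" "\<forall>b\<in>B. \<gamma> b \<in> P" by blast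
      obtain \<delta> where \<delta>: "s ^ p * c = (\<Sum>b\<in>B. \<delta> b ^ p * b)" using expand by blast
      have "s ^ p * (c * w + y) = x ^ p * (s ^ p * c) + s ^ p * y" by (simp add: x algebra_simps)
      also have "\<dots> = (\<Sum>b\<in>B. (x * \<delta> b + \<gamma> b) ^ p * b)"
        unfolding \<delta> \<gamma>(1) using p
        by (simp add: sum_distrib_left sum.distrib[symmetric] freshmans_dream power_mult_distrib algebra_simps)
      finally show ?case
        using \<gamma>(2) x(1) GP ring_mod.subspace_add[OF Psub] ring_mod.subspace_scale[OF Psub]
        by (intro exI[of _ "\<lambda>b. x * \<delta> b + \<gamma> b"]) (auto simp: mult.commute)
    qed
    obtain \<gamma> where \<gamma>: "s ^ p * (t ^ p * (\<Sum>b\<in>B. \<alpha> b ^ p * b)) = (\<Sum>b\<in>B. \<gamma> b ^ p * b)" "\<forall>b\<in>B. \<gamma> b \<in> P"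
    proof -
      have "t ^ (p - 1) * (t * (\<Sum>b\<in>B. \<alpha> b ^ p * b)) \<in> ring_mod.span ((\<lambda>x. x ^ p) ` G)"
        using t(2) by (rule ring_mod.span_scale)
      moreover have "t ^ (p - 1) * t = t ^ p"
        using p(1) prime_gt_0_nat power_minus_mult by blast
      ultimately have "t ^ p * (\<Sum>b\<in>B. \<alpha> b ^ p * b) \<in> ring_mod.span ((\<lambda>x. x ^ p) ` G)"
        by (simp only: mult.assoc[symmetric])
      from *[OF this] show ?thesis using that by blast
    qed
    \<comment> \<open>Subtracting the two expansions gives an exact relation whose coefficient at
      \<open>b\<close> is still outside \<open>P\<close>. It can be solved for \<open>b\<close>, and
      \<open>B - {b}\<close> contradicts minimality.\<close>
    define c where "c d = s * t * \<alpha> d - \<gamma> d" for d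
    have "s * t * \<alpha> b \<notin> P" using \<open>\<alpha> b \<notin> P\<close> s(2) t(1) prime_ideal_mult[OF P] by blast
    then have cP: "c b \<notin> P"
      using ring_mod.subspace_add[OF Psub, of "c b" "\<gamma> b"] \<gamma>(2) b
      unfolding c_def diff_add_cancel by blast
    have "(\<Sum>d\<in>B. c d ^ p * d) = s ^ p * (t ^ p * (\<Sum>b\<in>B. \<alpha> b ^ p * b)) - (\<Sum>b\<in>B. \<gamma> b ^ p * b)"
      using p by (simp add: c_def freshmans_dream_diff power_mult_distrib sum_distrib_left
          sum_subtractf left_diff_distrib mult.assoc)
    then have "(\<Sum>d\<in>B. c d ^ p * d) = 0" using \<gamma>(1) by simp
    then have cb: "c b ^ p * b = - (\<Sum>d\<in>B - {b}. c d ^ p * d)"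
      using sum.remove[OF s(1) b, of "\<lambda>d. c d ^ p * d"] by (simp only: eq_neg_iff_add_eq_0)
    have cb_span: "c b ^ p * b \<in> F.span (B - {b})"
      unfolding cb by (intro F.span_neg F.span_sum F.span_scale F.span_base)
    have "(c b * s) ^ p * r \<in> F.span (B - {b})" for r
    proof -
      obtain \<delta> where \<delta>: "s ^ p * r = (\<Sum>b\<in>B. \<delta> b ^ p * b)" using expand by blast
      have "(c b * s) ^ p * r = c b ^ p * (s ^ p * r)" by (simp add: power_mult_distrib mult.assoc)
      also have "\<dots> = (\<Sum>d\<in>B. c b ^ p * (\<delta> d ^ p * d))" unfolding \<delta> by (simp add: sum_distrib_left)
      also have "\<dots> \<in> F.span (B - {b})"
      proof (rule F.span_sum)
        fix d assume d: "d \<in> B"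
        show "c b ^ p * (\<delta> d ^ p * d) \<in> F.span (B - {b})"
        proof (cases "d = b")
          case True
          have "\<delta> b ^ p * (c b ^ p * b) \<in> F.span (B - {b})" using cb_span by (rule F.span_scale)
          then show ?thesis using True by (simp add: mult.left_commute)
        next
          case False
          then have "d \<in> F.span (B - {b})" using d by (intro F.span_base) simp
          then show ?thesis by (intro F.span_scale)
        qed
      qed
      finally show ?thesis .
    qed
    moreover have "c b * s \<notin> P" using cP s(2) prime_ideal_mult[OF P] by blast
    ultimately have "gen (B - {b})" using s(1) unfolding gen_def by blast
    then have "card B \<le> card (B - {b})" by (rule min)
    then show False using b s(1) by (metis card_Diff1_less not_less)
  qed
  have satG: "P \<subseteq> sat P (ring_mod.span G)"
  proof -
    have "sat P {0} \<union> G \<subseteq> sat P (ring_mod.span G)"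
      using sat_mono[of "{0}" "ring_mod.span G" P] ring_mod.span_zero
        sat_subset[OF P, of "ring_mod.span G"] ring_mod.span_superset[of G] by blast
    then have "sat P (ring_mod.span (sat P {0} \<union> G)) \<subseteq> sat P (ring_mod.span G)"
      by (intro sat_minimal ring_mod.span_minimal) (simp_all add: subspace_sat sat_sat P)
    then show ?thesis using r by (simp add: regular_params_def)
  qed
  have "\<alpha> b \<in> sat P {0}" if "(\<Sum>b\<in>B. \<alpha> b ^ p * b) = 0" "b \<in> B" for \<alpha> b
  proof -
    \<comment> \<open>With \<open>T = G\<close> no power remains: the ideal generated by
      \<open>G - G\<close> is zero.\<close>
    have "\<alpha> b \<in> sat P (ring_mod.span (G - G))"
    proof (rule frobenius_basis_descent[OF p r s(1), where T = G and \<alpha> = \<alpha> and b = b])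
      show "\<alpha> b \<in> sat P (ring_mod.span G)"
        if "(\<Sum>b\<in>B. \<alpha> b ^ p * b) \<in> sat P (ring_mod.span ((\<lambda>x. x ^ p) ` G))" "b \<in> B" for \<alpha> b
        using indep[OF that] satG by blast
      show "(\<Sum>b\<in>B. \<alpha> b ^ p * b) \<in> sat P (ring_mod.span ((\<lambda>x. x ^ p) ` (G - G)))"
        using that(1) subspace_sat[OF P, of "{0}"] ring_mod.subspace_0 by auto
    qed (use that in auto)
    then show ?thesis by simp
  qed
  then show ?thesis using s expand by blast
qed

text \<open>Coefficients with respect to \<open>B\<close> are determined only up to
  \<open>sat P {0}\<close>, so a chosen coefficient function need not be linear. This ideal is
  finitely generated, hence killed by a single \<open>u\<close> outside \<open>P\<close>, and
  multiplying the coefficients by \<open>u\<close> makes them linear.\<close>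

lemma frob_expansion_local:
  fixes P G :: "'r set"
  assumes p: "prime p" "CHAR('r) = p" and fin: "F_finite p TYPE('r)"
    and r: "regular_params P (sat P {0}) G"
  shows "\<exists>t L. t \<notin> P \<and> (\<forall>(\<phi>, x)\<in>set L. frob_dual p \<phi>) \<and> (\<forall>r. t ^ p * r = frob_expansion p L r)"
proof -
  have P: "prime_ideal P" using r by (auto simp: regular_params_def)
  obtain B s where B: "finite B" "s \<notin> P" and expand: "\<And>r. \<exists>\<alpha>. s ^ p * r = (\<Sum>b\<in>B. \<alpha> b ^ p * b)"
    and indep: "\<And>\<alpha> b. (\<Sum>b\<in>B. \<alpha> b ^ p * b) = 0 \<Longrightarrow> b \<in> B \<Longrightarrow> \<alpha> b \<in> sat P {0}"
    using frobenius_local_basis[OF assms] by blast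
  obtain \<delta> where \<delta>: "\<And>r. s ^ p * r = (\<Sum>b\<in>B. \<delta> r b ^ p * b)" using expand by metis
  have "ring_mod.subspace (sat P {0})" by (simp add: subspace_sat P)
  then obtain A where A: "finite A" "sat P {0} = ring_mod.span A" using subspace_fin_gen by blast
  have "\<And>a. a \<in> A \<Longrightarrow> a \<in> sat P {0}" using A(2) ring_mod.span_base by blast
  then obtain u where u: "u \<notin> P" "\<And>a. a \<in> A \<Longrightarrow> u * a = 0"
    using sat_common_denominator[OF P ring_mod.subspace_single_0 A(1), of "\<lambda>a. a"] by auto
  have kill: "u * a = 0" if "a \<in> sat P {0}" for a
    using that unfolding A(2)
  proof (induction rule: ring_mod.span_induct_alt)
    case (step c x y)
    then show ?case using u(2) by (simp add: distrib_left mult.left_commute)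
  qed simp
  obtain bs where bs: "set bs = B" "distinct bs" using finite_distinct_list[OF B(1)] by blast
  define L where "L = map (\<lambda>b. (\<lambda>r. u * \<delta> r b, b)) bs"
  have dual: "frob_dual p (\<lambda>r. u * \<delta> r b)" if b: "b \<in> B" for b
    unfolding frob_dual_def
  proof (intro conjI allI)
    fix x y
    have "(\<Sum>b\<in>B. (\<delta> (x + y) b - \<delta> x b - \<delta> y b) ^ p * b) = s ^ p * (x + y) - s ^ p * x - s ^ p * y"
      unfolding \<delta> using p
      by (simp add: freshmans_dream_diff left_diff_distrib sum_subtractf)
    then have "(\<Sum>b\<in>B. (\<delta> (x + y) b - \<delta> x b - \<delta> y b) ^ p * b) = 0" by (simp add: distrib_left)
    then have "\<delta> (x + y) b - \<delta> x b - \<delta> y b \<in> sat P {0}"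
      using indep[of "\<lambda>b. \<delta> (x + y) b - \<delta> x b - \<delta> y b", OF _ b] by simp
    then have "u * (\<delta> (x + y) b - \<delta> x b - \<delta> y b) = 0" by (rule kill)
    then show "u * \<delta> (x + y) b = u * \<delta> x b + u * \<delta> y b"
      by (simp add: right_diff_distrib diff_eq_eq add.commute)
  next
    fix c x
    have "(\<Sum>b\<in>B. (\<delta> (c ^ p * x) b - c * \<delta> x b) ^ p * b) = s ^ p * (c ^ p * x) - c ^ p * (s ^ p * x)"
      unfolding \<delta> using p
      by (simp add: freshmans_dream_diff left_diff_distrib sum_subtractf power_mult_distrib
          sum_distrib_left mult.assoc)
    then have "(\<Sum>b\<in>B. (\<delta> (c ^ p * x) b - c * \<delta> x b) ^ p * b) = 0" by (simp add: mult.left_commute)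
    then have "\<delta> (c ^ p * x) b - c * \<delta> x b \<in> sat P {0}"
      using indep[of "\<lambda>b. \<delta> (c ^ p * x) b - c * \<delta> x b", OF _ b] by simp
    then have "u * (\<delta> (c ^ p * x) b - c * \<delta> x b) = 0" by (rule kill)
    then show "u * \<delta> (c ^ p * x) b = c * (u * \<delta> x b)" by (simp add: right_diff_distrib mult.left_commute)
  qed
  have "(u * s) ^ p * r = frob_expansion p L r" for r
  proof -
    have "(u * s) ^ p * r = u ^ p * (s ^ p * r)" by (simp add: power_mult_distrib mult.assoc)
    also have "\<dots> = (\<Sum>b\<in>B. (u * \<delta> r b) ^ p * b)"
      unfolding \<delta> by (simp add: sum_distrib_left power_mult_distrib mult.assoc)
    also have "\<dots> = frob_expansion p L r"
      unfolding frob_expansion_def L_def using bs by (simp add: sum_list_distinct_conv_sum_set o_def)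
    finally show ?thesis .
  qed
  moreover have "u * s \<notin> P" using u B prime_ideal_mult[OF P] by blast
  ultimately show ?thesis using dual bs by (intro exI[of _ "u * s"] exI[of _ L]) (auto simp: L_def)
qed

lemma ex_prime_ideal_superset:
  fixes J :: "'r set"
  assumes "ring_mod.subspace J" and S: "1 \<in> S" "\<And>a b. a \<in> S \<Longrightarrow> b \<in> S \<Longrightarrow> a * b \<in> S" and "J \<inter> S = {}"
  shows "\<exists>P. prime_ideal P \<and> J \<subseteq> P \<and> P \<inter> S = {}"
proof -
  define \<A> where "\<A> = {I. ring_mod.subspace I \<and> J \<subseteq> I \<and> I \<inter> S = {}}"
  have "J \<in> \<A>" using assms by (simp add: \<A>_def)
  then have "\<exists>N\<in>\<A>. \<forall>I\<in>\<A>. N \<subseteq> I \<longrightarrow> I = N"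
    by (intro ex_maximal_subspace) (auto simp: \<A>_def)
  then obtain N where "N \<in> \<A>" and max: "\<And>I. I \<in> \<A> \<Longrightarrow> N \<subseteq> I \<Longrightarrow> I = N" by blast
  then have N: "ring_mod.subspace N" "J \<subseteq> N" "N \<inter> S = {}" by (auto simp: \<A>_def)
  have hit: "\<exists>n\<in>N. \<exists>c. n + c * a \<in> S" if "a \<notin> N" for a
  proof (rule ccontr)
    assume none: "\<not> ?thesis"
    have "ring_mod.span (insert a N) \<inter> S = {}" using none by (auto simp: mem_span_insert_iff[OF N(1)])
    moreover have "insert a N \<subseteq> ring_mod.span (insert a N)" by (rule ring_mod.span_superset)
    ultimately have "ring_mod.span (insert a N) = N" "a \<in> ring_mod.span (insert a N)"
      using max[of "ring_mod.span (insert a N)"] N(2) by (auto simp: \<A>_def)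
    then show False using that by simp
  qed
  have "prime_ideal N"
    unfolding prime_ideal_iff
  proof (intro conjI allI impI N(1))
    show "1 \<notin> N" using N(3) S(1) by blast
    fix a b assume ab: "a * b \<in> N"
    show "a \<in> N \<or> b \<in> N"
    proof (rule ccontr)
      assume "\<not> (a \<in> N \<or> b \<in> N)"
      then obtain n c m d where nm: "n \<in> N" "n + c * a \<in> S" "m \<in> N" "m + d * b \<in> S" using hit by meson
      have "(n + c * a) * (m + d * b) = (m + d * b) * n + (c * a) * m + (c * d) * (a * b)"
        by (simp add: algebra_simps)
      also have "\<dots> \<in> N"
        by (intro ring_mod.subspace_add[OF N(1)] ring_mod.subspace_scale[OF N(1) nm(1)]
            ring_mod.subspace_scale[OF N(1) nm(3)] ring_mod.subspace_scale[OF N(1) ab])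
      finally show False using S(2)[OF nm(2,4)] N(3) by blast
    qed
  qed
  then show ?thesis using N by blast
qed

text \<open>A form of Kunz's theorem: \<open>F\<^sub>*R\<close> is projective over \<open>R\<close>.\<close>

lemma frob_expansion_global:
  assumes p: "prime p" "CHAR('r) = p" and fin: "F_finite p TYPE('r)"
    and reg: "\<And>P :: 'r set. prime_ideal P \<Longrightarrow> \<exists>G. regular_params P (sat P {0}) G"
  shows "\<exists>L :: (('r \<Rightarrow> 'r) \<times> 'r) list. (\<forall>(\<phi>, x)\<in>set L. frob_dual p \<phi>) \<and> (\<forall>r. frob_expansion p L r = r)"
proof -
  \<comment> \<open>Multiplication by \<open>t\<close> on \<open>F_*R\<close> is
    \<open>r \<mapsto> t^p r\<close>, and \<open>J\<close> consists of those \<open>t\<close> for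
    which it factors through a finite free module. The local result puts an element of
    \<open>J\<close> outside every prime.\<close>
  define J where "J = {t :: 'r. \<exists>L. (\<forall>(\<phi>, x)\<in>set L. frob_dual p \<phi>) \<and> (\<forall>r. t ^ p * r = frob_expansion p L r)}"
  have J: "ring_mod.subspace J"
  proof (rule ring_mod.subspaceI)
    show "0 \<in> J" unfolding J_def using p prime_gt_0_nat
      by (auto simp: frob_expansion_def power_0_left intro!: exI[of _ "[]"])
    show "t + t' \<in> J" if tt: "t \<in> J" "t' \<in> J" for t t'
    proof -
      obtain L L' where L: "\<forall>(\<phi>, x)\<in>set L. frob_dual p \<phi>" "\<forall>r. t ^ p * r = frob_expansion p L r"
        and L': "\<forall>(\<phi>, x)\<in>set L'. frob_dual p \<phi>" "\<forall>r. t' ^ p * r = frob_expansion p L' r"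
        using tt unfolding J_def by blast
      have "(t + t') ^ p * r = frob_expansion p (L @ L') r" for r
        using L(2) L'(2) p by (simp add: frob_expansion_def freshmans_dream distrib_right)
      moreover have "\<forall>(\<phi>, x)\<in>set (L @ L'). frob_dual p \<phi>" using L(1) L'(1) by auto
      ultimately show ?thesis unfolding J_def by blast
    qed
    show "c * t \<in> J" if t: "t \<in> J" for c t
    proof -
      obtain L where L: "\<forall>(\<phi>, x)\<in>set L. frob_dual p \<phi>" "\<forall>r. t ^ p * r = frob_expansion p L r"
        using t unfolding J_def by blast
      define L' where "L' = map (\<lambda>(\<phi>, x). (\<lambda>r. c * \<phi> r, x)) L"
      have "(c * t) ^ p * r = frob_expansion p L' r" for r
      proof -
        have "(c * t) ^ p * r = c ^ p * frob_expansion p L r"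
          using L(2) by (simp add: power_mult_distrib mult.assoc)
        also have "\<dots> = frob_expansion p L' r"
          by (simp add: frob_expansion_def L'_def sum_list_const_mult[symmetric] o_def split_def
              power_mult_distrib mult.assoc)
        finally show ?thesis .
      qed
      moreover have "\<forall>(\<phi>, x)\<in>set L'. frob_dual p \<phi>"
        using L(1) by (auto simp: L'_def frob_dual_def distrib_left mult.left_commute)
      ultimately show ?thesis unfolding J_def by blast
    qed
  qed
  have "1 \<in> J"
  proof (rule ccontr)
    assume "1 \<notin> J"
    then obtain P where P: "prime_ideal P" "J \<subseteq> P"
      using ex_prime_ideal_superset[OF J, of "{1}"] by auto
    then obtain G where "regular_params P (sat P {0}) G" using reg by blast
    from frob_expansion_local[OF p fin this] show False using P(2) unfolding J_def by blast
  qed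
  then show ?thesis unfolding J_def by auto
qed

text \<open>Expand \<open>r\<close> along the level-one list, then each coefficient along the list
  of level \<open>e\<close>. Taking the \<open>p\<close>-th power of the inner expansion produces
  the members \<open>y ^ p * x\<close> and the functionals
  \<open>\<psi> \<circ> \<phi>\<close>.\<close>

lemma frob_expansion_iterate:
  assumes L: "\<forall>(\<phi>, x)\<in>set L. frob_dual p \<phi>" "\<And>r :: 'r. frob_expansion p L r = r"
    and p: "prime p" "CHAR('r) = p"
  shows "\<exists>L :: (('r \<Rightarrow> 'r) \<times> 'r) list.
    (\<forall>(\<phi>, x)\<in>set L. frob_dual (p ^ e) \<phi>) \<and> (\<forall>r. frob_expansion (p ^ e) L r = r)"
proof (induction e)
  case 0
  show ?case by (intro exI[of _ "[(id, 1)]"]) (simp add: frob_dual_def frob_expansion_def)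
next
  case (Suc e)
  then obtain K where K: "\<forall>(\<phi>, x)\<in>set K. frob_dual (p ^ e) \<phi>" "\<And>r :: 'r. frob_expansion (p ^ e) K r = r"
    by blast
  define M where "M = concat (map (\<lambda>(\<phi>, x). map (\<lambda>(\<psi>, y). (\<psi> \<circ> \<phi>, y ^ p * x)) K) L)"
  have "frob_dual (p ^ Suc e) (\<psi> \<circ> \<phi>)" if "frob_dual p \<phi>" "frob_dual (p ^ e) \<psi>" for \<phi> \<psi> :: "'r \<Rightarrow> 'r"
    unfolding frob_dual_def
  proof (intro conjI allI)
    show "(\<psi> \<circ> \<phi>) (a + b) = (\<psi> \<circ> \<phi>) a + (\<psi> \<circ> \<phi>) b" for a b
      using that by (simp add: frob_dual_def)
    have "r ^ p ^ Suc e * a = (r ^ p ^ e) ^ p * a" for r a :: 'r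
      by (simp add: power_mult[symmetric] mult.commute)
    then show "(\<psi> \<circ> \<phi>) (r ^ p ^ Suc e * a) = r * (\<psi> \<circ> \<phi>) a" for r a
      using that by (simp add: frob_dual_def)
  qed
  moreover have "\<exists>\<phi>' y \<psi> z. (\<phi>', y) \<in> set L \<and> (\<psi>, z) \<in> set K \<and> \<phi> = \<psi> \<circ> \<phi>'"
    if "(\<phi>, x) \<in> set M" for \<phi> x
    using that unfolding M_def by (fastforce simp: o_def)
  ultimately have "\<forall>(\<phi>, x)\<in>set M. frob_dual (p ^ Suc e) \<phi>" using L(1) K(1) by blast
  moreover have "frob_expansion (p ^ Suc e) M r = r" for r
  proof -
    have inner: "(\<Sum>(\<psi>, y)\<leftarrow>K. \<psi> (\<phi> r) ^ p ^ Suc e * (y ^ p * x)) = \<phi> r ^ p * x" for \<phi> x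
    proof -
      have fr: "(sum_list ys) ^ p = (\<Sum>y\<leftarrow>ys. y ^ p)" for ys :: "'r list"
        using p prime_gt_0_nat by (induction ys) (simp_all add: freshmans_dream power_0_left)
      have "\<phi> r ^ p * x = (frob_expansion (p ^ e) K (\<phi> r)) ^ p * x" by (simp add: K(2))
      also have "\<dots> = (\<Sum>(\<psi>, y)\<leftarrow>K. \<psi> (\<phi> r) ^ p ^ Suc e * (y ^ p * x))"
        by (simp add: frob_expansion_def fr sum_list_mult_const[symmetric] o_def split_def
            power_mult_distrib power_mult[symmetric] mult.assoc mult.commute[of "p ^ e" p])
      finally show ?thesis by simp
    qed
    have "frob_expansion (p ^ Suc e) M r = (\<Sum>(\<phi>, x)\<leftarrow>L. \<Sum>(\<psi>, y)\<leftarrow>K. \<psi> (\<phi> r) ^ p ^ Suc e * (y ^ p * x))"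
      unfolding frob_expansion_def M_def
      by (induction L) (auto simp: o_def split_def)
    also have "\<dots> = r" unfolding inner using L(2)[of r] by (simp add: frob_expansion_def)
    finally show ?thesis .
  qed
  ultimately show ?case by blast
qed

end

section \<open>Localizations and algebras essentially of finite type\<close>

lemma frac_class_eq_iff:
  assumes P: "prime_ideal P" and st: "s \<notin> P" "t \<notin> P"
  shows "frac_class (*) (- P) a s = frac_class (*) (- P) b t \<longleftrightarrow> (\<exists>u. u \<notin> P \<and> u * (t * a) = u * (s * b))"
proof
  assume eq: "frac_class (*) (- P) a s = frac_class (*) (- P) b t"
  have "(b, t) \<in> frac_class (*) (- P) b t"
    using st prime_ideal_one[OF P] by (auto simp: frac_class_def)
  then show "\<exists>u. u \<notin> P \<and> u * (t * a) = u * (s * b)"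
    unfolding eq[symmetric] by (auto simp: frac_class_def)
next
  assume "\<exists>u. u \<notin> P \<and> u * (t * a) = u * (s * b)"
  then obtain u where u: "u \<notin> P" "u * (t * a) = u * (s * b)" by blast
  have *: "(c, v) \<in> frac_class (*) (- P) b' t'"
    if mem: "(c, v) \<in> frac_class (*) (- P) a' s'" and nP: "s' \<notin> P" "t' \<notin> P"
      and w: "u * (t' * a') = u * (s' * b')" for c v a' s' b' t'
  proof -
    obtain w where w': "w \<notin> P" "v \<notin> P" "w * (v * a') = w * (s' * c)"
      using mem by (auto simp: frac_class_def)
    have "(s' * w * u) * (v * b') = (w * v) * (u * (s' * b'))" by (simp add: mult_ac)
    also have "\<dots> = (w * v) * (u * (t' * a'))" by (simp add: w)
    also have "\<dots> = (u * t') * (w * (v * a'))" by (simp add: mult_ac)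
    also have "\<dots> = (s' * w * u) * (t' * c)" unfolding w'(3) by (simp add: mult_ac)
    finally have "(s' * w * u) * (v * b') = (s' * w * u) * (t' * c)" .
    moreover have "s' * w * u \<notin> P" using w' nP u prime_ideal_mult[OF P] by blast
    ultimately show ?thesis using w'(2) by (auto simp: frac_class_def)
  qed
  show "frac_class (*) (- P) a s = frac_class (*) (- P) b t"
    using *[OF _ st u(2)] *[OF _ st(2,1) u(2)[symmetric]] by auto
qed

section \<open>The ring record of a localization at a prime\<close>

locale localization_at_prime =
  fixes P :: "'r::comm_ring_1 set"
  assumes prime: "prime_ideal P"
begin

abbreviation fr :: "'r \<Rightarrow> 'r \<Rightarrow> ('r \<times> 'r) set" where
  "fr \<equiv> frac_class (*) (- P)"

abbreviation A :: "('r \<times> 'r) set ring" where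
  "A \<equiv> localization_ring (- P)"

lemmas fr_eq_iff = frac_class_eq_iff[OF prime]

lemma one_notin [simp]: "1 \<notin> P"
  by (rule prime_ideal_one[OF prime])

lemma mult_mem_iff [simp]: "a * b \<in> P \<longleftrightarrow> a \<in> P \<or> b \<in> P"
  by (rule prime_ideal_mult[OF prime])

lemma mem_fr: "s \<notin> P \<Longrightarrow> (a, s) \<in> fr a s"
  using one_notin by (auto simp: frac_class_def)

lemma carrier_A: "carrier A = {fr a s | a s. s \<notin> P}"
  by (simp add: localization_ring_def localize_def)

lemma one_A: "\<one>\<^bsub>A\<^esub> = fr 1 1"
  by (simp add: localization_ring_def)

lemma zero_A: "\<zero>\<^bsub>A\<^esub> = fr 0 1"
  by (simp add: localization_ring_def)

lemma mult_A:
  assumes "s \<notin> P" "t \<notin> P"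
  shows "fr a s \<otimes>\<^bsub>A\<^esub> fr b t = fr (a * b) (s * t)"
proof -
  have "fr (a' * b') (s' * t') = fr (a * b) (s * t)"
    if ab: "(a', s') \<in> fr a s" "(b', t') \<in> fr b t" for a' s' b' t'
  proof -
    obtain u where u: "u \<notin> P" "s' \<notin> P" "u * (s' * a) = u * (s * a')"
      using ab(1) by (auto simp: frac_class_def)
    obtain v where v: "v \<notin> P" "t' \<notin> P" "v * (t' * b) = v * (t * b')"
      using ab(2) by (auto simp: frac_class_def)
    have "(u * v) * ((s * t) * (a' * b')) = (u * (s * a')) * (v * (t * b'))" by (simp add: mult_ac)
    also have "\<dots> = (u * v) * ((s' * t') * (a * b))" unfolding u(3)[symmetric] v(3)[symmetric]
      by (simp add: mult_ac)
    finally show ?thesis using u v assms by (subst fr_eq_iff) (auto intro!: exI[of _ "u * v"])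
  qed
  then have "(\<Union>(a', s')\<in>fr a s. \<Union>(b', t')\<in>fr b t. fr (a' * b') (s' * t')) = fr (a * b) (s * t)"
    using mem_fr[OF assms(1), of a] mem_fr[OF assms(2), of b] by blast
  then show ?thesis by (simp add: localization_ring_def)
qed

lemma add_A:
  assumes "s \<notin> P" "t \<notin> P"
  shows "fr a s \<oplus>\<^bsub>A\<^esub> fr b t = fr (t * a + s * b) (s * t)"
proof -
  have "fr (t' * a' + s' * b') (s' * t') = fr (t * a + s * b) (s * t)"
    if ab: "(a', s') \<in> fr a s" "(b', t') \<in> fr b t" for a' s' b' t'
  proof -
    obtain u where u: "u \<notin> P" "s' \<notin> P" "u * (s' * a) = u * (s * a')"
      using ab(1) by (auto simp: frac_class_def)
    obtain v where v: "v \<notin> P" "t' \<notin> P" "v * (t' * b) = v * (t * b')"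
      using ab(2) by (auto simp: frac_class_def)
    have "(u * v) * ((s * t) * (t' * a' + s' * b'))
        = (v * t * t') * (u * (s * a')) + (u * s * s') * (v * (t * b'))"
      by (simp add: distrib_left mult_ac)
    also have "\<dots> = (u * v) * ((s' * t') * (t * a + s * b))" unfolding u(3)[symmetric] v(3)[symmetric]
      by (simp add: distrib_left mult_ac)
    finally show ?thesis using u v assms by (subst fr_eq_iff) (auto intro!: exI[of _ "u * v"])
  qed
  then have "(\<Union>(a', s')\<in>fr a s. \<Union>(b', t')\<in>fr b t. fr (t' * a' + s' * b') (s' * t'))
      = fr (t * a + s * b) (s * t)"
    using mem_fr[OF assms(1), of a] mem_fr[OF assms(2), of b] by blast
  then show ?thesis by (simp add: localization_ring_def)
qed

definition extension :: "'r set \<Rightarrow> ('r \<times> 'r) set set" where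
  "extension I = {fr a s | a s. a \<in> I \<and> s \<notin> P}"

definition contraction :: "('r \<times> 'r) set set \<Rightarrow> 'r set" where
  "contraction I = {r. fr r 1 \<in> I}"

lemma fr_mem_extension_iff:
  assumes "ring_mod.subspace I" "sat P I = I" "s \<notin> P"
  shows "fr a s \<in> extension I \<longleftrightarrow> a \<in> I"
proof
  assume "fr a s \<in> extension I"
  then obtain b t where b: "fr a s = fr b t" "b \<in> I" "t \<notin> P" unfolding extension_def by blast
  then obtain u where u: "u \<notin> P" "u * (t * a) = u * (s * b)" using fr_eq_iff[OF assms(3) b(3)] by blast
  have "(u * t) * a = (u * s) * b" using u(2) by (simp add: mult.assoc)
  then have "(u * t) * a \<in> I" using b(2) ring_mod.subspace_scale[OF assms(1)] by simp
  then have "a \<in> sat P I" by (rule satI[rotated]) (use u b in simp)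
  then show "a \<in> I" using assms(2) by simp
qed (use assms(3) in \<open>auto simp: extension_def\<close>)

context
  assumes cring: "cring A"
begin

lemma ideal_extension:
  assumes I: "ring_mod.subspace I"
  shows "ideal (extension I) A"
proof -
  interpret cring A by (rule cring)
  have elim: "\<exists>a s. x = fr a s \<and> a \<in> I \<and> s \<notin> P" if "x \<in> extension I" for x
    using that by (auto simp: extension_def)
  have intro: "fr a s \<in> extension I" if "a \<in> I" "s \<notin> P" for a s
    using that by (auto simp: extension_def)
  have car: "extension I \<subseteq> carrier A" by (auto simp: carrier_A extension_def)
  have mult: "y \<otimes>\<^bsub>A\<^esub> x \<in> extension I" if x: "x \<in> extension I" and y: "y \<in> carrier A" for x y
  proof -
    obtain a s where a: "x = fr a s" "a \<in> I" "s \<notin> P" using elim[OF x] by blast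
    obtain b t where b: "y = fr b t" "t \<notin> P" using y by (auto simp: carrier_A)
    have "y \<otimes>\<^bsub>A\<^esub> x = fr (b * a) (t * s)" using a b by (simp add: mult_A)
    then show ?thesis using a b intro ring_mod.subspace_scale[OF I] by simp
  qed
  show ?thesis
  proof (rule idealI)
    show "subgroup (extension I) (add_monoid A)"
    proof (rule add.subgroupI)
      show "extension I \<noteq> {}" using intro[of 0 1] ring_mod.subspace_0[OF I] by auto
      show "\<ominus>\<^bsub>A\<^esub> x \<in> extension I" if x: "x \<in> extension I" for x
      proof -
        obtain a s where a: "x = fr a s" "a \<in> I" "s \<notin> P" using elim[OF x] by blast
        have "fr (- a) s \<oplus>\<^bsub>A\<^esub> x = \<zero>\<^bsub>A\<^esub>"
          using a one_notin by (simp add: add_A zero_A) (subst fr_eq_iff, auto)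
        moreover have "fr (- a) s \<in> extension I" using a intro ring_mod.subspace_neg[OF I] by blast
        ultimately have "\<ominus>\<^bsub>A\<^esub> x = fr (- a) s" using minus_equality x car by blast
        then show ?thesis using \<open>fr (- a) s \<in> extension I\<close> by simp
      qed
      show "x \<oplus>\<^bsub>A\<^esub> y \<in> extension I" if xy: "x \<in> extension I" "y \<in> extension I" for x y
      proof -
        obtain a s where a: "x = fr a s" "a \<in> I" "s \<notin> P" using elim[OF xy(1)] by blast
        obtain b t where b: "y = fr b t" "b \<in> I" "t \<notin> P" using elim[OF xy(2)] by blast
        have "x \<oplus>\<^bsub>A\<^esub> y = fr (t * a + s * b) (s * t)" using a b by (simp add: add_A)
        then show ?thesis
          using a b intro ring_mod.subspace_scale[OF I] ring_mod.subspace_add[OF I] by simp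
      qed
    qed (use car in simp)
    show "x \<otimes>\<^bsub>A\<^esub> y \<in> extension I" if "x \<in> extension I" "y \<in> carrier A" for x y
      using mult[OF that] m_comm car that by auto
  qed (use mult ring_axioms in auto)
qed

lemma fr_mem_ideal_iff:
  assumes "ideal I A" "s \<notin> P"
  shows "fr a s \<in> I \<longleftrightarrow> a \<in> contraction I"
proof -
  interpret ideal I A by fact
  have "fr a s = fr 1 s \<otimes>\<^bsub>A\<^esub> fr a 1" using assms(2) by (simp add: mult_A)
  moreover have "fr a 1 = fr s 1 \<otimes>\<^bsub>A\<^esub> fr a s"
    using assms(2) one_notin by (simp add: mult_A) (subst fr_eq_iff, auto)
  moreover have "fr 1 s \<in> carrier A" "fr s 1 \<in> carrier A"
    using assms(2) one_notin unfolding carrier_A by blast+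
  ultimately show ?thesis unfolding contraction_def using I_l_closed by (metis mem_Collect_eq)
qed

lemma contraction_subset:
  assumes "ideal I A" "I \<noteq> carrier A"
  shows "contraction I \<subseteq> P"
proof
  interpret ideal I A by fact
  fix r assume r: "r \<in> contraction I"
  show "r \<in> P"
  proof (rule ccontr)
    assume "r \<notin> P"
    then have "fr r r \<in> I" using fr_mem_ideal_iff[OF assms(1)] r by blast
    moreover have "fr r r = \<one>\<^bsub>A\<^esub>" using \<open>r \<notin> P\<close> one_notin unfolding one_A by (subst fr_eq_iff) auto
    ultimately show False using one_imp_carrier assms(2) by simp
  qed
qed

lemma prime_ideal_contraction:
  assumes "primeideal I A"
  shows "prime_ideal (contraction I)"
proof -
  interpret primeideal I A by fact
  have I: "ideal I A" by (rule is_ideal)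
  have car: "fr a 1 \<in> carrier A" for a using one_notin unfolding carrier_A by blast
  show ?thesis
    unfolding prime_ideal_iff
  proof (intro conjI allI impI ring_mod.subspaceI)
    show "0 \<in> contraction I"
      using additive_subgroup.zero_closed[OF is_additive_subgroup] by (simp add: contraction_def zero_A)
    show "x + y \<in> contraction I" if "x \<in> contraction I" "y \<in> contraction I" for x y
      using additive_subgroup.a_closed[OF is_additive_subgroup, of "fr x 1" "fr y 1"] that
      by (simp add: contraction_def add_A)
    show "c * x \<in> contraction I" if "x \<in> contraction I" for c x
      using I_l_closed[of "fr x 1" "fr c 1"] that car by (simp add: contraction_def mult_A)
    show "1 \<notin> contraction I" using contraction_subset[OF I] I_notcarr one_notin by blast
    show "a \<in> contraction I \<or> b \<in> contraction I" if "a * b \<in> contraction I" for a b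
      using I_prime[of "fr a 1" "fr b 1"] that car by (simp add: contraction_def mult_A)
  qed
qed

lemma contraction_strict_mono:
  assumes "ideal I A" "ideal J A" "I \<subset> J"
  shows "contraction I \<subset> contraction J"
proof -
  obtain x where x: "x \<in> J" "x \<notin> I" using assms(3) by blast
  have "J \<subseteq> carrier A" using assms(2) additive_subgroup.a_subset ideal.axioms(1) by blast
  then obtain a s where a: "x = fr a s" "s \<notin> P" using x(1) by (auto simp: carrier_A)
  then have "a \<in> contraction J" "a \<notin> contraction I" using x fr_mem_ideal_iff assms by blast+
  moreover have "contraction I \<subseteq> contraction J" using assms(3) by (auto simp: contraction_def)
  ultimately show ?thesis by blast
qed

lemma maximalideal_eq_extension:
  assumes "maximalideal M A"
  shows "M = extension P"
proof -
  interpret maximalideal M A by fact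
  have M: "ideal M A" by (rule is_ideal)
  have PP: "ring_mod.subspace P" "sat P P = P"
    using prime prime_ideal_subspace sat_prime by blast+
  have "M \<subseteq> extension P"
  proof
    fix x assume x: "x \<in> M"
    then have "x \<in> carrier A" by simp
    then obtain a s where a: "x = fr a s" "s \<notin> P" by (auto simp: carrier_A)
    then have "a \<in> contraction M" using x fr_mem_ideal_iff M by blast
    then show "x \<in> extension P"
      using contraction_subset[OF M] I_notcarr a by (auto simp: extension_def)
  qed
  moreover have "extension P \<noteq> carrier A"
  proof
    assume "extension P = carrier A"
    then have "fr 1 1 \<in> extension P" using one_notin unfolding carrier_A by blast
    then show False using fr_mem_extension_iff[OF PP one_notin] one_notin by blast
  qed
  moreover have "extension P \<subseteq> carrier A" by (auto simp: carrier_A extension_def)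
  ultimately show ?thesis using I_maximal[OF ideal_extension[OF PP(1)]] by blast
qed

end

end

text \<open>Numerators of the generators of the maximal ideal, and contractions of a longest chain
  of primes, transfer the record-based notion of regularity to saturated ideals of
  \<open>R\<close>.\<close>

lemma (in noetherian_comm_ring) regular_local_ring_params:
  fixes P :: "'r set"
  assumes P: "prime_ideal P" and reg: "regular_local_ring (localization_ring (- P))"
  shows "\<exists>G. regular_params P (sat P {0}) G"
proof -
  interpret localization_at_prime P by (rule localization_at_prime.intro) (rule P)
  have cr: "cring A" using reg by (simp add: regular_local_ring_def)
  interpret A: cring A by (rule cr)
  obtain H where H: "H \<subseteq> carrier A" "finite H" "enat (card H) = krull_dim A" "maximalideal (genideal A H) A"
    using reg unfolding regular_local_ring_def by blast
  define d where "d = card H"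
  define M where "M = genideal A H"
  have maxM: "maximalideal M A" using H(4) by (simp add: M_def)
  then have M: "M = extension P" "ideal M A" using maximalideal_eq_extension[OF cr] maximalideal.axioms(1) by auto
  define N where "N = {n. \<exists>Q. (\<forall>i\<le>n. primeideal (Q i) A) \<and> (\<forall>i<n. Q i \<subset> Q (Suc i))}"
  have "0 \<in> N" unfolding N_def
    using A.maximalideal_prime[OF maxM] by (auto intro!: exI[of _ "\<lambda>_. M"])
  have sup: "Sup (enat ` N) = enat d" using H(3) by (simp add: krull_dim_def N_def d_def)
  \<comment> \<open>A finite supremum of a nonempty set of naturals is attained, so a chain of
    length exactly \<open>d\<close> exists.\<close>
  have "d \<in> N"
  proof -
    have fin: "finite (enat ` N)" and ne: "enat ` N \<noteq> {}"
      using sup \<open>0 \<in> N\<close> by (auto simp: Sup_enat_def split: if_splits)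
    then have "enat d = Max (enat ` N)" using sup by (simp add: Sup_enat_def)
    then have "enat d \<in> enat ` N" using Max_in[OF fin ne] by simp
    then show ?thesis by auto
  qed
  then obtain Q where Q: "\<And>i. i \<le> d \<Longrightarrow> primeideal (Q i) A" "\<And>i. i < d \<Longrightarrow> Q i \<subset> Q (Suc i)"
    by (auto simp: N_def)
  \<comment> \<open>The top prime is replaced by \<open>P\<close>, which contains every contraction,
    so that the chain visibly ends at \<open>P\<close>.\<close>
  define C where "C i = (if i = d then P else contraction (Q i))" for i
  have Cprime: "prime_ideal (C i)" if "i \<le> d" for i
    using P prime_ideal_contraction[OF cr Q(1)[OF that]] by (simp add: C_def)
  have QP: "contraction (Q i) \<subseteq> P" if "i \<le> d" for i
    using contraction_subset[OF cr primeideal.axioms(1)[OF Q(1)[OF that]]]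
      primeideal.I_notcarr[OF Q(1)[OF that]] by simp
  have "C i \<subset> C (Suc i)" if "i < d" for i
  proof -
    have "contraction (Q i) \<subset> contraction (Q (Suc i))"
      using that Q by (intro contraction_strict_mono[OF cr]) (auto intro: primeideal.axioms(1))
    then show ?thesis using that QP[of "Suc i"] by (auto simp: C_def)
  qed
  then have chain: "prime_chain d (C 0) P"
    using prime_chain_of_sequence[of d C] Cprime by (simp add: C_def)
  have zero_sub: "sat P {0} \<subseteq> C 0"
  proof -
    have "prime_ideal (C 0)" "C 0 \<subseteq> P" using prime_chain_prime[OF chain] by auto
    then show ?thesis using P ring_mod.subspace_0[OF prime_ideal_subspace[of "C 0"]] sat_prime[of "C 0" P]
      by (intro sat_minimal) simp_all
  qed
  have "\<forall>h\<in>H. \<exists>a s. h = fr a s \<and> s \<notin> P" using H(1) by (auto simp: carrier_A)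
  then obtain num den where nd: "\<And>h. h \<in> H \<Longrightarrow> h = fr (num h) (den h)" "\<And>h. h \<in> H \<Longrightarrow> den h \<notin> P"
    by metis
  define G where "G = num ` H"
  have G: "finite G" "card G \<le> d" using H(2) card_image_le by (auto simp: G_def d_def)
  have PP: "ring_mod.subspace P" "sat P P = P" using P prime_ideal_subspace sat_prime by blast+
  have HM: "H \<subseteq> M" unfolding M_def by (rule A.genideal_self[OF H(1)])
  have GP: "G \<subseteq> P"
    using HM nd fr_mem_extension_iff[OF PP] by (force simp: G_def M(1))
  have satG: "ring_mod.subspace (sat P (ring_mod.span G))" "sat P (sat P (ring_mod.span G)) = sat P (ring_mod.span G)"
    by (simp_all add: subspace_sat sat_sat P)
  have "H \<subseteq> extension (sat P (ring_mod.span G))"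
  proof
    fix h assume h: "h \<in> H"
    have "num h \<in> sat P (ring_mod.span G)"
      using h ring_mod.span_base[of "num h" G] sat_subset[OF P] by (auto simp: G_def)
    then show "h \<in> extension (sat P (ring_mod.span G))"
      using fr_mem_extension_iff[OF satG nd(2)[OF h]] nd(1)[OF h] by metis
  qed
  then have "M \<subseteq> extension (sat P (ring_mod.span G))"
    unfolding M_def by (intro A.genideal_minimal ideal_extension[OF cr] satG(1))
  then have gen: "P \<subseteq> sat P (ring_mod.span G)"
    using fr_mem_extension_iff[OF satG one_notin] fr_mem_extension_iff[OF PP one_notin] M(1) by blast
  have zP: "sat P {0} \<subseteq> P"
    using ring_mod.subspace_0[OF PP(1)] by (intro sat_minimal PP(2)) auto
  have span: "sat P (ring_mod.span (sat P {0} \<union> G)) = P"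
  proof
    show "sat P (ring_mod.span (sat P {0} \<union> G)) \<subseteq> P"
      using zP GP PP by (intro sat_minimal ring_mod.span_minimal) auto
    have "sat P (ring_mod.span G) \<subseteq> sat P (ring_mod.span (sat P {0} \<union> G))"
      by (intro sat_mono ring_mod.span_mono) auto
    then show "P \<subseteq> sat P (ring_mod.span (sat P {0} \<union> G))" using gen by blast
  qed
  have z: "ring_mod.subspace (sat P {0})" "sat P (sat P {0}) = sat P {0}"
    by (simp_all add: subspace_sat sat_sat P)
  \<comment> \<open>Distinct generators may share a numerator, so only \<open>card G \<le> d\<close>
    is known so far; the height bound gives the converse.\<close>
  have "d \<le> card G" by (rule prime_chain_bound[OF G(1) P z span zero_sub chain])
  then have "card G = d" using G(2) by simp
  then have "regular_params P (sat P {0}) G"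
    unfolding regular_params_def using P z G(1) span zero_sub chain by blast
  then show ?thesis by blast
qed

text \<open>Finiteness of Frobenius propagates from \<open>k\<close> through each algebra generator
  \<open>x\<close>, since \<open>x^p\<close> acts as the scalar \<open>x\<close> and only the
  \<open>x^i\<close> with \<open>i < p\<close> have to be added. A denominator is absorbed by
  \<open>a/s = (1/s)^p s^(p-1) a\<close>.\<close>

lemma F_finite_ess_finite_type:
  fixes \<phi> :: "'k::field \<Rightarrow> 'r::comm_ring_1"
  assumes p: "prime p" "CHAR('k) = p" "CHAR('r) = p"
    and fin: "F_finite p TYPE('k)" and ft: "ess_finite_type \<phi>"
    and hom: "\<phi> 1 = 1" "\<And>a b. \<phi> (a + b) = \<phi> a + \<phi> b" "\<And>a b. \<phi> (a * b) = \<phi> a * \<phi> b"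
  shows "F_finite p TYPE('r)"
proof -
  interpret K: Modules.module "\<lambda>r x :: 'k. r ^ p * x" by (rule frobenius_module[OF p(1,2)])
  interpret F: Modules.module "\<lambda>r x :: 'r. r ^ p * x" by (rule frobenius_module[OF p(1,3)])
  note F.scale_scale [simp del] K.scale_scale [simp del]
  have hom0: "\<phi> 0 = 0" using hom(2)[of 0 0] by simp
  have hompow: "\<phi> (a ^ n) = \<phi> a ^ n" for a n by (induction n) (simp_all add: hom)
  obtain G where G: "finite G" "\<And>r. \<exists>a \<in> subalgebra_gen \<phi> G. \<exists>s \<in> subalgebra_gen \<phi> G. s dvd 1 \<and> s * r = a"
    using ft unfolding ess_finite_type_def by blast
  obtain B where B: "finite B" "K.span B = UNIV" using fin by (auto simp: F_finite_def fin_gen_module_def)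
  have mult_span: "x * d \<in> F.span W" if "\<And>w. w \<in> V \<Longrightarrow> x * w \<in> F.span W" "d \<in> F.span V" for x d V W
    using that(2)
  proof (induction rule: F.span_induct_alt)
    case base
    then show ?case by (simp add: F.span_zero)
  next
    case (step c w y)
    have "c ^ p * (x * w) + x * y \<in> F.span W"
      using step that(1) by (intro F.span_add F.span_scale)
    then show ?case by (simp add: distrib_left mult.left_commute)
  qed
  \<comment> \<open>Besides containing 1, the span is required to be stable under constants and
    generators; it is then stable under the whole subalgebra, and so contains it.\<close>
  have "\<exists>W. finite W \<and> 1 \<in> F.span W \<and> (\<forall>c. \<forall>d\<in>F.span W. \<phi> c * d \<in> F.span W) \<and>
      (\<forall>x\<in>G. \<forall>d\<in>F.span W. x * d \<in> F.span W)"
    using G(1)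
  proof (induction G rule: finite_induct)
    case empty
    have im: "\<phi> c \<in> F.span (\<phi> ` B)" for c
    proof -
      have "c \<in> K.span B" using B(2) by simp
      then show ?thesis
      proof (induction rule: K.span_induct_alt)
        case base
        then show ?case by (simp add: hom0 F.span_zero)
      next
        case (step c b y)
        have "\<phi> b \<in> F.span (\<phi> ` B)" using step(1) by (intro F.span_base imageI)
        then have "\<phi> c ^ p * \<phi> b + \<phi> y \<in> F.span (\<phi> ` B)"
          using step(2) by (intro F.span_add F.span_scale)
        then show ?case by (simp add: hom hompow)
      qed
    qed
    have "\<phi> c * d \<in> F.span (\<phi> ` B)" if "d \<in> F.span (\<phi> ` B)" for c d
      using that by (rule mult_span[rotated]) (use im hom(3) in \<open>metis imageE\<close>)
    then show ?case using B(1) im[of 1] hom(1) by (intro exI[of _ "\<phi> ` B"]) auto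
  next
    case (insert x G)
    then obtain W where W: "finite W" "1 \<in> F.span W" "\<And>c d. d \<in> F.span W \<Longrightarrow> \<phi> c * d \<in> F.span W"
      "\<And>y d. y \<in> G \<Longrightarrow> d \<in> F.span W \<Longrightarrow> y * d \<in> F.span W" by blast
    define W' where "W' = (\<lambda>(i, w). x ^ i * w) ` ({..<p} \<times> W)"
    have W'I: "x ^ i * w \<in> W'" if "i < p" "w \<in> W" for i w
      using that unfolding W'_def by force
    have pow: "x ^ i * d \<in> F.span W'" if "i < p" "d \<in> F.span W" for i d
      using that(2) by (rule mult_span[rotated]) (use W'I that(1) in \<open>blast intro: F.span_base\<close>)
    have p0: "0 < p" using p(1) prime_gt_0_nat by blast
    have ext: "y * d \<in> F.span W'" if y: "\<And>d. d \<in> F.span W \<Longrightarrow> y * d \<in> F.span W" and d: "d \<in> F.span W'" for y d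
      using d
    proof (rule mult_span[rotated])
      fix w assume "w \<in> W'"
      then obtain i v where v: "w = x ^ i * v" "i < p" "v \<in> W" by (auto simp: W'_def)
      have "x ^ i * (y * v) \<in> F.span W'" using v y F.span_base pow by blast
      then show "y * w \<in> F.span W'" by (simp add: v(1) mult.left_commute)
    qed
    have "x * d \<in> F.span W'" if "d \<in> F.span W'" for d
      using that
    proof (rule mult_span[rotated])
      fix w assume "w \<in> W'"
      then obtain i v where v: "w = x ^ i * v" "i < p" "v \<in> W" by (auto simp: W'_def)
      show "x * w \<in> F.span W'"
      proof (cases "Suc i < p")
        case True
        have "x ^ Suc i * v \<in> F.span W'" using True v F.span_base pow by blast
        then show ?thesis by (simp add: v(1) mult.assoc)
      next
        case False
        then have "p = Suc i" using v(2) by simp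
        moreover have "x ^ 0 * v \<in> F.span W'" using p0 v F.span_base pow by blast
        then have "x ^ p * v \<in> F.span W'" using F.span_scale[of v W' x] by simp
        ultimately show ?thesis by (simp add: v(1) mult.assoc)
      qed
    qed
    moreover have "1 \<in> F.span W'" using pow[OF p0 W(2)] by simp
    moreover have "finite W'" using W(1) by (simp add: W'_def)
    moreover have "\<phi> c * d \<in> F.span W'" if "d \<in> F.span W'" for c d using ext W(3) that by blast
    moreover have "y * d \<in> F.span W'" if "y \<in> G" "d \<in> F.span W'" for y d using ext W(4) that by blast
    ultimately show ?case by (intro exI[of _ W']) auto
  qed
  then obtain W where W: "finite W" "1 \<in> F.span W" "\<And>c d. d \<in> F.span W \<Longrightarrow> \<phi> c * d \<in> F.span W"
    "\<And>x d. x \<in> G \<Longrightarrow> d \<in> F.span W \<Longrightarrow> x * d \<in> F.span W" by blast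
  have alg: "a * d \<in> F.span W" if "a \<in> subalgebra_gen \<phi> G" "d \<in> F.span W" for a d
    using that
  proof (induction arbitrary: d)
    case (add x y)
    then show ?case by (simp add: distrib_right F.span_add)
  next
    case (mult x y)
    then show ?case by (simp add: mult.assoc)
  qed (use W in auto)
  have "r \<in> F.span W" for r
  proof -
    obtain a s where as: "a \<in> subalgebra_gen \<phi> G" "s \<in> subalgebra_gen \<phi> G" "s dvd 1" "s * r = a"
      using G(2) by blast
    obtain v where v: "s * v = 1" using as(3) by (metis dvdE)
    have pw: "s ^ n * d \<in> F.span W" if "d \<in> F.span W" for n d
      using that by (induction n) (simp_all add: mult.assoc alg as(2))
    have "a * 1 \<in> F.span W" using alg as(1) W(2) by blast
    then have "v ^ p * (s ^ (p - 1) * a) \<in> F.span W" using pw by (intro F.span_scale) simp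
    moreover have "v ^ p * (s ^ (p - 1) * a) = r"
    proof -
      have "v ^ p * (s ^ (p - 1) * a) = v ^ p * (s ^ (p - 1) * s) * r" by (simp add: as(4)[symmetric] mult.assoc)
      also have "s ^ (p - 1) * s = s ^ p" using p(1) prime_gt_0_nat power_minus_mult by blast
      also have "v ^ p * s ^ p = 1" using v by (simp add: power_mult_distrib[symmetric] mult.commute)
      finally show ?thesis by simp
    qed
    ultimately show ?thesis by simp
  qed
  then show ?thesis unfolding F_finite_def fin_gen_module_def using W(1) by blast
qed

section \<open>Test modules and jumping numbers\<close>

lemma ceiling_mult_power_Suc:
  assumes "0 \<le> t"
  shows "nat \<lceil>t * real p ^ Suc n\<rceil> \<le> p * nat \<lceil>t * real p ^ n\<rceil>"
proof -
  have "t * real p ^ Suc n = real p * (t * real p ^ n)" by simp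
  also have "\<dots> \<le> real p * of_int \<lceil>t * real p ^ n\<rceil>" by (intro mult_left_mono) simp_all
  also have "\<dots> = of_int (int p * \<lceil>t * real p ^ n\<rceil>)" by simp
  finally have "\<lceil>t * real p ^ Suc n\<rceil> \<le> int p * \<lceil>t * real p ^ n\<rceil>" by (simp only: ceiling_le_iff)
  then have "nat \<lceil>t * real p ^ Suc n\<rceil> \<le> nat (int p * \<lceil>t * real p ^ n\<rceil>)" by (rule nat_mono)
  then show ?thesis by (simp add: nat_mult_distrib)
qed

lemma ceiling_mult_power_add:
  assumes "0 \<le> t"
  shows "nat \<lceil>t * real p ^ (n + h)\<rceil> \<le> p ^ h * nat \<lceil>t * real p ^ n\<rceil>"
proof (induction h)
  case (Suc h)
  have "nat \<lceil>t * real p ^ (n + Suc h)\<rceil> \<le> p * nat \<lceil>t * real p ^ (n + h)\<rceil>"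
    using ceiling_mult_power_Suc[OF assms, of p "n + h"] by simp
  also have "\<dots> \<le> p * (p ^ h * nat \<lceil>t * real p ^ n\<rceil>)" using Suc by (rule mult_left_mono) simp
  finally show ?case by (simp add: mult.assoc)
qed simp

context cartier_module
begin

declare scale_scale [simp del]

notation scale (infixr \<open>*s\<close> 75)

definition kimg :: "'r \<Rightarrow> nat \<Rightarrow> nat \<Rightarrow> 'm set" where
  "kimg f e j = (\<lambda>x. (\<kappa> ^^ e) (f ^ j *s x)) ` UNIV"

lemma kappa_pow_add: "(\<kappa> ^^ e) (x + y) = (\<kappa> ^^ e) x + (\<kappa> ^^ e) y"
  by (induction e) (simp_all add: kappa_add)

lemma kappa_pow_scale: "(\<kappa> ^^ e) (r ^ (p ^ e) *s x) = r *s (\<kappa> ^^ e) x"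
proof (induction e arbitrary: r)
  case (Suc e)
  have "r ^ (p ^ Suc e) = (r ^ p) ^ (p ^ e)" by (simp add: power_mult)
  then show ?case using Suc[of "r ^ p"] by (simp add: kappa_scale)
qed simp

lemma kappa_pow_zero: "(\<kappa> ^^ e) 0 = 0"
  using kappa_pow_add[of e 0 0] by simp

lemma subspace_kimg: "subspace (kimg f e j)"
proof (rule subspaceI)
  have "(\<kappa> ^^ e) (f ^ j *s 0) = 0" by (simp add: kappa_pow_zero)
  then show "0 \<in> kimg f e j" unfolding kimg_def by (metis rangeI)
  show "x + y \<in> kimg f e j" if "x \<in> kimg f e j" "y \<in> kimg f e j" for x y
  proof -
    obtain u v where uv: "x = (\<kappa> ^^ e) (f ^ j *s u)" "y = (\<kappa> ^^ e) (f ^ j *s v)"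
      using \<open>x \<in> _\<close> \<open>y \<in> _\<close> by (auto simp: kimg_def)
    have "x + y = (\<kappa> ^^ e) (f ^ j *s (u + v))" by (simp add: uv kappa_pow_add scale_right_distrib)
    then show ?thesis unfolding kimg_def by blast
  qed
  show "c *s x \<in> kimg f e j" if x: "x \<in> kimg f e j" for c x
  proof -
    obtain u where u: "x = (\<kappa> ^^ e) (f ^ j *s u)" using x by (auto simp: kimg_def)
    have "c *s x = (\<kappa> ^^ e) (f ^ j *s (c ^ (p ^ e) *s u))"
      by (simp add: u kappa_pow_scale[symmetric] scale_left_commute)
    then show ?thesis unfolding kimg_def by blast
  qed
qed

lemma kimg_antimono:
  assumes "i \<le> j" shows "kimg f e j \<subseteq> kimg f e i"
proof
  fix x assume "x \<in> kimg f e j"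
  then obtain u where "x = (\<kappa> ^^ e) (f ^ j *s u)" by (auto simp: kimg_def)
  then have "x = (\<kappa> ^^ e) (f ^ i *s (f ^ (j - i) *s u))"
    using assms by (simp add: scale_scale power_add[symmetric])
  then show "x \<in> kimg f e i" unfolding kimg_def by blast
qed

text \<open>Moving \<open>f^a\<close> inside \<open>\<kappa>^e\<close> raises it to the
  \<open>p^e\<close>-th power; this identity drives the comparisons between levels.\<close>

lemma kappa_pow_kimg: "(\<kappa> ^^ n) (f ^ a *s (\<kappa> ^^ e) (f ^ b *s x)) = (\<kappa> ^^ (n + e)) (f ^ (a * p ^ e + b) *s x)"
proof -
  have "f ^ a *s (\<kappa> ^^ e) (f ^ b *s x) = (\<kappa> ^^ e) ((f ^ a) ^ (p ^ e) *s (f ^ b *s x))"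
    by (simp add: kappa_pow_scale)
  also have "\<dots> = (\<kappa> ^^ e) (f ^ (a * p ^ e + b) *s x)"
    by (simp add: scale_scale power_add power_mult)
  finally show ?thesis by (simp add: funpow_add)
qed

end

locale F_regular_module = cartier_module scale p \<kappa>
  for scale :: "'r::comm_ring_1 \<Rightarrow> 'm::ab_group_add \<Rightarrow> 'm" (infixr \<open>*s\<close> 75) and p \<kappa> +
  fixes f :: 'r
  assumes prime_p: "prime p"
    and noetherian: "noetherian_module ((*) :: 'r \<Rightarrow> 'r \<Rightarrow> 'r)"
    and fin_gen: "fin_gen_module scale"
    and F_regular: "F_regular scale \<kappa>"
    and nonzerodivisor: "f *s m = 0 \<Longrightarrow> m = 0"
begin

lemma surj_kappa: "surj \<kappa>"
  using F_regular by (simp add: F_regular_def F_pure_def)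

lemma surj_kappa_pow: "surj (\<kappa> ^^ e)"
proof (induction e)
  case (Suc e)
  then show ?case using comp_surj[OF Suc surj_kappa] by simp
qed simp

text \<open>Surjectivity lets \<open>M\<close> be replaced by \<open>\<kappa>^h M\<close>, and
  \<open>f^j\<close> then enters \<open>\<kappa>^h\<close> as \<open>f^(j p^h)\<close>.\<close>

lemma kimg_shift: "kimg f e j = kimg f (e + h) (j * p ^ h)"
proof -
  have "(\<lambda>x. (\<kappa> ^^ e) (f ^ j *s (\<kappa> ^^ h) x)) ` UNIV = (\<lambda>x. (\<kappa> ^^ e) (f ^ j *s x)) ` range (\<kappa> ^^ h)"
    by (simp add: image_image)
  then have "kimg f e j = (\<lambda>x. (\<kappa> ^^ e) (f ^ j *s (\<kappa> ^^ h) (f ^ 0 *s x))) ` UNIV"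
    unfolding kimg_def using surj_kappa_pow[of h] by simp
  then show ?thesis unfolding kappa_pow_kimg kimg_def by simp
qed

lemma nonzerodivisor_power: "f ^ n *s m = 0 \<Longrightarrow> m = 0"
proof (induction n arbitrary: m)
  case (Suc n)
  then have "f ^ n *s (f *s m) = 0" by (simp add: scale_scale mult.commute)
  then show ?case using Suc.IH nonzerodivisor by blast
qed simp

lemma support_not_annihilated:
  assumes P: "prime_ideal P" and "P \<in> module_support scale" and s: "s \<notin> P"
  shows "\<exists>m. s *s m \<noteq> 0"
proof (rule ccontr)
  assume "\<not> ?thesis"
  then have kill: "s *s m = 0" for m by blast
  have all: "frac_class scale (- P) m t = UNIV \<times> (- P)" for m t
    unfolding frac_class_def using s kill by (auto intro!: bexI[of _ s])
  have "localize scale (- P) UNIV = {frac_class scale (- P) 0 1}"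
    unfolding localize_def all using prime_ideal_one[OF P] by auto
  then show False using assms(2) by (simp add: module_support_def)
qed

text \<open>If \<open>M\<close> vanished at \<open>Q\<close>, each of finitely many generators would
  be killed by an element outside \<open>Q\<close>, and the product of these elements would
  annihilate \<open>M\<close>.\<close>

lemma mem_module_support:
  assumes Q: "prime_ideal Q" and ann: "\<And>r. (\<And>m. r *s m = 0) \<Longrightarrow> r \<in> Q"
  shows "Q \<in> module_support scale"
proof (rule ccontr)
  assume "Q \<notin> module_support scale"
  then have eq: "localize scale (- Q) UNIV = {frac_class scale (- Q) 0 1}" using Q by (simp add: module_support_def)
  have one: "1 \<notin> Q" using prime_ideal_one[OF Q] .
  have kill: "\<exists>u. u \<notin> Q \<and> u *s m = 0" for m
  proof -
    have "frac_class scale (- Q) m 1 \<in> localize scale (- Q) UNIV"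
      unfolding localize_def using one by blast
    then have "frac_class scale (- Q) m 1 = frac_class scale (- Q) 0 1" using eq by simp
    moreover have "(m, 1) \<in> frac_class scale (- Q) m 1" using one by (auto simp: frac_class_def)
    ultimately show ?thesis by (auto simp: frac_class_def)
  qed
  obtain B where B: "finite B" "span B = UNIV" using fin_gen by (auto simp: fin_gen_module_def)
  have "\<exists>u. u \<notin> Q \<and> (\<forall>b\<in>B. u *s b = 0)"
    using B(1)
  proof (induction B rule: finite_induct)
    case empty
    then show ?case using one by blast
  next
    case (insert b B)
    then obtain u where u: "u \<notin> Q" "\<forall>b\<in>B. u *s b = 0" by blast
    obtain v where v: "v \<notin> Q" "v *s b = 0" using kill by blast
    have "(u * v) *s b = 0" using v(2) by (simp add: scale_scale[symmetric])
    moreover have "(u * v) *s c = 0" if "c \<in> B" for c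
      using u(2) that by (simp add: mult.commute[of u] scale_scale[symmetric])
    moreover have "u * v \<notin> Q" using u v prime_ideal_mult[OF Q] by blast
    ultimately show ?case by blast
  qed
  then obtain u where u: "u \<notin> Q" "\<And>b. b \<in> B \<Longrightarrow> u *s b = 0" by blast
  have "u *s m = 0" for m
  proof -
    have "m \<in> span B" using B(2) by simp
    then show ?thesis
      by (induction rule: span_induct_alt)
        (use u(2) in \<open>auto simp: scale_right_distrib scale_left_commute[of u]\<close>)
  qed
  then show False using ann u(1) by blast
qed

text \<open>If \<open>f\<close> lay in \<open>P\<close>, the products \<open>s f^n\<close> with
  \<open>s\<close> outside \<open>P\<close> would still avoid the annihilator of \<open>M\<close>,
  as \<open>f\<close> is a nonzerodivisor. A prime over the annihilator that avoids them lies in the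
  support, inside \<open>P\<close>, and misses \<open>f\<close>, against the minimality of
  \<open>P\<close>.\<close>

lemma notin_generic_point:
  assumes "P \<in> generic_points (module_support scale)"
  shows "f \<notin> P"
proof
  assume fP: "f \<in> P"
  have supp: "P \<in> module_support scale" and min: "\<And>Q. Q \<in> module_support scale \<Longrightarrow> Q \<subseteq> P \<Longrightarrow> Q = P"
    using assms by (auto simp: generic_points_def)
  then have P: "prime_ideal P" by (simp add: module_support_def)
  have R: "noetherian_comm_ring TYPE('r)"
    by (rule noetherian_comm_ring.intro) (rule noetherian)
  define S where "S = {s * f ^ n | s n. s \<notin> P}"
  define Ann where "Ann = {r. \<forall>m. r *s m = 0}"
  have "ring_mod.subspace Ann" unfolding Ann_def
    by (intro ring_mod.subspaceI) (auto simp: scale_left_distrib scale_scale[symmetric])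
  moreover have "1 \<in> S"
  proof -
    have "1 * f ^ 0 \<in> S" unfolding S_def using prime_ideal_one[OF P] by blast
    then show ?thesis by simp
  qed
  moreover have "a * b \<in> S" if ab: "a \<in> S" "b \<in> S" for a b
  proof -
    obtain s n t m where st: "a = s * f ^ n" "b = t * f ^ m" "s \<notin> P" "t \<notin> P"
      using ab by (auto simp: S_def)
    have "a * b = (s * t) * f ^ (n + m)" by (simp add: st power_add mult_ac)
    moreover have "s * t \<notin> P" using st prime_ideal_mult[OF P] by blast
    ultimately show ?thesis unfolding S_def by blast
  qed
  moreover have "Ann \<inter> S = {}"
  proof (rule ccontr)
    assume "Ann \<inter> S \<noteq> {}"
    then obtain s n where s: "s \<notin> P" "\<And>m. (s * f ^ n) *s m = 0" by (auto simp: S_def Ann_def)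
    have "s *s m = 0" for m
    proof -
      have "f ^ n *s (s *s m) = 0" using s(2)[of m] by (simp add: scale_scale mult.commute)
      then show ?thesis by (rule nonzerodivisor_power)
    qed
    then show False using support_not_annihilated[OF P supp s(1)] by blast
  qed
  ultimately obtain Q where Q: "prime_ideal Q" "Ann \<subseteq> Q" "Q \<inter> S = {}"
    using noetherian_comm_ring.ex_prime_ideal_superset[OF R, of Ann S] by blast
  have "Q \<in> module_support scale" using Q(1,2) by (intro mem_module_support) (auto simp: Ann_def)
  moreover have "s \<in> P" if "s \<in> Q" for s
  proof (rule ccontr)
    assume "s \<notin> P"
    then have "s * f ^ 0 \<in> S" unfolding S_def by blast
    then show False using that Q(3) by auto
  qed
  ultimately have "Q = P" using min by blast
  moreover have "1 * f ^ 1 \<in> S" unfolding S_def using prime_ideal_one[OF P] by blast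
  ultimately show False using fP Q(3) by auto
qed

lemma kimg_mono_level: "kimg f h c \<subseteq> kimg f (Suc h) c"
proof -
  have "kimg f h c = kimg f (Suc h) (c * p)" using kimg_shift[of h c 1] by simp
  also have "\<dots> \<subseteq> kimg f (Suc h) c" using prime_ge_1_nat[OF prime_p] by (intro kimg_antimono) simp
  finally show ?thesis .
qed

text \<open>\<open>F\<close>-regularity applies because \<open>f\<close> is invertible at the generic points of \<open>M\<close>.\<close>

lemma eventually_kimg_eq_UNIV: "\<exists>h0. \<forall>h\<ge>h0. kimg f h c = UNIV"
proof -
  interpret noetherian_module scale
    using noetherian_module_fin_gen[OF noetherian fin_gen] .
  define N where "N = (\<Union>h. kimg f h c)"
  obtain h0 where h0: "N = kimg f h0 c"
    unfolding N_def using ascending_stabilizes[of "\<lambda>h. kimg f h c"] kimg_mono_level subspace_kimg by blast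
  have "cartier_submodule scale \<kappa> N"
    unfolding cartier_submodule_def
  proof
    show "subspace N" unfolding h0 by (rule subspace_kimg)
    show "\<kappa> ` N \<subseteq> N"
    proof
      fix y assume "y \<in> \<kappa> ` N"
      then obtain x where "y = \<kappa> ((\<kappa> ^^ h0) (f ^ c *s x))" unfolding h0 kimg_def by blast
      then have "y = (\<kappa> ^^ Suc h0) (f ^ c *s x)" by simp
      then have "y \<in> kimg f (Suc h0) c" unfolding kimg_def by blast
      then show "y \<in> N" unfolding N_def by blast
    qed
  qed
  moreover have "localize scale (- P) N = localize scale (- P) UNIV"
    if gp: "P \<in> generic_points (module_support scale)" for P
  proof
    have P: "prime_ideal P" using gp by (auto simp: generic_points_def module_support_def)
    define g where "g = f ^ c"
    have g: "g \<notin> P" unfolding g_def using notin_generic_point[OF gp] prime_ideal_power_notin[OF P] by blast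
    show "localize scale (- P) UNIV \<subseteq> localize scale (- P) N"
    proof
      fix U assume "U \<in> localize scale (- P) UNIV"
      then obtain m s where U: "U = frac_class scale (- P) m s" "s \<notin> P" by (auto simp: localize_def)
      \<comment> \<open>The stage \<open>h = 0\<close> of the union is \<open>f^c M\<close>, which
        becomes all of \<open>M\<close> once \<open>f\<close> is inverted.\<close>
      have "g *s m = (\<kappa> ^^ 0) (f ^ c *s m)" by (simp add: g_def)
      then have "g *s m \<in> N" unfolding N_def kimg_def by blast
      moreover have "g * s \<notin> P" using g U(2) prime_ideal_mult[OF P] by blast
      moreover have "U = frac_class scale (- P) (g *s m) (g * s)"
        unfolding U(1) frac_class_def
      proof (intro Collect_cong, clarify)
        fix m' s'
        have "(\<exists>u\<in>- P. u *s s' *s m = u *s s *s m') \<longleftrightarrow> (\<exists>u\<in>- P. u *s s' *s g *s m = u *s (g * s) *s m')"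
          (is "?L \<longleftrightarrow> ?R")
        proof
          assume ?L
          then obtain u where "u \<in> - P" "u *s s' *s m = u *s s *s m'" by blast
          then have "g *s u *s s' *s m = g *s u *s s *s m'" by simp
          then show ?R using \<open>u \<in> - P\<close> by (intro bexI[of _ u]) (simp_all add: scale_scale mult_ac)
        next
          assume ?R
          then obtain u where u: "u \<in> - P" "u *s s' *s g *s m = u *s (g * s) *s m'" by blast
          have "(u * g) *s s' *s m = (u * g) *s s *s m'" using u(2) by (simp add: scale_scale mult_ac)
          moreover have "u * g \<in> - P" using u(1) g prime_ideal_mult[OF P] by blast
          ultimately show ?L by blast
        qed
        then show "(s' \<in> - P \<and> ?L) = (s' \<in> - P \<and> ?R)" by blast
      qed
      ultimately show "U \<in> localize scale (- P) N" unfolding localize_def by blast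
    qed
  qed (auto simp: localize_def)
  ultimately have "N = UNIV" using F_regular unfolding F_regular_def by blast
  moreover have "kimg f h0 c \<subseteq> kimg f h c" if "h \<ge> h0" for h
    using lift_Suc_mono_le[of "\<lambda>h. kimg f h c", OF kimg_mono_level that] .
  ultimately show ?thesis using h0 by blast
qed

definition tau :: "real \<Rightarrow> 'm set" where
  "tau t = (\<Union>e. kimg f e (nat \<lceil>t * real p ^ e\<rceil>))"

lemma kimg_ceiling_mono:
  assumes "0 \<le> t" "e \<le> n"
  shows "kimg f e (nat \<lceil>t * real p ^ e\<rceil>) \<subseteq> kimg f n (nat \<lceil>t * real p ^ n\<rceil>)"
proof -
  obtain h where h: "n = e + h" using assms(2) le_Suc_ex by blast
  have "kimg f e (nat \<lceil>t * real p ^ e\<rceil>) = kimg f n (nat \<lceil>t * real p ^ e\<rceil> * p ^ h)"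
    unfolding h by (rule kimg_shift)
  also have "\<dots> \<subseteq> kimg f n (nat \<lceil>t * real p ^ n\<rceil>)"
    using ceiling_mult_power_add[OF assms(1), of p e h] by (intro kimg_antimono) (simp add: h mult.commute)
  finally show ?thesis .
qed

lemma tau_eq_kimg:
  assumes "0 \<le> t"
  shows "\<exists>e. tau t = kimg f e (nat \<lceil>t * real p ^ e\<rceil>)"
proof -
  interpret noetherian_module scale
    using noetherian_module_fin_gen[OF noetherian fin_gen] .
  have inc: "kimg f e (nat \<lceil>t * real p ^ e\<rceil>) \<subseteq> kimg f (Suc e) (nat \<lceil>t * real p ^ Suc e\<rceil>)" for e
    by (rule kimg_ceiling_mono[OF assms]) simp
  show ?thesis unfolding tau_def
    by (rule ascending_stabilizes[where N = "\<lambda>e. kimg f e (nat \<lceil>t * real p ^ e\<rceil>)", OF inc subspace_kimg])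
qed

lemma subspace_tau:
  assumes "0 \<le> t" shows "subspace (tau t)"
proof -
  obtain e where "tau t = kimg f e (nat \<lceil>t * real p ^ e\<rceil>)" using tau_eq_kimg[OF assms] by blast
  then show ?thesis using subspace_kimg by simp
qed

text \<open>At a stage \<open>e\<close> where the union is attained, \<open>M\<close> is replaced by
  \<open>\<kappa>^h(f^c M)\<close>: any fixed number \<open>c\<close> of extra factors
  \<open>f\<close> is absorbed at a deeper level. The bound \<open>n \<ge> 1\<close> matches the
  sums in \<open>cartier_plus\<close>, which start at 1.\<close>

lemma tau_subset_kimg_plus:
  assumes t: "0 \<le> t"
  shows "\<exists>n\<ge>1. tau t \<subseteq> kimg f n (nat \<lceil>t * real p ^ n\<rceil> + c)"
proof -
  obtain e where e: "tau t = kimg f e (nat \<lceil>t * real p ^ e\<rceil>)" using tau_eq_kimg[OF t] by blast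
  obtain h0 where h0: "\<And>h. h \<ge> h0 \<Longrightarrow> kimg f h c = UNIV" using eventually_kimg_eq_UNIV by blast
  define h where "h = Suc h0"
  define a where "a = nat \<lceil>t * real p ^ e\<rceil>"
  have "tau t \<subseteq> kimg f (e + h) (a * p ^ h + c)"
  proof
    fix y assume "y \<in> tau t"
    then obtain x where x: "y = (\<kappa> ^^ e) (f ^ a *s x)" unfolding e kimg_def a_def by blast
    have "x \<in> kimg f h c" using h0[of h] by (simp add: h_def)
    then obtain z where "x = (\<kappa> ^^ h) (f ^ c *s z)" unfolding kimg_def by blast
    then have "y = (\<kappa> ^^ (e + h)) (f ^ (a * p ^ h + c) *s z)" using x kappa_pow_kimg by simp
    then show "y \<in> kimg f (e + h) (a * p ^ h + c)" unfolding kimg_def by blast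
  qed
  also have "\<dots> \<subseteq> kimg f (e + h) (nat \<lceil>t * real p ^ (e + h)\<rceil> + c)"
    using ceiling_mult_power_add[OF t, of p e h] by (intro kimg_antimono) (simp add: a_def mult.commute)
  finally show ?thesis by (intro exI[of _ "e + h"]) (simp add: h_def)
qed

lemma cartier_plus_mono: "N \<subseteq> L \<Longrightarrow> cartier_plus scale p \<kappa> f t N \<subseteq> cartier_plus scale p \<kappa> f t L"
  unfolding cartier_plus_def by (intro span_mono) blast

lemma cartier_plus_subset_tau:
  assumes "0 \<le> t" shows "cartier_plus scale p \<kappa> f t N \<subseteq> tau t"
  unfolding cartier_plus_def
proof (rule span_minimal[OF _ subspace_tau[OF assms]])
  show "(\<Union>n\<in>{1..}. (\<lambda>x. (\<kappa> ^^ n) (f ^ nat \<lceil>t * real p ^ n\<rceil> *s x)) ` N) \<subseteq> tau t"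
    unfolding tau_def kimg_def by blast
qed

lemma tau_subset_cartier_plus:
  assumes "0 \<le> t" shows "tau t \<subseteq> cartier_plus scale p \<kappa> f t (range (scale (f ^ c)))"
proof -
  obtain n where n: "n \<ge> 1" "tau t \<subseteq> kimg f n (nat \<lceil>t * real p ^ n\<rceil> + c)"
    using tau_subset_kimg_plus[OF assms] by blast
  have "kimg f n (nat \<lceil>t * real p ^ n\<rceil> + c)
      \<subseteq> (\<lambda>x. (\<kappa> ^^ n) (f ^ nat \<lceil>t * real p ^ n\<rceil> *s x)) ` range (scale (f ^ c))"
    unfolding kimg_def by (auto simp: power_add scale_scale[symmetric])
  also have "\<dots> \<subseteq> cartier_plus scale p \<kappa> f t (range (scale (f ^ c)))"
    unfolding cartier_plus_def using n(1) by (intro order_trans[OF _ span_superset]) blast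
  finally show ?thesis using n(2) by blast
qed

text \<open>The summand \<open>n = 1\<close> suffices: write \<open>x = \<kappa> z\<close>, so that
  \<open>f^a x = \<kappa>(f^(a p) z)\<close> with \<open>a p \<ge> a\<close>. By induction every
  iterate of \<open>cartier_plus\<close> then contains some \<open>f^k M\<close>.\<close>

lemma power_scale_subset_cartier_plus: "\<exists>k. range (scale (f ^ k)) \<subseteq> cartier_plus scale p \<kappa> f t (range (scale (f ^ c)))"
proof -
  define a where "a = nat \<lceil>t * real p ^ 1\<rceil> + c"
  have "range (scale (f ^ a)) \<subseteq> cartier_plus scale p \<kappa> f t (range (scale (f ^ c)))"
  proof
    fix y assume "y \<in> range (scale (f ^ a))"
    then obtain x where x: "y = f ^ a *s x" by blast
    obtain z where z: "x = \<kappa> z" using surj_kappa by (metis surjD)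
    have "a \<le> a * p" using prime_ge_1_nat[OF prime_p] by simp
    have "y = (\<kappa> ^^ 1) (f ^ (a * p) *s z)" unfolding x z
      using kappa_pow_kimg[of 0 f a 1 0 z] by simp
    also have "a * p = nat \<lceil>t * real p ^ 1\<rceil> + (c + (a * p - a))"
      using \<open>a \<le> a * p\<close> unfolding a_def by linarith
    also have "f ^ \<dots> *s z = f ^ nat \<lceil>t * real p ^ 1\<rceil> *s (f ^ c *s (f ^ (a * p - a) *s z))"
      by (simp only: power_add scale_scale)
    finally show "y \<in> cartier_plus scale p \<kappa> f t (range (scale (f ^ c)))"
      unfolding cartier_plus_def by (intro span_base) blast
  qed
  then show ?thesis by blast
qed

text \<open>Every iterate contains some \<open>f^k M\<close>, and \<open>cartier_plus\<close> of
  \<open>f^k M\<close> is already \<open>tau t\<close>, the largest possible value. The stable value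
  is thus reached after one step.\<close>

lemma iterated_cartier_plus:
  assumes t: "0 \<le> t"
  shows "(cartier_plus scale p \<kappa> f t ^^ Suc h) UNIV = tau t"
proof -
  have "\<exists>k. range (scale (f ^ k)) \<subseteq> (cartier_plus scale p \<kappa> f t ^^ h) UNIV"
  proof (induction h)
    case (Suc h)
    then obtain k where k: "range (scale (f ^ k)) \<subseteq> (cartier_plus scale p \<kappa> f t ^^ h) UNIV" by blast
    obtain j where "range (scale (f ^ j)) \<subseteq> cartier_plus scale p \<kappa> f t (range (scale (f ^ k)))"
      using power_scale_subset_cartier_plus by blast
    also have "\<dots> \<subseteq> (cartier_plus scale p \<kappa> f t ^^ Suc h) UNIV" using cartier_plus_mono[OF k] by simp
    finally show ?case by blast
  qed simp
  then obtain k where k: "range (scale (f ^ k)) \<subseteq> (cartier_plus scale p \<kappa> f t ^^ h) UNIV" by blast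
  then have "tau t \<subseteq> (cartier_plus scale p \<kappa> f t ^^ Suc h) UNIV"
    using tau_subset_cartier_plus[OF t, of k] cartier_plus_mono[OF k, of t] by simp
  then show ?thesis using cartier_plus_subset_tau[OF t] by auto
qed

lemma stable_image_eq_tau:
  assumes t: "0 \<le> t" shows "stable_image scale p \<kappa> f t = tau t"
  unfolding stable_image_def
proof (rule the_equality)
  show ev: "\<forall>\<^sub>F h in sequentially. (cartier_plus scale p \<kappa> f t ^^ h) UNIV = tau t"
    unfolding eventually_sequentially
    using iterated_cartier_plus[OF t] by (metis Suc_le_D)
  fix N assume "\<forall>\<^sub>F h in sequentially. (cartier_plus scale p \<kappa> f t ^^ h) UNIV = N"
  from eventually_conj[OF this ev] show "N = tau t"
    by (auto simp: eventually_sequentially)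
qed

lemma test_module_eq_tau:
  assumes t: "0 \<le> t" shows "test_module scale p \<kappa> f t = tau t"
proof -
  obtain k where "range (scale (f ^ k)) \<subseteq> tau t"
    using power_scale_subset_cartier_plus[of t 0] cartier_plus_subset_tau[OF t] by blast
  then have "range (scale (f ^ Suc k)) \<subseteq> scale f ` tau t"
    by (auto simp: scale_scale[symmetric] image_iff)
  then have "tau t \<subseteq> cartier_plus scale p \<kappa> f t (scale f ` tau t)"
    using tau_subset_cartier_plus[OF t, of "Suc k"] cartier_plus_mono by blast
  then show ?thesis
    unfolding test_module_def stable_image_eq_tau[OF t] using cartier_plus_subset_tau[OF t] by blast
qed

section \<open>The filtration \<open>tau\<close> and its jumps\<close>

lemma tau_antimono:
  assumes "t \<le> t'" shows "tau t' \<subseteq> tau t"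
proof -
  have "kimg f e (nat \<lceil>t' * real p ^ e\<rceil>) \<subseteq> kimg f e (nat \<lceil>t * real p ^ e\<rceil>)" for e
    using assms by (intro kimg_antimono nat_mono ceiling_mono mult_right_mono) simp_all
  then show ?thesis unfolding tau_def by blast
qed

text \<open>The case \<open>c = 1\<close> of \<open>tau_subset_kimg_plus\<close>: raising
  \<open>t\<close> by at most \<open>1/p^n\<close> raises the exponent at level \<open>n\<close> by
  at most one.\<close>

lemma tau_right_continuous:
  assumes "0 \<le> t" shows "\<exists>\<epsilon>>0. \<forall>t'. t \<le> t' \<longrightarrow> t' \<le> t + \<epsilon> \<longrightarrow> tau t' = tau t"
proof -
  obtain n where n: "tau t \<subseteq> kimg f n (nat \<lceil>t * real p ^ n\<rceil> + 1)"
    using tau_subset_kimg_plus[OF assms] by blast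
  have p0: "real p ^ n > 0" using prime_gt_0_nat[OF prime_p] by simp
  have "tau t' = tau t" if t': "t \<le> t'" "t' \<le> t + 1 / real p ^ n" for t'
  proof
    have "t' * real p ^ n \<le> (t + 1 / real p ^ n) * real p ^ n" using t'(2) p0 by (intro mult_right_mono) simp_all
    also have "\<dots> = t * real p ^ n + 1" using p0 by (simp add: distrib_right)
    finally have "t' * real p ^ n \<le> t * real p ^ n + 1" .
    then have "\<lceil>t' * real p ^ n\<rceil> \<le> \<lceil>t * real p ^ n + 1\<rceil>" by (rule ceiling_mono)
    also have "\<dots> = \<lceil>t * real p ^ n\<rceil> + 1" by simp
    finally have "nat \<lceil>t' * real p ^ n\<rceil> \<le> nat \<lceil>t * real p ^ n\<rceil> + 1" by linarith
    then have "kimg f n (nat \<lceil>t * real p ^ n\<rceil> + 1) \<subseteq> kimg f n (nat \<lceil>t' * real p ^ n\<rceil>)"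
      by (rule kimg_antimono)
    then show "tau t \<subseteq> tau t'" using n unfolding tau_def[of t'] by blast
  qed (rule tau_antimono[OF t'(1)])
  moreover have "1 / real p ^ n > 0" using p0 by simp
  ultimately show ?thesis by blast
qed

text \<open>The ceiling at level \<open>e + h\<close> is exactly \<open>j p^h\<close>, so by
  \<open>kimg_shift\<close> the union is constant from level \<open>e\<close> on.\<close>

lemma tau_fraction: "tau (real j / real p ^ e) = kimg f e j"
proof
  have p0: "real p > 0" using prime_gt_0_nat[OF prime_p] by simp
  have at: "kimg f (e + h) (nat \<lceil>real j / real p ^ e * real p ^ (e + h)\<rceil>) = kimg f e j" for h
  proof -
    have "real j / real p ^ e * real p ^ (e + h) = real (j * p ^ h)" using p0 by (simp add: power_add)
    then have "nat \<lceil>real j / real p ^ e * real p ^ (e + h)\<rceil> = j * p ^ h" by (simp only: ceiling_of_nat nat_int)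
    then show ?thesis using kimg_shift by simp
  qed
  have nn: "0 \<le> real j / real p ^ e" by simp
  show "tau (real j / real p ^ e) \<subseteq> kimg f e j"
    unfolding tau_def using kimg_ceiling_mono[OF nn le_add2] at by blast
  show "kimg f e j \<subseteq> tau (real j / real p ^ e)" unfolding tau_def using at[of 0] by blast
qed

lemma F_jumping_number_iff:
  assumes "0 < x"
  shows "F_jumping_number scale p \<kappa> f x \<longleftrightarrow> (\<forall>y. 0 \<le> y \<longrightarrow> y < x \<longrightarrow> tau x \<noteq> tau y)"
proof
  assume j: "F_jumping_number scale p \<kappa> f x"
  show "\<forall>y. 0 \<le> y \<longrightarrow> y < x \<longrightarrow> tau x \<noteq> tau y"
  proof (intro allI impI)
    fix y :: real assume y: "0 \<le> y" "y < x"
    then have "test_module scale p \<kappa> f x \<noteq> test_module scale p \<kappa> f (x - (x - y))"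
      using j unfolding F_jumping_number_def by (elim conjE allE[of _ "x - y"]) simp
    then show "tau x \<noteq> tau y" using y by (simp add: test_module_eq_tau)
  qed
next
  assume tau: "\<forall>y. 0 \<le> y \<longrightarrow> y < x \<longrightarrow> tau x \<noteq> tau y"
  then show "F_jumping_number scale p \<kappa> f x"
    unfolding F_jumping_number_def using assms by (simp add: test_module_eq_tau)
qed

text \<open>The jump is the infimum of the \<open>t \<ge> a\<close> with
  \<open>tau t = tau b\<close>. Right continuity makes this infimum attained, so it exceeds
  \<open>a\<close>, and by monotonicity no smaller parameter has the same value.\<close>

lemma jump_between:
  assumes "0 \<le> a" "a < b"
  shows "tau a \<noteq> tau b \<longleftrightarrow> (\<exists>x. a < x \<and> x \<le> b \<and> F_jumping_number scale p \<kappa> f x)"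
proof
  assume ne: "tau a \<noteq> tau b"
  define S where "S = {t. a \<le> t \<and> tau t = tau b}"
  define x where "x = Inf S"
  have bS: "b \<in> S" using assms by (simp add: S_def)
  have bdd: "bdd_below S" by (intro bdd_belowI[of _ a]) (simp add: S_def)
  have ax: "a \<le> x" unfolding x_def using bS by (intro cInf_greatest) (auto simp: S_def)
  have xb: "x \<le> b" unfolding x_def using bS bdd by (rule cInf_lower)
  obtain \<epsilon> where \<epsilon>: "\<epsilon> > 0" "\<And>t'. x \<le> t' \<Longrightarrow> t' \<le> x + \<epsilon> \<Longrightarrow> tau t' = tau x"
    using tau_right_continuous[of x] assms ax by auto
  obtain t where t: "t \<in> S" "t < x + \<epsilon>"
    using cInf_lessD[of S "x + \<epsilon>"] bS \<epsilon>(1) unfolding x_def by force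
  have "x \<le> t" unfolding x_def using t(1) bdd by (rule cInf_lower)
  then have Tx: "tau x = tau b" using \<epsilon>(2)[of t] t by (simp add: S_def)
  then have "a < x" using ne ax by (cases "a = x") auto
  moreover have "tau x \<noteq> tau y" if y: "0 \<le> y" "y < x" for y
  proof
    assume eq: "tau x = tau y"
    show False
    proof (cases "a \<le> y")
      case True
      then have "y \<in> S" using eq Tx by (simp add: S_def)
      then have "x \<le> y" unfolding x_def using bdd by (rule cInf_lower)
      then show False using y by simp
    next
      case False
      then have "tau a \<subseteq> tau y" by (intro tau_antimono) simp
      then have "tau a \<subseteq> tau b" using eq Tx by simp
      then show False using ne tau_antimono[of a b] assms by auto
    qed
  qed
  ultimately show "\<exists>x. a < x \<and> x \<le> b \<and> F_jumping_number scale p \<kappa> f x"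
    using xb assms F_jumping_number_iff[of x] by auto
next
  assume "\<exists>x. a < x \<and> x \<le> b \<and> F_jumping_number scale p \<kappa> f x"
  then obtain x where x: "a < x" "x \<le> b" "F_jumping_number scale p \<kappa> f x" by blast
  then have "tau x \<noteq> tau a" using F_jumping_number_iff[of x] assms by auto
  moreover have "tau b \<subseteq> tau x" "tau x \<subseteq> tau a" using x by (simp_all add: tau_antimono)
  ultimately show "tau a \<noteq> tau b" by blast
qed

lemma jumping_numbers_image:
  "{(real_of_int \<lceil>x * real p ^ e\<rceil> - 1) / real p ^ e | x :: real.
       0 < x \<and> x \<le> 1 \<and> F_jumping_number scale p \<kappa> f x}
   = {real j / real p ^ e | j. j < p ^ e \<and> kimg f e j \<noteq> kimg f e (Suc j)}" (is "?L = ?R")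
proof
  define q where "q = p ^ e"
  have q: "real q > 0" "real p ^ e = real q"
    using prime_gt_0_nat[OF prime_p] by (simp_all add: q_def)
  have tau: "tau (real j / real q) = kimg f e j" for j using tau_fraction[of j e] by (simp add: q)
  have iff: "kimg f e j \<noteq> kimg f e (Suc j) \<longleftrightarrow>
      (\<exists>x. real j / real q < x \<and> x \<le> real (Suc j) / real q \<and> F_jumping_number scale p \<kappa> f x)" for j
    unfolding tau[symmetric] using q by (intro jump_between) (simp_all add: divide_strict_right_mono)
  show "?L \<subseteq> ?R"
  proof
    fix y assume "y \<in> ?L"
    then obtain x where x: "y = (real_of_int \<lceil>x * real q\<rceil> - 1) / real q" "0 < x" "x \<le> 1"
      "F_jumping_number scale p \<kappa> f x" unfolding q by blast
    have "0 < x * real q" using x q by simp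
    then have c: "1 \<le> \<lceil>x * real q\<rceil>" by (simp add: one_le_ceiling)
    define j where "j = nat (\<lceil>x * real q\<rceil> - 1)"
    have j: "real j = real_of_int \<lceil>x * real q\<rceil> - 1" using c by (simp add: j_def)
    have "x * real q \<le> real q" using x q by simp
    then have "\<lceil>x * real q\<rceil> \<le> int q" by (simp add: ceiling_le_iff)
    then have "j < q" using c unfolding j_def by linarith
    moreover have "real j < x * real q" "x * real q \<le> real (Suc j)" using j by linarith+
    then have "real j / real q < x" "x \<le> real (Suc j) / real q"
      using q(1) by (simp_all add: pos_divide_less_eq pos_le_divide_eq)
    then have "kimg f e j \<noteq> kimg f e (Suc j)" using iff x(4) by blast
    moreover have "y = real j / real p ^ e" using x(1) j q(2) by simp
    ultimately show "y \<in> ?R" unfolding q_def by blast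
  qed
  show "?R \<subseteq> ?L"
  proof
    fix y assume "y \<in> ?R"
    then obtain j where j: "y = real j / real q" "j < q" "kimg f e j \<noteq> kimg f e (Suc j)"
      unfolding q(2) unfolding q_def by blast
    then obtain x where x: "real j / real q < x" "x \<le> real (Suc j) / real q" "F_jumping_number scale p \<kappa> f x"
      using iff by blast
    have b: "real j < x * real q" "x * real q \<le> real (Suc j)"
      using x q(1) by (simp_all add: pos_divide_less_eq pos_le_divide_eq)
    then have "\<lceil>x * real q\<rceil> = int (Suc j)" by (intro ceiling_unique) simp_all
    then have "y = (real_of_int \<lceil>x * real q\<rceil> - 1) / real q" using j(1) by simp
    moreover have "0 < x" using x(1) q(1) by (meson divide_nonneg_pos le_less_trans of_nat_0_le_iff)
    moreover have "x \<le> 1"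
    proof -
      have "real (Suc j) / real q \<le> 1" using j(2) q(1) by (simp add: Suc_le_eq)
      then show ?thesis using x(2) by linarith
    qed
    ultimately show "y \<in> ?L" using x(3) unfolding q by blast
  qed
qed

end

section \<open>Differential operators and Bernstein-Sato polynomials\<close>

lemma prime_dvd_choose_prime_power:
  fixes p :: nat
  assumes "prime p" "0 < k" "k < p ^ l"
  shows "p dvd (p ^ l choose k)"
proof (rule ccontr)
  assume "\<not> p dvd (p ^ l choose k)"
  then have "coprime (p ^ l) (p ^ l choose k)" using assms(1) by (simp add: prime_imp_coprime)
  moreover have "p ^ l dvd k * (p ^ l choose k)" using times_binomial_minus1_eq[OF assms(2), of "p ^ l"] by simp
  ultimately have "p ^ l dvd k" by (simp add: coprime_dvd_mult_left_iff)
  then show False using assms by (auto dest: dvd_imp_le)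
qed

text \<open>Lucas's congruence for one digit. In Vandermonde's sum with \<open>q = p^l\<close> only
  the terms \<open>k = 0\<close> and \<open>k = q\<close> survive modulo \<open>p\<close>, so adding
  \<open>q\<close> to \<open>n\<close> adds 1 to the value, which is therefore
  \<open>n div q\<close>.\<close>

lemma of_nat_choose_prime_power:
  assumes p: "prime p" "CHAR('r::comm_ring_1) = p"
  shows "(of_nat (n choose p ^ l) :: 'r) = of_nat ((n div p ^ l) mod p)"
proof -
  define q where "q = p ^ l"
  have q: "0 < q" using prime_gt_0_nat[OF p(1)] by (simp add: q_def)
  have van: "(of_nat (q + m choose q) :: 'r) = of_nat (m choose q) + 1" for m
  proof -
    have "(of_nat (q + m choose q) :: 'r) = (\<Sum>k\<le>q. of_nat (q choose k) * of_nat (m choose (q - k)))"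
      by (simp flip: vandermonde)
    also have "\<dots> = (\<Sum>k\<in>{0, q}. of_nat (q choose k) * of_nat (m choose (q - k)))"
    proof (intro sum.mono_neutral_right ballI)
      fix k assume "k \<in> {..q} - {0, q}"
      then have "p dvd (q choose k)"
        using prime_dvd_choose_prime_power[OF p(1), of k l] by (simp add: q_def)
      then have "(of_nat (q choose k) :: 'r) = 0" using p(2) by (simp add: of_nat_eq_0_iff_char_dvd)
      then show "(of_nat (q choose k) :: 'r) * of_nat (m choose (q - k)) = 0" by simp
    qed auto
    also have "\<dots> = of_nat (m choose q) + 1" using q by simp
    finally show ?thesis .
  qed
  have "(of_nat (n choose q) :: 'r) = of_nat (n div q)"
  proof (induction n rule: less_induct)
    case (less n)
    show ?case
    proof (cases "n < q")
      case False
      then have "n = q + (n - q)" by simp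
      moreover have "n div q = Suc ((n - q) div q)" using False q by (simp add: le_div_geq)
      ultimately show ?thesis using van[of "n - q"] less[of "n - q"] q False by simp
    qed (simp add: binomial_eq_0)
  qed
  also have "\<dots> = of_nat (n div q mod p + p * (n div q div p))" by simp
  also have "\<dots> = of_nat (n div q mod p) + of_nat p * of_nat (n div q div p)"
    by (simp only: of_nat_add of_nat_mult)
  also have "(of_nat p :: 'r) = 0" using p(2) of_nat_CHAR[where 'a = 'r] by simp
  finally show ?thesis by (simp add: q_def)
qed

lemma fermat_indicator:
  assumes p: "prime p" "CHAR('r::comm_ring_1) = p" and di: "d < p" "i < p"
  shows "(1 :: 'r) - (of_nat d - of_nat i) ^ (p - 1) = (if d = i then 1 else 0)"
proof (cases "d = i")
  case True
  then show ?thesis using prime_gt_1_nat[OF p(1)] by (simp add: power_0_left)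
next
  case False
  define a where "a = p + d - i"
  have p0: "(of_nat p :: 'r) = 0" using p(2) of_nat_CHAR[where 'a = 'r] by simp
  have a: "(of_nat a :: 'r) = of_nat d - of_nat i" using di by (simp add: a_def of_nat_diff p0)
  have "\<not> p dvd a"
  proof
    assume "p dvd a"
    then obtain k where k: "a = p * k" by blast
    have "0 < a" "a < p * 2" using di by (simp_all add: a_def)
    then have "k = 1" using k by simp
    then show False using k False di by (simp add: a_def)
  qed
  then have "[a ^ (p - 1) = 1] (mod p)" using fermat_theorem p(1) by blast
  then have "a ^ (p - 1) mod p = 1" using prime_gt_1_nat[OF p(1)] by (simp add: cong_def)
  then have "a ^ (p - 1) = p * (a ^ (p - 1) div p) + 1" by (metis mult_div_mod_eq)
  then have "(of_nat (a ^ (p - 1)) :: 'r) = of_nat (p * (a ^ (p - 1) div p) + 1)" by simp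
  also have "\<dots> = 1" by (simp only: of_nat_add of_nat_mult p0) simp
  finally have "(of_nat a :: 'r) ^ (p - 1) = 1" by simp
  then show ?thesis using False a by simp
qed

lemma mod_power_eq_sum_digits:
  fixes p :: nat
  shows "n mod p ^ e = (\<Sum>l<e. (n div p ^ l mod p) * p ^ l)"
proof (induction e)
  case (Suc e)
  have "n mod p ^ Suc e = n mod (p ^ e * p)" by (simp add: mult.commute)
  also have "\<dots> = p ^ e * (n div p ^ e mod p) + n mod p ^ e" by (rule mod_mult2_eq)
  finally show ?case using Suc by (simp add: mult.commute)
qed simp

lemma mod_power_eq_iff_digits:
  fixes p :: nat
  assumes "0 < p" "j < p ^ e"
  shows "n mod p ^ e = j \<longleftrightarrow> (\<forall>l<e. n div p ^ l mod p = j div p ^ l mod p)"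
proof
  assume n: "n mod p ^ e = j"
  show "\<forall>l<e. n div p ^ l mod p = j div p ^ l mod p"
  proof (intro allI impI)
    fix l assume "l < e"
    then obtain h where h: "e = l + Suc h" using less_imp_Suc_add by fastforce
    have "n mod p ^ e = p ^ l * (n div p ^ l mod p ^ Suc h) + n mod p ^ l"
      unfolding h power_add by (rule mod_mult2_eq)
    then have "j div p ^ l = (n mod p ^ l + p ^ l * (n div p ^ l mod p ^ Suc h)) div p ^ l"
      using n by (simp add: add.commute)
    also have "\<dots> = n div p ^ l mod p ^ Suc h" using assms(1) by simp
    finally show "n div p ^ l mod p = j div p ^ l mod p"
      by (simp add: mod_mod_cancel)
  qed
next
  assume "\<forall>l<e. n div p ^ l mod p = j div p ^ l mod p"
  then have "n mod p ^ e = j mod p ^ e" unfolding mod_power_eq_sum_digits by (intro sum.cong) auto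
  then show "n mod p ^ e = j" using assms(2) by simp
qed

section \<open>Diagonal operators and projections onto residue classes of exponents\<close>

definition diag_op :: "(nat \<Rightarrow> 'r::comm_ring_1) \<Rightarrow> 'r poly \<Rightarrow> 'r poly" where
  "diag_op c g = (\<Sum>n\<le>Polynomial.degree g. Polynomial.monom (c n * Polynomial.coeff g n) n)"

lemma coeff_diag_op: "Polynomial.coeff (diag_op c g) n = c n * Polynomial.coeff g n"
proof -
  have "Polynomial.coeff (diag_op c g) n
      = (\<Sum>m\<le>Polynomial.degree g. if m = n then c n * Polynomial.coeff g n else 0)"
    unfolding diag_op_def Polynomial.coeff_sum by (intro sum.cong) auto
  also have "\<dots> = c n * Polynomial.coeff g n" by (auto simp: coeff_eq_0)
  finally show ?thesis .
qed

lemma theta_eq_diag_op: "theta m = diag_op (\<lambda>n. of_nat (n choose m))"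
  by (simp add: fun_eq_iff theta_def diag_op_def)

lemma diag_op_add: "diag_op c (g + h) = diag_op c g + diag_op c h"
  by (intro poly_eqI) (simp add: coeff_diag_op distrib_left)

lemma diag_op_monom: "diag_op c (Polynomial.monom b j) = Polynomial.monom (c j * b) j"
  by (intro poly_eqI) (simp add: coeff_diag_op)

lemma diag_op_comp: "diag_op c \<circ> diag_op d = diag_op (\<lambda>n. c n * d n)"
  by (intro ext poly_eqI) (simp add: coeff_diag_op mult.assoc)

lemma diag_op_one: "diag_op (\<lambda>_. 1) = id"
  by (intro ext poly_eqI) (simp add: coeff_diag_op)

text \<open>A predicate on the multiplier \<open>c\<close> rather than on the operator, so that the
  closure rules below can be chained by unification on functions of \<open>n\<close>.\<close>

definition diag_in_theta_ring :: "nat \<Rightarrow> nat \<Rightarrow> (nat \<Rightarrow> 'r::comm_ring_1) \<Rightarrow> bool" where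
  "diag_in_theta_ring p e c \<longleftrightarrow> diag_op c \<in> theta_ring p e"

lemma diag_in_theta_ring_one: "diag_in_theta_ring p e (\<lambda>_. 1)"
  unfolding diag_in_theta_ring_def diag_op_one by (rule theta_ring.one)

lemma diag_in_theta_ring_mult:
  "diag_in_theta_ring p e c \<Longrightarrow> diag_in_theta_ring p e d \<Longrightarrow> diag_in_theta_ring p e (\<lambda>n. c n * d n)"
  unfolding diag_in_theta_ring_def diag_op_comp[symmetric] by (rule theta_ring.comp)

lemma diag_in_theta_ring_diff:
  assumes "diag_in_theta_ring p e c" "diag_in_theta_ring p e d"
  shows "diag_in_theta_ring p e (\<lambda>n. c n - d n)"
proof -
  have "(\<lambda>g. diag_op c g + - diag_op d g) \<in> theta_ring p e"
    using assms unfolding diag_in_theta_ring_def by (intro theta_ring.add theta_ring.uminus)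
  moreover have "(\<lambda>g. diag_op c g + - diag_op d g) = diag_op (\<lambda>n. c n - d n)"
    by (intro ext poly_eqI) (simp add: coeff_diag_op left_diff_distrib)
  ultimately show ?thesis by (simp add: diag_in_theta_ring_def)
qed

lemma diag_in_theta_ring_of_nat: "diag_in_theta_ring p e (\<lambda>_. of_nat k :: 'r::comm_ring_1)"
proof (induction k)
  case 0
  show ?case using diag_in_theta_ring_diff[OF diag_in_theta_ring_one diag_in_theta_ring_one] by simp
next
  case (Suc k)
  \<comment> \<open>The closure rule at hand is for differences, and \<open>k - (1 - 1 - 1)\<close>
    is \<open>k + 1\<close>.\<close>
  have "diag_in_theta_ring p e (\<lambda>_. of_nat k - (1 - 1 - 1) :: 'r)"
    by (intro diag_in_theta_ring_diff diag_in_theta_ring_one Suc)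
  then show ?case by (simp add: add.commute)
qed

lemma diag_in_theta_ring_power:
  "diag_in_theta_ring p e c \<Longrightarrow> diag_in_theta_ring p e (\<lambda>n. c n ^ k)"
  by (induction k) (simp_all add: diag_in_theta_ring_one diag_in_theta_ring_mult)

lemma diag_in_theta_ring_choose:
  "l < e \<Longrightarrow> diag_in_theta_ring p e (\<lambda>n. of_nat (n choose p ^ l))"
  unfolding diag_in_theta_ring_def theta_eq_diag_op[symmetric] by (rule theta_ring.theta)

text \<open>\<^term>\<open>digit_op p l i\<close> is \<open>1 - (\<theta> - i)\<^sup>p\<^sup>-\<^sup>1\<close> for \<open>\<theta> = theta (p ^ l)\<close>; by Fermat's little theorem
  it projects onto the monomials whose \<open>l\<close>-th digit is \<open>i\<close>.\<close>

definition digit_op :: "nat \<Rightarrow> nat \<Rightarrow> nat \<Rightarrow> 'r::comm_ring_1 poly \<Rightarrow> 'r poly" where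
  "digit_op p l i = diag_op (\<lambda>n. 1 - (of_nat (n choose p ^ l) - of_nat i) ^ (p - 1))"

text \<open>The parameter \<open>k\<close> restricts the condition to the lowest \<open>k\<close>
  digits, so that the projection onto one class modulo \<open>p^e\<close> can be built digit by
  digit.\<close>

definition digits_proj :: "nat \<Rightarrow> nat \<Rightarrow> nat \<Rightarrow> 'r::comm_ring_1 poly \<Rightarrow> 'r poly" where
  "digits_proj p k j = diag_op (\<lambda>n. if \<forall>l<k. n div p ^ l mod p = j div p ^ l mod p then 1 else 0)"

context
  fixes p :: nat and T :: "'r::comm_ring_1 itself"
  assumes p: "prime p" "CHAR('r) = p"
begin

lemma digit_op_eq:
  assumes "i < p"
  shows "(digit_op p l i :: 'r poly \<Rightarrow> _) = diag_op (\<lambda>n. if n div p ^ l mod p = i then 1 else 0)"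
proof -
  have "(1 :: 'r) - (of_nat (n choose p ^ l) - of_nat i) ^ (p - 1) = (if n div p ^ l mod p = i then 1 else 0)" for n
    unfolding of_nat_choose_prime_power[OF p] using assms prime_gt_0_nat[OF p(1)]
    by (intro fermat_indicator[OF p]) simp_all
  then show ?thesis by (simp add: digit_op_def)
qed

lemma digits_proj_0: "(digits_proj p 0 j :: 'r poly \<Rightarrow> _) = id"
  by (simp add: digits_proj_def diag_op_one)

lemma digits_proj_Suc:
  "(digits_proj p (Suc k) j :: 'r poly \<Rightarrow> _) = digit_op p k (j div p ^ k mod p) \<circ> digits_proj p k j"
proof -
  have "j div p ^ k mod p < p" using prime_gt_0_nat[OF p(1)] by simp
  then show ?thesis
    unfolding digits_proj_def digit_op_eq[OF \<open>_ < p\<close>] diag_op_comp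
    by (intro arg_cong[of _ _ diag_op]) (auto simp: fun_eq_iff less_Suc_eq)
qed

lemma digits_proj_in_theta_ring:
  assumes "k \<le> e" shows "(digits_proj p k j :: 'r poly \<Rightarrow> _) \<in> theta_ring p e"
  using assms
proof (induction k)
  case 0
  show ?case unfolding digits_proj_0 by (rule theta_ring.one)
next
  case (Suc k)
  have "(digit_op p k (j div p ^ k mod p) :: 'r poly \<Rightarrow> _) \<in> theta_ring p e"
    unfolding digit_op_def diag_in_theta_ring_def[symmetric] using Suc.prems
    by (intro diag_in_theta_ring_diff diag_in_theta_ring_one diag_in_theta_ring_power
        diag_in_theta_ring_choose diag_in_theta_ring_of_nat) simp
  then show ?case unfolding digits_proj_Suc using Suc by (intro theta_ring.comp) simp_all
qed

lemma digits_proj_eq: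
  assumes "j < p ^ e"
  shows "(digits_proj p e j :: 'r poly \<Rightarrow> _) = diag_op (\<lambda>n. if n mod p ^ e = j then 1 else 0)"
  unfolding digits_proj_def mod_power_eq_iff_digits[OF prime_gt_0_nat[OF p(1)] assms] ..

end

text \<open>All generators preserve each \<open>R t^j\<close>: operators from \<open>R\<close> act
  alike for every \<open>j\<close>, and \<open>theta (p ^ l)\<close> acts by the \<open>l\<close>-th
  digit of \<open>j\<close>, which for \<open>l < e\<close> depends only on \<open>j\<close> modulo
  \<open>p^e\<close>. The periodicity keeps \<open>graded_map\<close> stable under
  precomposition.\<close>

lemma theta_ring_monomial:
  assumes p: "prime p" "CHAR('r::comm_ring_1) = p" and B: "B \<in> theta_ring p e"
  shows "(\<forall>g h. B (g + h) = B g + B h) \<and>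
    (\<exists>Q. (\<forall>j. Q j \<in> diff_ops p e) \<and> (\<forall>j k. Q (j + k * p ^ e) = Q j) \<and>
      (\<forall>b j. B (Polynomial.monom (b :: 'r) j) = Polynomial.monom (Q j b) j))"
  using B
proof (induction rule: theta_ring.induct)
  case one
  show ?case by (auto simp: diff_ops_def intro!: exI[of _ "\<lambda>_ b. b"])
next
  case (diff P)
  have add: "P (a + b) = P a + P b" for a b using diff by (simp add: diff_ops_def)
  then have "P 0 = 0" using add[of 0 0] by simp
  then show ?case using diff add
    by (auto simp: map_poly_monom coeff_map_poly poly_eq_iff intro!: exI[of _ "\<lambda>_. P"])
next
  case (theta l)
  have per: "(of_nat (j + k * p ^ e choose p ^ l) :: 'r) = of_nat (j choose p ^ l)" for j k
  proof -
    obtain h where h: "e = l + Suc h" using theta less_imp_Suc_add by fastforce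
    have "(j + k * p ^ e) div p ^ l mod p = (j + p ^ l * (p * (k * p ^ h))) div p ^ l mod p"
      by (simp add: h power_add mult_ac)
    also have "\<dots> = j div p ^ l mod p" using prime_gt_0_nat[OF p(1)] by simp
    finally show ?thesis unfolding of_nat_choose_prime_power[OF p] by simp
  qed
  show ?case unfolding theta_eq_diag_op
    by (auto simp: diag_op_add diag_op_monom per diff_ops_def algebra_simps
        intro!: exI[of _ "\<lambda>j b. of_nat (j choose p ^ l) * b"])
next
  case (add A B)
  then obtain Q Q' where "\<forall>j. Q j \<in> diff_ops p e" "\<forall>j k. Q (j + k * p ^ e) = Q j"
      "\<forall>b j. A (Polynomial.monom b j) = Polynomial.monom (Q j b) j"
      "\<forall>j. Q' j \<in> diff_ops p e" "\<forall>j k. Q' (j + k * p ^ e) = Q' j"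
      "\<forall>b j. B (Polynomial.monom b j) = Polynomial.monom (Q' j b) j" by blast
  then show ?case using add.IH
    by (auto simp: diff_ops_def algebra_simps add_monom intro!: exI[of _ "\<lambda>j b. Q j b + Q' j b"])
next
  case (uminus A)
  then obtain Q where "\<forall>j. Q j \<in> diff_ops p e" "\<forall>j k. Q (j + k * p ^ e) = Q j"
      "\<forall>b j. A (Polynomial.monom b j) = Polynomial.monom (Q j b) j" by blast
  then show ?case using uminus.IH
    by (auto simp: diff_ops_def minus_monom intro!: exI[of _ "\<lambda>j b. - Q j b"])
next
  case (comp A B)
  then obtain Q Q' where "\<forall>j. Q j \<in> diff_ops p e" "\<forall>j k. Q (j + k * p ^ e) = Q j"
      "\<forall>b j. A (Polynomial.monom b j) = Polynomial.monom (Q j b) j"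
      "\<forall>j. Q' j \<in> diff_ops p e" "\<forall>j k. Q' (j + k * p ^ e) = Q' j"
      "\<forall>b j. B (Polynomial.monom b j) = Polynomial.monom (Q' j b) j" by blast
  then show ?case using comp.IH
    by (auto simp: diff_ops_def intro!: exI[of _ "\<lambda>j b. Q j (Q' j b)"])
qed

lemma poly_additive_eqI:
  fixes \<psi> \<chi> :: "'r::comm_ring_1 poly \<Rightarrow> 'm::ab_group_add"
  assumes "Modules.additive \<psi>" "Modules.additive \<chi>"
    and "\<And>b j. \<psi> (Polynomial.monom b j) = \<chi> (Polynomial.monom b j)"
  shows "\<psi> = \<chi>"
proof
  fix g
  have "\<psi> (\<Sum>i\<le>Polynomial.degree g. Polynomial.monom (Polynomial.coeff g i) i)
      = \<chi> (\<Sum>i\<le>Polynomial.degree g. Polynomial.monom (Polynomial.coeff g i) i)"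
    unfolding Modules.additive.sum[OF assms(1)] Modules.additive.sum[OF assms(2)] assms(3) ..
  then show "\<psi> g = \<chi> g" by (simp only: Polynomial.poly_as_sum_of_monoms)
qed

section \<open>The modules \<open>A^e\<close> and \<open>N^e\<close> through maps graded by the
  exponent\<close>

locale graph_module = cartier_module scale p \<kappa>
  for scale :: "'r::comm_ring_1 \<Rightarrow> 'm::ab_group_add \<Rightarrow> 'm" (infixr \<open>*s\<close> 75) and p \<kappa> +
  fixes f :: 'r and e :: nat and L :: "(('r \<Rightarrow> 'r) \<times> 'r) list"
  assumes prime_p: "prime p" and char_p: "CHAR('r) = p"
    and dual: "\<forall>(\<phi>, x)\<in>set L. frob_dual (p ^ e) \<phi>"
    and expansion: "frob_expansion (p ^ e) L r = r"
begin

definition graph_map :: "'m \<Rightarrow> 'r poly \<Rightarrow> 'm" where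
  "graph_map m = (\<lambda>g. (\<kappa> ^^ e) (poly g f *s m))"

text \<open>The \<open>R[t]\<close>-linear maps \<open>F\<^sup>e\<^sub>*R[t] \<rightarrow> \<gamma>\<^sub>*M\<close> sending \<open>F\<^sup>e\<^sub>*(R t\<^sup>j)\<close> into \<open>S j\<close>.\<close>

definition graded_map :: "(nat \<Rightarrow> 'm set) \<Rightarrow> ('r poly \<Rightarrow> 'm) \<Rightarrow> bool" where
  "graded_map S \<psi> \<longleftrightarrow> Modules.additive \<psi> \<and>
     (\<forall>r b j k. \<psi> (Polynomial.monom (r ^ (p ^ e) * b) (j + k * p ^ e)) = r *s f ^ k *s \<psi> (Polynomial.monom b j)) \<and>
     (\<forall>b j. \<psi> (Polynomial.monom b j) \<in> S j)"

lemma graded_map_zero: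
  assumes "\<And>j. subspace (S j)" shows "graded_map S (\<lambda>_. 0)"
  using subspace_0[OF assms] by (simp add: graded_map_def Modules.additive_def)

lemma graded_map_add:
  assumes "\<And>j. subspace (S j)" "graded_map S \<psi>" "graded_map S \<chi>"
  shows "graded_map S (\<lambda>g. \<psi> g + \<chi> g)"
  using assms(2,3) subspace_add[OF assms(1)]
  by (simp add: graded_map_def Modules.additive_def scale_right_distrib add_ac)

lemma graded_map_comp:
  assumes \<psi>: "graded_map S \<psi>" and B: "B \<in> theta_ring p e"
  shows "graded_map S (\<psi> \<circ> B)"
proof -
  obtain Q where add: "\<And>g h. B (g + h) = B g + B h" and Q: "\<And>j. Q j \<in> diff_ops p e" "\<And>j k. Q (j + k * p ^ e) = Q j"
    "\<And>b j. B (Polynomial.monom b j) = Polynomial.monom (Q j b) j"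
    using theta_ring_monomial[OF prime_p char_p B] by blast
  have lin: "Q j (r ^ (p ^ e) * b) = r ^ (p ^ e) * Q j b" for r b j using Q(1) by (simp add: diff_ops_def)
  show ?thesis
    using \<psi> unfolding graded_map_def Modules.additive_def by (simp add: add Q lin)
qed

lemma graph_map_monom: "graph_map m (Polynomial.monom b j) = (\<kappa> ^^ e) (f ^ j *s b *s m)"
  by (simp add: graph_map_def poly_monom scale_scale mult.commute)

lemma additive_graph_map: "Modules.additive (graph_map m)"
  by unfold_locales (simp add: graph_map_def scale_left_distrib kappa_pow_add)

lemma graded_map_graph_map:
  assumes "\<And>b j. (\<kappa> ^^ e) (f ^ j *s b *s m) \<in> S j"
  shows "graded_map S (graph_map m)"
proof -
  have "graph_map m (Polynomial.monom (r ^ (p ^ e) * b) (j + k * p ^ e))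
      = r *s f ^ k *s graph_map m (Polynomial.monom b j)" for r b j k
  proof -
    have "f ^ (j + k * p ^ e) *s (r ^ (p ^ e) * b) *s m = (r * f ^ k) ^ (p ^ e) *s (f ^ j *s b *s m)"
      by (simp add: scale_scale power_add power_mult power_mult_distrib mult_ac)
    then show ?thesis unfolding graph_map_monom by (simp only: kappa_pow_scale) (simp add: scale_scale)
  qed
  then show ?thesis using assms unfolding graded_map_def by (simp add: additive_graph_map graph_map_monom)
qed

lemma graded_map_right_submodule_gen:
  assumes S: "\<And>j. subspace (S j)" and G: "\<And>\<psi>. \<psi> \<in> G \<Longrightarrow> graded_map S \<psi>"
    and "\<psi> \<in> right_submodule_gen (theta_ring p e) G"
  shows "graded_map S \<psi>"
  using assms(3)
proof (induction rule: right_submodule_gen.induct)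
  case (act \<psi> P)
  then show ?case by (intro graded_map_comp)
qed (simp_all add: G graded_map_zero[OF S] graded_map_add[OF S])

abbreviation AM :: "('r poly \<Rightarrow> 'm) set" where "AM \<equiv> A_mod scale p \<kappa> f e"
abbreviation AtM :: "('r poly \<Rightarrow> 'm) set" where "AtM \<equiv> At_mod scale p \<kappa> f e"

text \<open>Since \<open>t\<close> acts as \<open>f\<close>, a generator sends \<open>b t^j\<close>
  to \<open>\<kappa>^e(f^j b m)\<close>. This and the next lemma bound the values in each degree
  from above; the converse, which needs the dual basis, is
  \<open>digits_proj_mem_At_mod\<close>.\<close>

lemma A_mod_graded: "\<psi> \<in> AM \<Longrightarrow> graded_map (kimg f e) \<psi>"
  unfolding A_mod_def
proof (erule graded_map_right_submodule_gen[rotated 2])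
  fix \<psi> assume "\<psi> \<in> graph_maps scale \<kappa> f e UNIV"
  then obtain m where "\<psi> = graph_map m" by (auto simp: graph_maps_def graph_map_def)
  then show "graded_map (kimg f e) \<psi>"
    by (auto intro!: graded_map_graph_map simp: kimg_def)
qed (rule subspace_kimg)

lemma At_mod_graded: "\<psi> \<in> AtM \<Longrightarrow> graded_map (\<lambda>j. kimg f e (Suc j)) \<psi>"
  unfolding At_mod_def
proof (erule graded_map_right_submodule_gen[rotated 2])
  fix \<psi> assume "\<psi> \<in> graph_maps scale \<kappa> f e (range (scale f))"
  then obtain m where \<psi>: "\<psi> = graph_map (f *s m)" by (auto simp: graph_maps_def graph_map_def)
  have "(\<kappa> ^^ e) (f ^ j *s b *s f *s m) \<in> kimg f e (Suc j)" for b j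
  proof -
    have "f ^ j *s b *s f *s m = f ^ Suc j *s (b *s m)" by (simp add: scale_scale mult_ac)
    then show ?thesis unfolding kimg_def by simp
  qed
  then show "graded_map (\<lambda>j. kimg f e (Suc j)) \<psi>" unfolding \<psi> by (rule graded_map_graph_map)
qed (rule subspace_kimg)

lemma A_mod_closed:
  "(\<lambda>_. 0) \<in> AM" "graph_map m \<in> AM" "\<psi> \<in> AM \<Longrightarrow> B \<in> theta_ring p e \<Longrightarrow> \<psi> \<circ> B \<in> AM"
  unfolding A_mod_def graph_map_def
  by (auto simp: graph_maps_def intro: right_submodule_gen.intros)

lemma At_mod_closed:
  "(\<lambda>_. 0) \<in> AtM" "graph_map (f *s m) \<in> AtM" "\<psi> \<in> AtM \<Longrightarrow> B \<in> theta_ring p e \<Longrightarrow> \<psi> \<circ> B \<in> AtM"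
  "\<psi> \<in> AtM \<Longrightarrow> \<chi> \<in> AtM \<Longrightarrow> (\<lambda>g. \<psi> g + \<chi> g) \<in> AtM"
  unfolding At_mod_def graph_map_def
  by (auto simp: graph_maps_def intro: right_submodule_gen.intros)

text \<open>The inductive definition has no clause for negatives; they come from precomposing with
  the operator \<open>- id\<close>, as every member is additive.\<close>

lemma At_mod_uminus:
  assumes "\<psi> \<in> AtM" shows "(\<lambda>g. - \<psi> g) \<in> AtM"
proof -
  have "Modules.additive \<psi>" using At_mod_graded[OF assms] by (simp add: graded_map_def)
  then have "\<psi> \<circ> (\<lambda>g. - id g) = (\<lambda>g. - \<psi> g)" by (simp add: fun_eq_iff Modules.additive.minus)
  then show ?thesis
    using At_mod_closed(3)[OF assms theta_ring.uminus[OF theta_ring.one]] by simp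
qed

lemma At_mod_diff: "\<psi> \<in> AtM \<Longrightarrow> \<chi> \<in> AtM \<Longrightarrow> (\<lambda>g. \<psi> g - \<chi> g) \<in> AtM"
  using At_mod_closed(4)[of \<psi> "\<lambda>g. - \<chi> g"] At_mod_uminus[of \<chi>] by simp

lemma At_mod_sum_list:
  "(\<And>x. x \<in> set xs \<Longrightarrow> h x \<in> AtM) \<Longrightarrow> (\<lambda>g. \<Sum>x\<leftarrow>xs. h x g) \<in> AtM"
  by (induction xs) (simp_all add: At_mod_closed(1,4))

lemma N_class_eq_iff:
  "N_class scale p \<kappa> f e \<psi> = N_class scale p \<kappa> f e \<chi> \<longleftrightarrow> (\<lambda>g. \<psi> g - \<chi> g) \<in> AtM"
proof
  assume eq: "N_class scale p \<kappa> f e \<psi> = N_class scale p \<kappa> f e \<chi>"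
  have "\<psi> \<in> N_class scale p \<kappa> f e \<psi>" unfolding N_class_def using At_mod_closed(1) by force
  then obtain \<omega> where "\<psi> = (\<lambda>g. \<chi> g + \<omega> g)" "\<omega> \<in> AtM" unfolding eq by (auto simp: N_class_def)
  then show "(\<lambda>g. \<psi> g - \<chi> g) \<in> AtM" by simp
next
  have sub: "N_class scale p \<kappa> f e \<psi> \<subseteq> N_class scale p \<kappa> f e \<chi>" if d: "(\<lambda>g. \<psi> g - \<chi> g) \<in> AtM" for \<psi> \<chi>
  proof
    fix \<omega> assume "\<omega> \<in> N_class scale p \<kappa> f e \<psi>"
    then obtain \<eta> where \<eta>: "\<omega> = (\<lambda>g. \<psi> g + \<eta> g)" "\<eta> \<in> AtM" by (auto simp: N_class_def)
    have "\<omega> = (\<lambda>g. \<chi> g + ((\<psi> g - \<chi> g) + \<eta> g))" unfolding \<eta>(1) by (simp add: fun_eq_iff)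
    then show "\<omega> \<in> N_class scale p \<kappa> f e \<chi>"
      unfolding N_class_def using At_mod_closed(4)[OF d \<eta>(2)]
      by (intro CollectI exI[of _ "\<lambda>g. \<psi> g - \<chi> g + \<eta> g"] conjI)
  qed
  assume d: "(\<lambda>g. \<psi> g - \<chi> g) \<in> AtM"
  then have "(\<lambda>g. \<chi> g - \<psi> g) \<in> AtM" using At_mod_uminus[OF d] by simp
  then show "N_class scale p \<kappa> f e \<psi> = N_class scale p \<kappa> f e \<chi>" using sub d by blast
qed

text \<open>Modulo \<open>AtM\<close> the factor \<open>Y\<close>, which is
  \<open>theta (p ^ k) - i\<close>, kills an eigenvector, and the digit projection is
  \<open>1 - Y Z\<close>. Operators act from the right, so \<open>Y\<close> is placed leftmost to
  meet \<open>\<psi>\<close> before the rest.\<close>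

lemma eigen_digits_proj:
  assumes \<psi>: "\<psi> \<in> AM" and "k \<le> e"
    and eig: "\<And>l. l < e \<Longrightarrow> (\<lambda>g. (\<psi> \<circ> theta (p ^ l)) g - of_nat (j div p ^ l mod p) *s \<psi> g) \<in> AtM"
  shows "(\<lambda>g. (\<psi> \<circ> digits_proj p k j) g - \<psi> g) \<in> AtM"
  using assms(2)
proof (induction k)
  case 0
  show ?case by (simp add: digits_proj_0 prime_p char_p At_mod_closed(1))
next
  case (Suc k)
  have add: "Modules.additive \<psi>" using A_mod_graded[OF \<psi>] by (simp add: graded_map_def)
  define i where "i = j div p ^ k mod p"
  define Y where "Y = diag_op (\<lambda>n. of_nat (n choose p ^ k) - of_nat i :: 'r)"
  define Z where "Z = diag_op (\<lambda>n. (of_nat (n choose p ^ k) - of_nat i :: 'r) ^ (p - 2))"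
  have Y: "Y g = theta (p ^ k) g - (\<Sum>_<i. g)" for g
    unfolding Y_def theta_eq_diag_op
    by (intro poly_eqI) (simp add: coeff_diag_op left_diff_distrib of_nat_poly)
  have "\<psi> (Y g) = \<psi> (theta (p ^ k) g) - of_nat i *s \<psi> g" for g
    unfolding Y Modules.additive.diff[OF add] Modules.additive.sum[OF add] sum_constant_scale by simp
  then have "\<psi> \<circ> Y \<in> AtM" using eig[of k] Suc.prems by (simp add: i_def o_def)
  moreover have Z: "Z \<in> theta_ring p e"
    unfolding Z_def diag_in_theta_ring_def[symmetric] using Suc.prems
    by (intro diag_in_theta_ring_diff diag_in_theta_ring_power
        diag_in_theta_ring_choose diag_in_theta_ring_of_nat) simp
  ultimately have YZ: "\<psi> \<circ> Y \<circ> Z \<in> AtM" by (rule At_mod_closed(3))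
  have p: "p - 1 = Suc (p - 2)" using prime_ge_2_nat[OF prime_p] by simp
  have "digit_op p k i g = g - Y (Z g)" for g :: "'r poly"
    unfolding digit_op_def Y_def Z_def p
    by (intro poly_eqI) (simp add: coeff_diag_op left_diff_distrib mult.assoc)
  then have digit: "\<psi> (digit_op p k i g) = \<psi> g - \<psi> (Y (Z g))" for g
    by (simp add: Modules.additive.diff[OF add])
  have proj: "(digits_proj p k j :: 'r poly \<Rightarrow> _) \<in> theta_ring p e"
    using digits_proj_in_theta_ring[OF prime_p char_p] Suc.prems by simp
  have "\<psi> \<circ> Y \<circ> Z \<circ> digits_proj p k j \<in> AtM" using YZ proj by (rule At_mod_closed(3))
  from At_mod_diff[OF Suc.IH this] Suc.prems
  have "(\<lambda>g. (\<psi> \<circ> digits_proj p k j) g - \<psi> g - (\<psi> \<circ> Y \<circ> Z \<circ> digits_proj p k j) g) \<in> AtM" by simp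
  moreover have "(\<psi> \<circ> digits_proj p (Suc k) j) g - \<psi> g
      = (\<psi> \<circ> digits_proj p k j) g - \<psi> g - (\<psi> \<circ> Y \<circ> Z \<circ> digits_proj p k j) g" for g
    unfolding digits_proj_Suc[OF prime_p char_p] i_def[symmetric] by (simp add: digit)
  ultimately show ?case by (simp only:)
qed

text \<open>The dual basis expresses a map on \<open>F\<^sup>e\<^sub>*R\<close> through the values on its members, so a map with values in
  \<open>\<kappa>\<^sup>e(f\<^sup>j\<^sup>+\<^sup>1M)\<close> lies in the \<open>\<D>\<^sup>e\<^sub>R\<close>-module generated by \<open>b \<mapsto> \<kappa>\<^sup>e(bf\<^sup>j\<^sup>+\<^sup>1n)\<close>.\<close>

lemma digits_proj_mem_At_mod:
  assumes \<psi>: "graded_map S \<psi>" and j: "j < p ^ e" and S: "S j \<subseteq> kimg f e (Suc j)"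
  shows "\<psi> \<circ> digits_proj p e j \<in> AtM"
proof -
  define q where "q = p ^ e"
  have add: "Modules.additive \<psi>" and
    lin: "\<And>r b j k. \<psi> (Polynomial.monom (r ^ q * b) (j + k * q)) = r *s f ^ k *s \<psi> (Polynomial.monom b j)"
    using \<psi> by (auto simp: graded_map_def q_def)
  have "\<exists>n. \<psi> (Polynomial.monom x j) = (\<kappa> ^^ e) (f ^ Suc j *s n)" for x
    using \<psi> S unfolding graded_map_def kimg_def by blast
  then obtain n where n: "\<And>x. \<psi> (Polynomial.monom x j) = (\<kappa> ^^ e) (f ^ Suc j *s n x)" by metis
  \<comment> \<open>\<open>b \<mapsto> \<phi>(b)^q\<close> is the composite of \<open>\<phi>\<close>
    from \<open>F^e_*R\<close> to \<open>R\<close> with Frobenius from \<open>R\<close> back to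
    \<open>F^e_*R\<close>, hence an operator of level \<open>e\<close>.\<close>
  define D where "D \<phi> = map_poly (\<lambda>b. \<phi> b ^ q)" for \<phi> :: "'r \<Rightarrow> 'r"
  define \<chi> where "\<chi> = (\<lambda>g. \<Sum>(\<phi>, x)\<leftarrow>L. (graph_map (f *s n x) \<circ> D \<phi> \<circ> digits_proj p e j) g)"
  have proj: "(digits_proj p e j :: 'r poly \<Rightarrow> _) \<in> theta_ring p e"
    using digits_proj_in_theta_ring[OF prime_p char_p] by simp
  have \<phi>: "\<phi> (a + b) = \<phi> a + \<phi> b" "\<phi> (r ^ q * a) = r * \<phi> a" "\<phi> 0 = 0"
    if "(\<phi>, x) \<in> set L" for \<phi> x a b r
  proof -
    have fd: "frob_dual q \<phi>" using dual that by (auto simp: q_def)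
    then show 1: "\<phi> (a + b) = \<phi> a + \<phi> b" "\<phi> (r ^ q * a) = r * \<phi> a" for a b r
      by (auto simp: frob_dual_def)
    show "\<phi> 0 = 0" using 1(1)[of 0 0] by simp
  qed
  have q0: "0 < q" using prime_gt_0_nat[OF prime_p] by (simp add: q_def)
  have Dring: "D \<phi> \<in> theta_ring p e" if m: "(\<phi>, x) \<in> set L" for \<phi> x
    unfolding D_def
  proof (rule theta_ring.diff)
    show "(\<lambda>b. \<phi> b ^ q) \<in> diff_ops p e"
      using \<phi>[OF m] prime_p char_p unfolding diff_ops_def q_def
      by (simp add: freshmans_dream' power_mult_distrib)
  qed
  have "graph_map (f *s n (snd x)) \<circ> D (fst x) \<circ> digits_proj p e j \<in> AtM" if "x \<in> set L" for x
    using that by (intro At_mod_closed(2,3) proj Dring[of _ "snd x"]) simp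
  from At_mod_sum_list[of L "\<lambda>x. graph_map (f *s n (snd x)) \<circ> D (fst x) \<circ> digits_proj p e j", OF this]
  have "\<chi> \<in> AtM" unfolding \<chi>_def split_def .
  moreover have "\<psi> \<circ> digits_proj p e j = \<chi>"
  proof (rule poly_additive_eqI)
    have padd: "digits_proj p e j (g + h) = digits_proj p e j g + digits_proj p e j h" for g h :: "'r poly"
      by (simp add: digits_proj_def diag_op_add)
    show "Modules.additive (\<psi> \<circ> digits_proj p e j)"
      by unfold_locales (simp add: padd Modules.additive.add[OF add])
    have "graded_map (\<lambda>j. kimg f e (Suc j)) \<chi>" using \<open>\<chi> \<in> AtM\<close> by (rule At_mod_graded)
    then show "Modules.additive \<chi>" by (simp add: graded_map_def)
    fix b :: 'r and m
    have pm: "digits_proj p e j (Polynomial.monom b m) = (if m mod q = j then Polynomial.monom b m else 0)"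
      using digits_proj_eq[OF prime_p char_p j] by (simp add: diag_op_monom q_def)
    show "(\<psi> \<circ> digits_proj p e j) (Polynomial.monom b m) = \<chi> (Polynomial.monom b m)"
    proof (cases "m mod q = j")
      case False
      have "graph_map (f *s n x) (D \<phi> 0) = 0" for \<phi> x
        by (simp add: D_def graph_map_def kappa_pow_zero)
      then have "\<chi> (Polynomial.monom b m) = 0"
        unfolding \<chi>_def using pm False by (simp add: split_def)
      then show ?thesis using pm False by (simp add: Modules.additive.zero[OF add])
    next
      case True
      then obtain k where k: "m = j + k * q" by (metis mod_div_decomp add.commute)
      have summand: "graph_map (f *s n x) (D \<phi> (Polynomial.monom b m)) = f ^ k *s \<phi> b *s \<psi> (Polynomial.monom x j)"
        if m: "(\<phi>, x) \<in> set L" for \<phi> x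
      proof -
        have "D \<phi> (Polynomial.monom b m) = Polynomial.monom (\<phi> b ^ q) m"
          unfolding D_def using \<phi>(3)[OF m] q0 by (simp add: map_poly_monom power_0_left)
        then have "graph_map (f *s n x) (D \<phi> (Polynomial.monom b m)) = (\<kappa> ^^ e) (f ^ m *s \<phi> b ^ q *s f *s n x)"
          by (simp add: graph_map_monom)
        \<comment> \<open>With \<open>m = j + k q\<close> everything but \<open>f^(j+1) n x\<close>
          is a \<open>q\<close>-th power and can leave \<open>\<kappa>^e\<close>.\<close>
        also have "f ^ m *s \<phi> b ^ q *s f *s n x = (f ^ k * \<phi> b) ^ q *s (f ^ Suc j *s n x)"
          by (simp add: k scale_scale power_add power_mult power_mult_distrib mult_ac)
        also have "(\<kappa> ^^ e) \<dots> = f ^ k *s \<phi> b *s \<psi> (Polynomial.monom x j)"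
          unfolding q_def kappa_pow_scale by (simp add: n scale_scale)
        finally show ?thesis .
      qed
      have "\<psi> (Polynomial.monom b m) = f ^ k *s \<psi> (Polynomial.monom b j)"
        using lin[of 1 b j k] by (simp add: k)
      also have "\<psi> (Polynomial.monom b j) = (\<Sum>(\<phi>, x)\<leftarrow>L. \<phi> b *s \<psi> (Polynomial.monom x j))"
      proof -
        have "\<psi> (Polynomial.monom (\<Sum>(\<phi>, x)\<leftarrow>K. \<phi> b ^ q * x) j) = (\<Sum>(\<phi>, x)\<leftarrow>K. \<phi> b *s \<psi> (Polynomial.monom x j))"
          for K :: "(('r \<Rightarrow> 'r) \<times> 'r) list"
        proof (induction K)
          case (Cons a K)
          obtain \<phi> x where a: "a = (\<phi>, x)" by force
          show ?case using Cons lin[of "\<phi> b" x j 0]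
            by (simp add: a add_monom[symmetric] Modules.additive.add[OF add])
        qed (simp add: Modules.additive.zero[OF add])
        moreover have "(\<Sum>(\<phi>, x)\<leftarrow>L. \<phi> b ^ q * x) = b"
          using expansion[of b] by (simp add: frob_expansion_def q_def)
        ultimately show ?thesis by metis
      qed
      also have "f ^ k *s (\<Sum>(\<phi>, x)\<leftarrow>L. \<phi> b *s \<psi> (Polynomial.monom x j))
          = (\<Sum>(\<phi>, x)\<leftarrow>L. f ^ k *s \<phi> b *s \<psi> (Polynomial.monom x j))"
      proof -
        have "c *s sum_list xs = (\<Sum>x\<leftarrow>xs. c *s x)" for c xs
          by (induction xs) (simp_all add: scale_right_distrib)
        then show ?thesis by (simp add: o_def split_def)
      qed
      also have "\<dots> = \<chi> (Polynomial.monom b m)"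
        unfolding \<chi>_def using summand pm True
        by (intro arg_cong[of _ _ sum_list] map_cong refl) auto
      finally show ?thesis using pm True by simp
    qed
  qed
  ultimately show ?thesis by simp
qed

text \<open>Positions start at 1 with the lowest digit, matching the exponent
  \<open>e + 1 - l\<close> in \<open>BS_poly\<close>: the associated root is
  \<open>j / p^e\<close>.\<close>

definition digit_tuple :: "nat \<Rightarrow> nat \<Rightarrow> nat" where
  "digit_tuple j = (\<lambda>l\<in>{1..e}. j div p ^ (l - 1) mod p)"

text \<open>Equal images force every eigenvector to be congruent to its projection, which lies in
  \<open>AtM\<close>. For different images some \<open>\<kappa>^e(f^j m)\<close> is outside the
  smaller one, and the projected generator at \<open>m\<close> is an eigenvector that takes this
  value at \<open>t^j\<close>.\<close>

lemma N_eigen_nontrivial_iff: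
  assumes j: "j < p ^ e"
  shows "N_eigen scale p \<kappa> f e (digit_tuple j) \<noteq> {N_class scale p \<kappa> f e (\<lambda>_. 0)}
    \<longleftrightarrow> kimg f e j \<noteq> kimg f e (Suc j)"
proof
  assume ne: "N_eigen scale p \<kappa> f e (digit_tuple j) \<noteq> {N_class scale p \<kappa> f e (\<lambda>_. 0)}"
  show "kimg f e j \<noteq> kimg f e (Suc j)"
  proof
    assume eq: "kimg f e j = kimg f e (Suc j)"
    have "N_class scale p \<kappa> f e \<psi> = N_class scale p \<kappa> f e (\<lambda>_. 0)"
      if \<psi>: "\<psi> \<in> AM" and eig: "\<forall>l\<in>{1..e}. N_class scale p \<kappa> f e (\<psi> \<circ> theta (p ^ (l - 1))) =
                     N_class scale p \<kappa> f e (\<lambda>g. of_nat (digit_tuple j l) *s \<psi> g)" for \<psi>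
    proof -
      have "(\<lambda>g. (\<psi> \<circ> digits_proj p e j) g - \<psi> g) \<in> AtM"
      proof (rule eigen_digits_proj[OF \<psi> order_refl])
        fix l assume "l < e"
        then have "Suc l \<in> {1..e}" by simp
        from bspec[OF eig this] this
        show "(\<lambda>g. (\<psi> \<circ> theta (p ^ l)) g - of_nat (j div p ^ l mod p) *s \<psi> g) \<in> AtM"
          unfolding N_class_eq_iff by (simp add: digit_tuple_def)
      qed
      moreover have "\<psi> \<circ> digits_proj p e j \<in> AtM"
        using digits_proj_mem_At_mod[OF A_mod_graded[OF \<psi>] j] eq by simp
      ultimately have "(\<lambda>g. (\<psi> \<circ> digits_proj p e j) g - ((\<psi> \<circ> digits_proj p e j) g - \<psi> g)) \<in> AtM"
        by (rule At_mod_diff[rotated])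
      then show ?thesis by (simp add: N_class_eq_iff)
    qed
    \<comment> \<open>The zero class belongs to every eigenspace, so differing from its singleton
      means having a nonzero class.\<close>
    moreover have "N_class scale p \<kappa> f e (\<lambda>_. 0) \<in> N_eigen scale p \<kappa> f e (digit_tuple j)"
      unfolding N_eigen_def using A_mod_closed(1) by (auto intro!: exI[of _ "\<lambda>_. 0"] simp: o_def)
    ultimately show False using ne unfolding N_eigen_def by blast
  qed
next
  assume ne: "kimg f e j \<noteq> kimg f e (Suc j)"
  have "kimg f e (Suc j) \<subseteq> kimg f e j" by (rule kimg_antimono) simp
  then obtain m where m: "(\<kappa> ^^ e) (f ^ j *s m) \<notin> kimg f e (Suc j)" using ne by (auto simp: kimg_def)
  define \<psi> where "\<psi> = graph_map m \<circ> digits_proj p e j"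
  have \<psi>: "\<psi> \<in> AM" unfolding \<psi>_def
    using digits_proj_in_theta_ring[OF prime_p char_p] by (intro A_mod_closed(2,3)) simp
  have theta: "\<psi> \<circ> theta (p ^ l) = (\<lambda>g. of_nat (j div p ^ l mod p) *s \<psi> g)" if l: "l < e" for l
  proof
    fix g :: "'r poly"
    have "digits_proj p e j (theta (p ^ l) g) = Polynomial.smult (of_nat (j div p ^ l mod p)) (digits_proj p e j g)"
    proof (rule poly_eqI)
      fix n
      have "(of_nat (n choose p ^ l) :: 'r) = of_nat (j div p ^ l mod p)" if "\<forall>l<e. n div p ^ l mod p = j div p ^ l mod p"
        using that l of_nat_choose_prime_power[OF prime_p char_p, of n l] by simp
      then show "Polynomial.coeff (digits_proj p e j (theta (p ^ l) g)) n
          = Polynomial.coeff (Polynomial.smult (of_nat (j div p ^ l mod p)) (digits_proj p e j g)) n"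
        by (cases "\<forall>l<e. n div p ^ l mod p = j div p ^ l mod p")
          (auto simp: digits_proj_def theta_eq_diag_op coeff_diag_op)
    qed
    moreover have "graph_map m (Polynomial.smult (of_nat k) h) = of_nat k *s graph_map m h" for k h
    proof -
      have "graph_map m (Polynomial.smult (of_nat k) h) = graph_map m (\<Sum>_<k. h)"
        by (intro arg_cong[of _ _ "graph_map m"] poly_eqI) (simp add: of_nat_poly)
      then show ?thesis unfolding Modules.additive.sum[OF additive_graph_map] sum_constant_scale by simp
    qed
    ultimately show "(\<psi> \<circ> theta (p ^ l)) g = of_nat (j div p ^ l mod p) *s \<psi> g"
      by (simp add: \<psi>_def)
  qed
  have "\<psi> \<circ> theta (p ^ (l - 1)) = (\<lambda>g. of_nat (digit_tuple j l) *s \<psi> g)" if l: "l \<in> {1..e}" for l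
  proof -
    have "l - 1 < e" using l by auto
    from theta[OF this] show ?thesis using l by (simp add: digit_tuple_def)
  qed
  then have "N_class scale p \<kappa> f e \<psi> \<in> N_eigen scale p \<kappa> f e (digit_tuple j)"
    unfolding N_eigen_def using \<psi> by auto
  moreover have "N_class scale p \<kappa> f e \<psi> \<noteq> N_class scale p \<kappa> f e (\<lambda>_. 0)"
  proof
    assume "N_class scale p \<kappa> f e \<psi> = N_class scale p \<kappa> f e (\<lambda>_. 0)"
    then have "\<psi> \<in> AtM" by (simp add: N_class_eq_iff)
    then have "\<psi> (Polynomial.monom 1 j) \<in> kimg f e (Suc j)" using At_mod_graded by (simp add: graded_map_def)
    moreover have "digits_proj p e j (Polynomial.monom (1 :: 'r) j) = Polynomial.monom 1 j"
      by (simp add: digits_proj_def diag_op_monom)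
    ultimately show False using m by (simp add: \<psi>_def graph_map_monom)
  qed
  ultimately show "N_eigen scale p \<kappa> f e (digit_tuple j) \<noteq> {N_class scale p \<kappa> f e (\<lambda>_. 0)}" by blast
qed

lemma sum_digit_tuple:
  assumes "j < p ^ e"
  shows "(\<Sum>l = 1..e. of_nat (digit_tuple j l) / of_nat p ^ (e + 1 - l) :: rat) = of_nat j / of_nat p ^ e"
proof -
  have p0: "(of_nat p :: rat) \<noteq> 0" using prime_gt_0_nat[OF prime_p] by simp
  have "(\<Sum>l = 1..e. of_nat (digit_tuple j l) / of_nat p ^ (e + 1 - l) :: rat)
      = (\<Sum>l<e. of_nat (j div p ^ l mod p) / of_nat p ^ (e - l))"
    by (rule sum.reindex_bij_witness[of _ Suc "\<lambda>l. l - 1"]) (auto simp: digit_tuple_def)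
  also have "\<dots> = (\<Sum>l<e. of_nat (j div p ^ l mod p) * of_nat p ^ l / of_nat p ^ e)"
  proof (intro sum.cong refl)
    fix l assume "l \<in> {..<e}"
    then have "(of_nat p :: rat) ^ e = of_nat p ^ l * of_nat p ^ (e - l)" by (simp flip: power_add)
    then show "(of_nat (j div p ^ l mod p) / of_nat p ^ (e - l) :: rat)
        = of_nat (j div p ^ l mod p) * of_nat p ^ l / of_nat p ^ e" using p0 by simp
  qed
  also have "\<dots> = of_nat (\<Sum>l<e. (j div p ^ l mod p) * p ^ l) / of_nat p ^ e"
    by (simp add: sum_divide_distrib)
  also have "(\<Sum>l<e. (j div p ^ l mod p) * p ^ l) = j"
    using mod_power_eq_sum_digits[of j p e] assms by simp
  finally show ?thesis .
qed

text \<open>The number \<open>j / p^e\<close> can be read off the tuple, so distinct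
  \<open>j\<close> give distinct tuples; counting does the rest.\<close>

lemma digit_tuple_image: "digit_tuple ` {..<p ^ e} = ({1..e} \<rightarrow>\<^sub>E {0..<p})"
proof (rule card_subset_eq)
  show "finite ({1..e} \<rightarrow>\<^sub>E {0..<p})" by (simp add: finite_PiE)
  show "digit_tuple ` {..<p ^ e} \<subseteq> ({1..e} \<rightarrow>\<^sub>E {0..<p})"
    using prime_gt_0_nat[OF prime_p] by (auto simp: digit_tuple_def)
  have "inj_on digit_tuple {..<p ^ e}"
  proof (rule inj_onI)
    fix i j assume ij: "i \<in> {..<p ^ e}" "j \<in> {..<p ^ e}" "digit_tuple i = digit_tuple j"
    have "(of_nat i :: rat) / of_nat p ^ e = of_nat j / of_nat p ^ e"
      using sum_digit_tuple[of i] sum_digit_tuple[of j] ij by (metis lessThan_iff)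
    then show "i = j" using prime_gt_0_nat[OF prime_p] by auto
  qed
  then show "card (digit_tuple ` {..<p ^ e}) = card ({1..e} \<rightarrow>\<^sub>E {0..<p})"
    by (simp add: card_image card_funcsetE)
qed

lemma BS_poly_roots:
  "{s :: rat. poly (BS_poly scale p \<kappa> f e) s = 0}
    = {of_nat j / of_nat p ^ e | j. j < p ^ e \<and> kimg f e j \<noteq> kimg f e (Suc j)}"
proof -
  define R where "R = {j. j < p ^ e \<and> kimg f e j \<noteq> kimg f e (Suc j)}"
  have idx: "BS_index_set scale p \<kappa> f e = digit_tuple ` R"
    unfolding BS_index_set_def digit_tuple_image[symmetric] R_def using N_eigen_nontrivial_iff by auto
  have "finite (BS_index_set scale p \<kappa> f e)" unfolding idx by (simp add: R_def)
  then have "{s :: rat. poly (BS_poly scale p \<kappa> f e) s = 0}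
      = (\<lambda>i. \<Sum>l = 1..e. of_nat (i l) / of_nat p ^ (e + 1 - l)) ` BS_index_set scale p \<kappa> f e"
    by (auto simp: BS_poly_def poly_prod)
  also have "\<dots> = (\<lambda>j. of_nat j / of_nat p ^ e) ` R"
    unfolding idx image_image by (intro image_cong refl sum_digit_tuple) (simp add: R_def)
  finally show ?thesis by (auto simp: R_def)
qed

end

theorem theorem5p4:
  fixes p :: nat
    and \<phi> :: "'k::field \<Rightarrow> 'r::comm_ring_1"
    and scale :: "'r \<Rightarrow> 'm::ab_group_add \<Rightarrow> 'm"
    and \<kappa> :: "'m \<Rightarrow> 'm"
    and f :: 'r
  assumes "prime p"
    and "CHAR('k) = p"
    and "F_finite p TYPE('k)"
    and "\<phi> \<in> ring_hom (ring_of_type_algebra :: 'k ring) (ring_of_type_algebra :: 'r ring)"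
    and "ess_finite_type \<phi>"
    and "regular_ring TYPE('r)"
    and "cartier_module scale p \<kappa>"
    and "fin_gen_module scale"
    and "F_regular scale \<kappa>"
    and "\<And>m. scale f m = 0 \<Longrightarrow> m = 0"
  shows "\<exists>e0. \<forall>e\<ge>e0.
    of_rat ` {s :: rat. poly (BS_poly scale p \<kappa> f e) s = 0} =
    {(real_of_int \<lceil>x * real p ^ e\<rceil> - 1) / real p ^ e | x :: real.
       0 < x \<and> x \<le> 1 \<and> F_jumping_number scale p \<kappa> f x}"
proof -
  have noeth: "noetherian_module ((*) :: 'r \<Rightarrow> 'r \<Rightarrow> 'r)"
    by (rule noetherian_ring_imp_noetherian_module) (use assms(6) in \<open>simp add: regular_ring_def\<close>)
  then have R: "noetherian_comm_ring TYPE('r)" by (rule noetherian_comm_ring.intro)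
  have hom: "\<phi> 1 = 1" "\<And>a b. \<phi> (a + b) = \<phi> a + \<phi> b" "\<And>a b. \<phi> (a * b) = \<phi> a * \<phi> b"
    using assms(4) by (auto simp: ring_hom_def ring_of_type_algebra_def)
  have hom0: "\<phi> 0 = 0" using hom(2)[of 0 0] by simp
  \<comment> \<open>The characteristic of \<open>R\<close> divides \<open>p\<close> because
    \<open>\<phi>\<close> carries \<open>p = 0\<close> over from the field, and it is not 1 because
    \<open>0 \<noteq> 1\<close> in the type.\<close>
  have "\<phi> (of_nat n) = of_nat n" for n by (induction n) (simp_all add: hom hom0)
  then have "(of_nat p :: 'r) = 0" using hom0 of_nat_CHAR[where 'a = 'k] assms(2) by metis
  then have "CHAR('r) dvd p" by (simp add: of_nat_eq_0_iff_char_dvd)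
  then have char: "CHAR('r) = p" using assms(1) CHAR_not_1[where 'a = 'r] by (auto simp: prime_nat_iff)
  have Ffin: "F_finite p TYPE('r)" using F_finite_ess_finite_type[OF assms(1,2) char assms(3,5) hom] .
  have params: "\<exists>G. regular_params P (sat P {0}) G" if "prime_ideal P" for P :: "'r set"
    using noetherian_comm_ring.regular_local_ring_params[OF R that] assms(6) that
    by (simp add: regular_ring_def)
  obtain L1 :: "(('r \<Rightarrow> 'r) \<times> 'r) list" where
    L1: "\<forall>(\<phi>, x)\<in>set L1. frob_dual p \<phi>" "\<And>r. frob_expansion p L1 r = r"
    using noetherian_comm_ring.frob_expansion_global[OF R assms(1) char Ffin params] by blast
  interpret F_regular_module scale p \<kappa> f
    using assms noeth by (simp add: F_regular_module_def F_regular_module_axioms_def)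
  have "of_rat ` {s :: rat. poly (BS_poly scale p \<kappa> f e) s = 0} =
    {(real_of_int \<lceil>x * real p ^ e\<rceil> - 1) / real p ^ e | x :: real.
       0 < x \<and> x \<le> 1 \<and> F_jumping_number scale p \<kappa> f x}" for e
  proof -
    obtain L :: "(('r \<Rightarrow> 'r) \<times> 'r) list" where
      L: "\<forall>(\<phi>, x)\<in>set L. frob_dual (p ^ e) \<phi>" "\<And>r. frob_expansion (p ^ e) L r = r"
      using noetherian_comm_ring.frob_expansion_iterate[OF R L1 assms(1) char] by blast
    interpret graph_module scale p \<kappa> f e L
      by unfold_locales (use assms(1) char L in auto)
    have "(of_rat ` {s :: rat. poly (BS_poly scale p \<kappa> f e) s = 0} :: real set)
        = {real j / real p ^ e | j. j < p ^ e \<and> kimg f e j \<noteq> kimg f e (Suc j)}"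
      unfolding BS_poly_roots by (force simp: of_rat_divide of_rat_power)
    then show ?thesis unfolding jumping_numbers_image .
  qed
  then show ?thesis by blast
qed

end
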